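(* Let $W=\begin{bmatrix}w_{11}&w_{12}\\ w_{21}&w_{22}\end{bmatrix}\in\mathcal U_\kappa(j_{pq})$ (with $w_{11}$ of size $p\times p$ and $w_{22}$ of size $q\times q$), let $b_2$ be an inner $q\times q$ mvf, and assume that: (iii) if $f\in H_2^m$ and $[0\ \ I_q]Wf\in H_2^q$, then $Wf\in H_2^m$; (iv) $[0\ \ I_q]WH_2^m=b_2^{-1}H_2^q$. Then $s_{21}:=-w_{22}^{-1}w_{21}\in\mathcal S_\kappa^{q\times p}$, and hence $W\in\mathcal U_\kappa^\circ(j_{pq})$.
   Context: $p,q\ge1$, $m=p+q$, $j_{pq}=\begin{bmatrix}I_p&0\\ 0&-I_q\end{bmatrix}$, $\mathbb D=\{|\lambda|<1\}$, $\mathbb T=\partial\mathbb D$, "mvf" = matrix valued function. $H_2^k$ is the $\mathbb C^k$-valued Hardy space of $\mathbb D$; its elements are identified with their boundary values on $\mathbb T$, and products such as $Wf$ are understood as functions a.e. on $\mathbb T$. A $q\times q$ mvf is inner if it is holomorphic and contractive in $\mathbb D$ with unitary boundary values a.e. on $\mathbb T$. A Hermitian kernel has $\kappa$ negative squares if all the associated finite Hermitian Gram matrices have at most $\kappa$ negative eigenvalues, and some has exactly $\kappa$. $\mathcal S_\kappa^{q\times p}$ is the set of $q\times p$ mvf's $s$ meromorphic in $\mathbb D$ for which the kernel $\frac{I_q-s(\lambda)s(\omega)^*}{1-\lambda\overline\omega}$ has $\kappa$ negative squares on the domain of holomorphy of $s$ in $\mathbb D$. $\mathcal U_\kappa(j_{pq})$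 is the class of $m\times m$ mvf's $W$ meromorphic in $\mathbb D$ such that the kernel $\frac{j_{pq}-W(\lambda)j_{pq}W(\omega)^*}{1-\lambda\overline\omega}$ has $\kappa$ negative squares on the domain of holomorphy of $W$ in $\mathbb D$ and the nontangential boundary values satisfy $W(\mu)j_{pq}W(\mu)^*=j_{pq}$ a.e. on $\mathbb T$. For such $W$ the block $w_{22}$ is invertible at all but finitely many points of the domain of holomorphy of $W$ in $\mathbb D$. $\mathcal U_\kappa^\circ(j_{pq})$ is the class of $W\in\mathcal U_\kappa(j_{pq})$ with $-w_{22}^{-1}w_{21}\in\mathcal S_\kappa^{q\times p}$. *)

theory Defs
  imports "Jordan_Normal_Form.Char_Poly" "HOL-Complex_Analysis.Complex_Analysis"
begin

(* Jordan_Normal_Form matrices are used only for Gram matrices, whose size is a variable;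
   everywhere else $ and \<chi> are those of HOL-Analysis. *)
no_notation Matrix.vec_index (infixl "$" 100)

abbreviation unit_disc :: "complex set" (\<open>\<bbbD>\<close>) where
  "\<bbbD> \<equiv> ball 0 1"

subsection \<open>Matrices\<close>

definition conj_transpose :: "complex^'c^'r \<Rightarrow> complex^'r^'c" where
  "conj_transpose A = (\<chi> i j. cnj (A $ j $ i))"

definition j_pq :: "complex^('p::finite + 'q::finite)^('p + 'q)" where
  "j_pq = (\<chi> i j. if i = j then (case i of Inl _ \<Rightarrow> 1 | Inr _ \<Rightarrow> -1) else 0)"

definition block21 :: "complex^('p::finite + 'q::finite)^('p + 'q) \<Rightarrow> complex^'p^'q" where
  "block21 A = (\<chi> i j. A $ Inr i $ Inl j)"

definition block22 :: "complex^('p::finite + 'q::finite)^('p + 'q) \<Rightarrow> complex^'q^'q" where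
  "block22 A = (\<chi> i j. A $ Inr i $ Inr j)"

(* the q x (p + q) matrix [0 I_q] *)
definition zero_id :: "complex^('p::finite + 'q::finite)^'q" where
  "zero_id = (\<chi> i j. if j = Inr i then 1 else 0)"

subsection \<open>Kernels with finitely many negative squares\<close>

definition num_neg_eigenvalues :: "complex mat \<Rightarrow> nat" where
  "num_neg_eigenvalues A =
     (\<Sum>x | x < (0::real) \<and> eigenvalue A (complex_of_real x).
        Polynomial.order (complex_of_real x) (char_poly A))"

(* entries u_i^* K(w_i, w_j) u_j, for i, j < n *)
definition gram_matrix ::
    "(complex \<Rightarrow> complex \<Rightarrow> complex^'k^'k) \<Rightarrow> nat \<Rightarrow> (nat \<Rightarrow> complex) \<Rightarrow> (nat \<Rightarrow> complex^'k)
      \<Rightarrow> complex mat" where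
  "gram_matrix K n w u =
     Matrix.mat n n (\<lambda>(i, j). \<Sum>a\<in>UNIV. cnj (u i $ a) * (K (w i) (w j) *v u j) $ a)"

definition has_negative_squares ::
    "nat \<Rightarrow> complex set \<Rightarrow> (complex \<Rightarrow> complex \<Rightarrow> complex^'k^'k) \<Rightarrow> bool" where
  "has_negative_squares \<kappa> \<Omega> K \<longleftrightarrow>
     (\<forall>z\<in>\<Omega>. \<forall>w\<in>\<Omega>. K w z = conj_transpose (K z w)) \<and>
     (\<forall>n w u. (\<forall>i<n. w i \<in> \<Omega>) \<longrightarrow> num_neg_eigenvalues (gram_matrix K n w u) \<le> \<kappa>) \<and>
     (\<exists>n w u. (\<forall>i<n. w i \<in> \<Omega>) \<and> num_neg_eigenvalues (gram_matrix K n w u) = \<kappa>)"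

subsection \<open>Meromorphic matrix valued functions\<close>

definition mvf_meromorphic :: "(complex \<Rightarrow> complex^'c^'r) \<Rightarrow> bool" where
  "mvf_meromorphic F \<longleftrightarrow> (\<forall>i j. (\<lambda>z. F z $ i $ j) meromorphic_on \<bbbD>)"

(* A total HOL function representing a meromorphic function may take arbitrary values on a sparse
   set. The notions below ignore them: removable singularities are removed, and the domain of
   holomorphy is the complement of the poles. *)
definition mvf_reg :: "(complex \<Rightarrow> complex^'c^'r) \<Rightarrow> complex \<Rightarrow> complex^'c^'r" where
  "mvf_reg F z = (\<chi> i j. remove_sings (\<lambda>w. F w $ i $ j) z)"

definition holomorphy_domain :: "(complex \<Rightarrow> complex^'c^'r) \<Rightarrow> complex set" where
  "holomorphy_domain F = {z \<in> \<bbbD>. \<forall>i j. \<not> is_pole (\<lambda>w. F w $ i $ j) z}"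

definition mvf_kernel ::
    "complex^'r^'r \<Rightarrow> complex^'c^'c \<Rightarrow> (complex \<Rightarrow> complex^'c^'r) \<Rightarrow>
       complex \<Rightarrow> complex \<Rightarrow> complex^'r^'r" where
  "mvf_kernel J J' F z w =
     (\<chi> i j. (J - F z ** J' ** conj_transpose (F w)) $ i $ j / (1 - z * cnj w))"

subsection \<open>Boundary values on the unit circle\<close>

definition stolz_region :: "real \<Rightarrow> complex \<Rightarrow> complex set" where
  "stolz_region \<alpha> \<mu> = {z \<in> \<bbbD>. norm (z - \<mu>) < \<alpha> * (1 - norm z)}"

definition has_nt_limit :: "(complex \<Rightarrow> 'a::topological_space) \<Rightarrow> complex \<Rightarrow> 'a \<Rightarrow> bool" where
  "has_nt_limit F \<mu> L \<longleftrightarrow> (\<forall>\<alpha>>1. (F \<longlongrightarrow> L) (at \<mu> within stolz_region \<alpha> \<mu>))"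

(* unspecified where no nontangential limit exists *)
definition nt_boundary :: "(complex \<Rightarrow> 'a::topological_space) \<Rightarrow> complex \<Rightarrow> 'a" where
  "nt_boundary F \<mu> = (THE L. has_nt_limit F \<mu> L)"

definition ae_circle :: "(complex \<Rightarrow> bool) \<Rightarrow> bool" where
  "ae_circle P \<longleftrightarrow> (AE t in lebesgue_on {0..2*pi}. P (cis t))"

(* equality of two sets of functions on the circle, functions being taken modulo
   almost everywhere equality *)
definition ae_set_eq :: "(complex \<Rightarrow> 'a) set \<Rightarrow> (complex \<Rightarrow> 'a) set \<Rightarrow> bool" where
  "ae_set_eq A B \<longleftrightarrow>
     (\<forall>f\<in>A. \<exists>g\<in>B. ae_circle (\<lambda>\<mu>. f \<mu> = g \<mu>)) \<and>
     (\<forall>g\<in>B. \<exists>f\<in>A. ae_circle (\<lambda>\<mu>. f \<mu> = g \<mu>))"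

(* the product W f on the circle; nt_boundary (mvf_reg W) is what W denotes there *)
definition bd_mult :: "(complex \<Rightarrow> complex^'c^'r) \<Rightarrow> (complex \<Rightarrow> complex^'c) \<Rightarrow> complex \<Rightarrow> complex^'r"
  where "bd_mult W f \<mu> = nt_boundary (mvf_reg W) \<mu> *v f \<mu>"

subsection \<open>Hardy space and inner functions\<close>

definition hardy_disc :: "(complex \<Rightarrow> complex^'k) set" where
  "hardy_disc = {f. (\<forall>i. (\<lambda>z. f z $ i) holomorphic_on \<bbbD>) \<and>
     (\<exists>C. \<forall>r\<in>{0..<1}. integral {0..2*pi} (\<lambda>t. (norm (f (of_real r * cis t)))\<^sup>2) \<le> C)}"

(* The Hardy space as a space of functions on the circle: all representatives of the
   nontangential boundary functions. Values off the circle are irrelevant. *)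
definition H2 :: "(complex \<Rightarrow> complex^'k) set" where
  "H2 = {g. \<exists>f\<in>hardy_disc. ae_circle (\<lambda>\<mu>. has_nt_limit f \<mu> (g \<mu>))}"

definition inner_mvf :: "(complex \<Rightarrow> complex^'k^'k) \<Rightarrow> bool" where
  "inner_mvf b \<longleftrightarrow>
     (\<forall>i j. (\<lambda>z. b z $ i $ j) holomorphic_on \<bbbD>) \<and>
     (\<forall>z\<in>\<bbbD>. \<forall>v. norm (b z *v v) \<le> norm v) \<and>
     ae_circle (\<lambda>\<mu>. \<exists>L. has_nt_limit b \<mu> L \<and>
        L ** conj_transpose L = mat 1 \<and> conj_transpose L ** L = mat 1)"

subsection \<open>The classes\<close>

definition schur_class :: "nat \<Rightarrow> (complex \<Rightarrow> complex^'p^'q) set" where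
  "schur_class \<kappa> = {s. mvf_meromorphic s \<and>
     has_negative_squares \<kappa> (holomorphy_domain s) (mvf_kernel (mat 1) (mat 1) (mvf_reg s))}"

definition U_class :: "nat \<Rightarrow> (complex \<Rightarrow> complex^('p::finite + 'q::finite)^('p + 'q)) set" where
  "U_class \<kappa> = {W. mvf_meromorphic W \<and>
     has_negative_squares \<kappa> (holomorphy_domain W) (mvf_kernel j_pq j_pq (mvf_reg W)) \<and>
     ae_circle (\<lambda>\<mu>. \<exists>L. has_nt_limit (mvf_reg W) \<mu> L \<and> L ** j_pq ** conj_transpose L = j_pq)}"

(* - w22^(-1) w21; at the exceptional points where w22 is singular the value is immaterial,
   as schur_class only depends on s up to values on a sparse set *)
definition s21 :: "(complex \<Rightarrow> complex^('p::finite + 'q::finite)^('p + 'q)) \<Rightarrow> complex \<Rightarrow> complex^'p^'q"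
  where "s21 W z = - (matrix_inv (block22 (W z)) ** block21 (W z))"

definition U_circ_class ::
    "nat \<Rightarrow> (complex \<Rightarrow> complex^('p::finite + 'q::finite)^('p + 'q)) set" where
  "U_circ_class \<kappa> = {W \<in> U_class \<kappa>. s21 W \<in> schur_class \<kappa>}"

end

theory Submission
  imports Defs "Jordan_Normal_Form.Schur_Decomposition" "HOL-Real_Asymp.Real_Asymp"
begin

text \<open>
  Notation: \<open>j\<close> is the signature matrix, vectors \<open>h = (h\<^sub>1, h\<^sub>2)\<close> are split into upper and lower
  components, and \<open>H\<^sub>2\<close> is the Hardy space.

  The Potapov-Ginzburg transform \<open>S\<close> of \<open>W\<close> exchanges the lower components of argument and value:
  \<open>S h = k\<close> holds exactly when \<open>W\<close> maps \<open>(h\<^sub>1, k\<^sub>2)\<close> to \<open>(k\<^sub>1, h\<^sub>2)\<close>. The kernel of \<open>W\<close> is congruent to the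
  Schur kernel of \<open>S\<close> (\<open>pg_kernel_congruence\<close>), so \<open>S\<close> has \<open>\<kappa>\<close> negative squares as well, and \<open>s\<^sub>2\<^sub>1\<close> is the
  lower left block of \<open>S\<close>. A block has no more negative squares than the whole
  (\<open>neg_dim_ge_lower_left\<close>); hence \<open>s\<^sub>2\<^sub>1\<close> has at most \<open>\<kappa>\<close> of them. That it does not have fewer is due to
  the two assumptions on the action of \<open>W\<close> on \<open>H\<^sub>2\<close>.

  The bridge from kernels to \<open>H\<^sub>2\<close> is the multiplication operator. If the Schur kernel of \<open>F\<close> has at most
  \<open>k\<close> negative squares, then among any \<open>k + 1\<close> elements of \<open>H\<^sub>2\<close> there is a nontrivial linear combination
  \<open>h\<close> with \<open>F h\<close> in \<open>H\<^sub>2\<close> (\<open>few_negative_squares_imp_finite_codim\<close>). Conversely, if among any \<open>k\<close> polynomials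
  there is a nontrivial linear combination \<open>h\<close> such that \<open>F h\<close> is in \<open>H\<^sub>2\<close> with norm at most that of \<open>h\<close>, then the
  Schur kernel of \<open>F\<close> has fewer than \<open>k\<close> negative squares
  (\<open>contractive_finite_codim_imp_few_negative_squares\<close>).

  Suppose that \<open>s\<^sub>2\<^sub>1\<close> has fewer than \<open>\<kappa>\<close> negative squares; then so does \<open>S\<close>, which is absurd. Indeed, let \<open>\<kappa>\<close>
  polynomials \<open>h\<close> be given. The lower component of each is \<open>b\<^sub>2\<close> inverse times \<open>b\<^sub>2 h\<^sub>2\<close>, so by (iv) it is the lower
  component of some \<open>W f\<close> with \<open>f\<close> in \<open>H\<^sub>2\<close>, and \<open>W f\<close> is in \<open>H\<^sub>2\<close> by (iii). The upper components of \<open>h\<close> and \<open>f\<close> still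
  differ. After passing to a nontrivial linear combination the difference \<open>x\<close> satisfies \<open>s\<^sub>2\<^sub>1 x \<in> H\<^sub>2\<close>. Adding
  \<open>(x, s\<^sub>2\<^sub>1 x)\<close> to \<open>f\<close> corrects the upper component of \<open>f\<close> and leaves the lower component of \<open>W f\<close> unchanged, since
  \<open>W\<close> maps \<open>(x, s\<^sub>2\<^sub>1 x)\<close> to a vector with zero lower component; (iii) applies once more. Now \<open>S h\<close> consists of the
  upper component of \<open>W f\<close> and the lower component of \<open>f\<close>. It is in \<open>H\<^sub>2\<close>, and it has the norm of \<open>h\<close> because \<open>W\<close> is
  \<open>j\<close>-unitary on the circle (\<open>pgS_contractive_finite_codim\<close>).
\<close>

(* \<bullet> is the scalar product of vectors of variable size, and $v selects their entries. *)
no_notation inner (infix "\<bullet>" 70)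
no_notation Matrix.vec_index (infixl "$" 100)
notation Matrix.vec_index (infixl "$v" 100)

section \<open>Unitary diagonalization of Hermitian matrices\<close>

abbreviation adj :: "complex mat \<Rightarrow> complex mat" where
  "adj X \<equiv> map_mat cnj (transpose_mat X)"

lemma adj_mult:
  assumes "A \<in> carrier_mat n m" "B \<in> carrier_mat m k"
  shows "adj (A * B) = adj B * adj A"
  using assms by (intro eq_matI) (auto simp: scalar_prod_def mult.commute)

lemma adj_four_block:
  assumes "A \<in> carrier_mat n1 m1" "B \<in> carrier_mat n1 m2" "C \<in> carrier_mat n2 m1" "D \<in> carrier_mat n2 m2"
  shows "adj (four_block_mat A B C D) = four_block_mat (adj A) (adj C) (adj B) (adj D)"
  using assms by (intro eq_matI) auto

text \<open>
  Gram-Schmidt applied to a basis that starts with \<open>v\<close>, followed by normalization of the columns.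
\<close>

lemma unitary_mat_with_first_column:
  assumes v: "(v :: complex Matrix.vec) \<in> carrier_vec n" and v0: "v \<noteq> 0\<^sub>v n" and n: "n \<noteq> 0"
  shows "\<exists>W c. W \<in> carrier_mat n n \<and> adj W * W = 1\<^sub>m n \<and> col W 0 = c \<cdot>\<^sub>v v"
proof -
  define b where "b = basis_completion v"
  define ws where "ws = gram_schmidt n b"
  interpret cof_vec_space n "TYPE(complex)" .
  from basis_completion[OF v v0, folded b_def]
  have dist_b: "distinct b" 
    and indep: "\<not> lin_dep (set b)" and b: "set b \<subseteq> carrier_vec n" and hdb: "hd b = v" 
    and len_b: "length b = n" by auto
  from hdb len_b n obtain vs where bv: "b = v # vs" by (cases b, auto)
  from gram_schmidt_result[OF b dist_b indep refl, folded ws_def]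
  have ws: "set ws \<subseteq> carrier_vec n" "corthogonal ws" "length ws = n" 
    by (auto simp: len_b)
  from gram_schmidt_hd[OF v, of vs, folded bv] have hdws: "hd ws = v" unfolding ws_def .
  define d where "d i = complex_of_real (1 / sqrt (\<Sum>l<n. (norm (ws ! i $v l))\<^sup>2))" for i
  define W where "W = Matrix.mat n n (\<lambda>(l, i). d i * (ws ! i $v l))"
  have wsc: "ws ! i \<in> carrier_vec n" if "i < n" for i
    using ws that by (metis nth_mem subsetD)
  have W: "W \<in> carrier_mat n n" by (simp add: W_def)
  have sp: "ws ! j \<bullet>c ws ! i = (\<Sum>l<n. ws ! j $v l * cnj (ws ! i $v l))" if "i < n" "j < n" for i j
    using wsc[OF that(1)] wsc[OF that(2)] by (auto simp: scalar_prod_def atLeast0LessThan intro!: sum.cong)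
  have orth: "(\<Sum>l<n. ws ! j $v l * cnj (ws ! i $v l)) = 0 \<longleftrightarrow> j \<noteq> i" if "i < n" "j < n" for i j
    using corthogonalD[OF ws(2), of j i] that ws(3) sp[OF that] by simp
  have "adj W * W = 1\<^sub>m n"
  proof (intro eq_matI)
    fix i j assume ij: "i < dim_row (1\<^sub>m n :: complex mat)" "j < dim_col (1\<^sub>m n :: complex mat)"
    have e: "(adj W * W) $$ (i, j) = cnj (d i) * d j * (\<Sum>l<n. ws ! j $v l * cnj (ws ! i $v l))"
      using ij by (auto simp: W_def scalar_prod_def sum_distrib_left atLeast0LessThan intro!: sum.cong)
    show "(adj W * W) $$ (i, j) = 1\<^sub>m n $$ (i, j)"
    proof (cases "i = j")
      case True
      let ?s = "\<Sum>l<n. (norm (ws ! i $v l))\<^sup>2"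
      have "(\<Sum>l<n. ws ! i $v l * cnj (ws ! i $v l)) = complex_of_real ?s"
        by (simp only: of_real_sum complex_norm_square)
      moreover have "?s \<ge> 0" by (intro sum_nonneg) auto
      moreover have "?s \<noteq> 0" using orth[of i i] ij calculation(1) by (metis index_one_mat(2) of_real_0)
      ultimately have s: "?s > 0" "(\<Sum>l<n. ws ! i $v l * cnj (ws ! i $v l)) = complex_of_real ?s" by auto
      then have "1 / sqrt ?s * (1 / sqrt ?s) * ?s = 1" by (simp add: field_simps)
      from arg_cong[OF this, of complex_of_real]
      have "cnj (d i) * d i * complex_of_real ?s = 1"
        unfolding d_def complex_cnj_complex_of_real of_real_mult of_real_1 by simp
      then show ?thesis using True ij e s(2) by simp
    next
      case False
      then show ?thesis using ij e orth[of i j] by simp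
    qed
  qed (auto simp: W_def)
  moreover have "col W 0 = d 0 \<cdot>\<^sub>v v"
  proof -
    have "ws ! 0 = v" using hdws ws(3) n by (metis hd_conv_nth length_0_conv)
    then show ?thesis using n v by (intro eq_vecI) (auto simp: W_def)
  qed
  ultimately show ?thesis using W by blast
qed

text \<open>
  Let \<open>W\<close> be unitary with an eigenvector as first column. The first column of \<open>adj W * A * W\<close> vanishes below
  the corner and, \<open>A\<close> being Hermitian, so does the first row to the right of it. The matrix splits into
  a corner and a smaller Hermitian matrix. Starting from a factorization of the characteristic polynomial
  fixes the order and the multiplicities of the diagonal entries.
\<close>

lemma hermitian_unitary_diagonalization:
  assumes "A \<in> carrier_mat n n" "adj A = A" "char_poly A = (\<Prod>e\<leftarrow>es. [:- e, 1:])"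
  shows "\<exists>U. U \<in> carrier_mat n n \<and> adj U * U = 1\<^sub>m n \<and>
           adj U * A * U = Matrix.mat n n (\<lambda>(i, j). if i = j then es ! i else 0)"
  using assms
proof (induct es arbitrary: n A)
  case Nil
  with degree_monic_char_poly[of A n] show ?case
    by (intro exI[of _ "1\<^sub>m 0"]) (auto intro!: eq_matI)
next
  case (Cons e es n A)
  let ?n1 = "n - 1"
  let ?cp = "char_poly A"
  have A: "A \<in> carrier_mat n n" by fact
  from Cons(4)
  have cp: "?cp = [: -e, 1 :] * (\<Prod>e \<leftarrow> es. [:- e, 1:])" by auto
  have mon: "monic (\<Prod>e\<leftarrow> es. [:- e, 1:])" by (rule monic_prod_list, auto)
  have deg: "degree ?cp = Suc (degree (\<Prod>e\<leftarrow> es. [:- e, 1:]))" unfolding cp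
    by (subst degree_mult_eq, insert mon, auto)
  with degree_monic_char_poly[OF A] have n: "n \<noteq> 0" by auto
  have e: "eigenvalue A e" 
    unfolding eigenvalue_root_char_poly[OF A] cp by simp
  then obtain v where v: "v \<in> carrier_vec n" "v \<noteq> 0\<^sub>v n" and ev: "A *\<^sub>v v = e \<cdot>\<^sub>v v"
    using A unfolding eigenvalue_def eigenvector_def by auto
  from unitary_mat_with_first_column[OF v n] obtain W c
    where W: "W \<in> carrier_mat n n" "adj W * W = 1\<^sub>m n" "col W 0 = c \<cdot>\<^sub>v v" by blast
  have W': "adj W \<in> carrier_mat n n" using W by auto
  have WW': "W * adj W = 1\<^sub>m n" using mat_mult_left_right_inverse[OF W' W(1) W(2)] .
  define A' where "A' = adj W * A * W"
  have A': "A' \<in> carrier_mat n n" using W A by (auto simp: A'_def)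
  have adj_invol: "adj (adj X) = X" for X by (intro eq_matI) auto
  have "adj A' = adj W * (A * W)"
    unfolding A'_def using W' W A Cons(3) 
    by (subst adj_mult[of _ n n _ n]; (simp add: adj_mult[of _ n n _ n] adj_invol)?)
  also have "\<dots> = A'" unfolding A'_def using W W' A by (simp add: assoc_mult_mat[of _ n n _ n _ n])
  finally have hA': "adj A' = A'" .
  have hA'2: "cnj (A' $$ (j, i)) = A' $$ (i, j)" if "i < n" "j < n" for i j
    using arg_cong[OF hA', of "\<lambda>M. M $$ (i, j)"] A' that by simp
  have col0: "A' $$ (i, 0) = (if i = 0 then e else 0)" if i: "i < n" for i
  proof -
    have "col A' 0 = adj W *\<^sub>v (A *\<^sub>v col W 0)"
    proof -
      have n': "0 < n" using n by simp
      have "A' = adj W * (A * W)" unfolding A'_def by (rule assoc_mult_mat[OF W' A W(1)])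
      moreover have "A * W \<in> carrier_mat n n" using A W(1) by simp
      ultimately show ?thesis using col_mult2[OF W' _ n', of "A * W"] col_mult2[OF A W(1) n'] by simp
    qed
    also have "A *\<^sub>v col W 0 = e \<cdot>\<^sub>v col W 0"
      using ev A v W by (simp add: mult_mat_vec smult_smult_assoc mult.commute)
    also have "adj W *\<^sub>v (e \<cdot>\<^sub>v col W 0) = e \<cdot>\<^sub>v (adj W *\<^sub>v col W 0)"
      using W(1) n by (intro mult_mat_vec[OF W']) auto
    also have "adj W *\<^sub>v col W 0 = col (adj W * W) 0"
      using W(1) W' n by (intro eq_vecI) auto
    finally have "col A' 0 = e \<cdot>\<^sub>v col (1\<^sub>m n) 0" using W(2) by simp
    from arg_cong[OF this, of "\<lambda>x. x $v i"] show ?thesis using i A' n by auto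
  qed
  obtain A1 A2 A0 A3 where splitA': "split_block A' 1 1 = (A1,A2,A0,A3)"
    by (cases "split_block A' 1 1", auto)
  from A' n have "dim_row A' = 1 + ?n1" "dim_col A' = 1 + ?n1" by auto
  from split_block[OF splitA' this] have A2: "A2 \<in> carrier_mat 1 ?n1"
    and A3: "A3 \<in> carrier_mat ?n1 ?n1" 
    and A'block: "A' = four_block_mat A1 A2 A0 A3" by auto
  have A1id: "A1 = Matrix.mat 1 1 (\<lambda> _. e)"
    using splitA'[unfolded split_block_def Let_def] col0[of 0] A' n by auto
  have A1: "A1 \<in> carrier_mat 1 1" unfolding A1id by auto
  have A0id: "A0 = 0\<^sub>m ?n1 1"
    using splitA'[unfolded split_block_def Let_def] col0 A' n by (auto intro!: eq_matI)
  have A2id: "A2 = 0\<^sub>m 1 ?n1"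
  proof -
    have "A' $$ (0, Suc i) = 0" if "Suc i < n" for i
      using hA'2[of 0 "Suc i"] col0[of "Suc i"] that n by simp
    then show ?thesis
      using splitA'[unfolded split_block_def Let_def] A' n by (auto intro!: eq_matI)
  qed
  have hA3: "adj A3 = A3"
  proof (intro eq_matI)
    fix i j assume "i < dim_row A3" "j < dim_col A3"
    then show "adj A3 $$ (i, j) = A3 $$ (i, j)"
      using splitA'[unfolded split_block_def Let_def] A' n hA'2[of "Suc i" "Suc j"] by auto
  qed (use A3 in auto)
  have "similar_mat_wit A' A (adj W) W"
    by (rule similar_mat_witI[of _ _ n], insert W W' A A' WW', auto simp: A'_def)
  hence A'A: "similar_mat A' A" unfolding similar_mat_def by blast
  from cp char_poly_similar[OF A'A]
  have cp: "char_poly A' = [: -e,1 :] * (\<Prod> e \<leftarrow> es. [:- e, 1:])" by simp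
  also have "char_poly A' = char_poly A1 * char_poly A3" 
    unfolding A'block A0id
    by (rule char_poly_four_block_zeros_col[OF A1 A2 A3])
  also have "char_poly A1 = [: -e,1 :]"
    by (simp add: A1id char_poly_defs Determinant.det_def sign_def)
  finally have cp: "char_poly A3 = (\<Prod> e \<leftarrow> es. [:- e, 1:])"
    by (metis mult_cancel_left pCons_eq_0_iff zero_neq_one)
  let ?D = "Matrix.mat ?n1 ?n1 (\<lambda>(i, j). if i = j then es ! i else 0)"
  from Cons(1)[OF A3 hA3 cp] obtain U where U: "U \<in> carrier_mat ?n1 ?n1" "adj U * U = 1\<^sub>m ?n1"
    and UA: "adj U * A3 * U = ?D" by blast
  let ?B = "four_block_mat (1\<^sub>m 1) (0\<^sub>m 1 ?n1) (0\<^sub>m ?n1 1) U"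
  have aB: "adj ?B = four_block_mat (1\<^sub>m 1) (0\<^sub>m 1 ?n1) (0\<^sub>m ?n1 1) (adj U)"
  proof -
    have "adj (1\<^sub>m 1) = 1\<^sub>m 1" "adj (0\<^sub>m 1 ?n1) = 0\<^sub>m ?n1 1" "adj (0\<^sub>m ?n1 1) = 0\<^sub>m 1 ?n1"
      by (auto intro!: eq_matI)
    then show ?thesis using U by (subst adj_four_block[of _ 1 1 _ ?n1 _ ?n1]) auto
  qed
  have B: "?B \<in> carrier_mat n n" using U n by (intro carrier_matI) auto
  have aBc: "adj ?B \<in> carrier_mat n n" using B by auto
  have aU: "adj U \<in> carrier_mat ?n1 ?n1" using U by auto
  have "adj ?B * ?B = 1\<^sub>m n"
    unfolding aB using U n
    by (subst mult_four_block_mat[of _ 1 1 _ ?n1 _ ?n1 _ _ 1 _ ?n1]) (auto intro!: eq_matI)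
  moreover have "adj ?B * A' * ?B = Matrix.mat n n (\<lambda>(i, j). if i = j then (e # es) ! i else 0)"
  proof -
    have "adj ?B * A' * ?B = four_block_mat A1 (0\<^sub>m 1 ?n1) (0\<^sub>m ?n1 1) (adj U * A3 * U)"
      unfolding aB A'block A0id A2id using U(1) A1 A3 aU
      by (simp add: mult_four_block_mat[of _ 1 1 _ ?n1 _ ?n1 _ _ 1 _ ?n1])
    then show ?thesis unfolding UA A1id using n by (auto intro!: eq_matI simp: nth_Cons')
  qed
  moreover define M where "M = ?B"
  ultimately have *: "adj M * M = 1\<^sub>m n" 
    "adj M * A' * M = Matrix.mat n n (\<lambda>(i, j). if i = j then (e # es) ! i else 0)" by simp_all
  have M: "M \<in> carrier_mat n n" "adj M \<in> carrier_mat n n" using B aBc by (simp_all add: M_def)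
  have adWM: "adj (W * M) = adj M * adj W" using W(1) M(1) by (rule adj_mult)
  have "adj (W * M) * (W * M) = adj M * (adj W * W) * M"
    unfolding adWM using W(1) W' M by (simp add: assoc_mult_mat[of _ n n _ n _ n])
  then have "adj (W * M) * (W * M) = 1\<^sub>m n" using * W(2) M by simp
  moreover have "adj (W * M) * A * (W * M) = adj M * A' * M"
    unfolding A'_def adWM using W(1) W' M A by (simp add: assoc_mult_mat[of _ n n _ n _ n])
  ultimately show ?case
    using W(1) M(1) unfolding *(2) by (intro exI[of _ "W * M"]) simp
qed

section \<open>Negative directions of Hermitian forms\<close>

text \<open>
  Elimination: an unknown \<open>p\<close> with nonzero coefficient is solved for in the last equation and removed from the others.
\<close>

lemma ex_nontrivial_solution:
  fixes a :: "nat \<Rightarrow> nat \<Rightarrow> 'a::field"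
  assumes "m < k"
  shows "\<exists>c. (\<exists>l<k. c l \<noteq> 0) \<and> (\<forall>i<m. (\<Sum>l<k. a i l * c l) = 0)"
  using assms
proof (induction m arbitrary: a k)
  case 0
  then show ?case by (intro exI[of _ "\<lambda>_. 1"]) auto
next
  case (Suc m)
  then obtain k' where k: "k = Suc k'" "m < k'" by (cases k) auto
  show ?case
  proof (cases "\<exists>l<k. a m l \<noteq> 0")
    case False
    from Suc.IH[of k a] Suc.prems obtain c where "\<exists>l<k. c l \<noteq> 0" "\<forall>i<m. (\<Sum>l<k. a i l * c l) = 0" by auto
    with False show ?thesis by (intro exI[of _ c]) (auto simp: less_Suc_eq)
  next
    case True
    then obtain p where p: "p < k" "a m p \<noteq> 0" by blast
    define s where "s l = (if l < p then l else Suc l)" for l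
    have bij: "bij_betw s {..<k'} ({..<k} - {p})"
      by (rule bij_betw_byWitness[where f' = "\<lambda>l. if l < p then l else l - 1"])
         (use p k in \<open>auto simp: s_def\<close>)
    define b where "b i l = a i (s l) - a i p * a m (s l) / a m p" for i l
    from Suc.IH[OF k(2), of b] obtain c where c: "\<exists>l<k'. c l \<noteq> 0" "\<forall>i<m. (\<Sum>l<k'. b i l * c l) = 0" by blast
    define d where "d l = (if l = p then - (\<Sum>l<k'. a m (s l) * c l) / a m p else c (if l < p then l else l - 1))" for l
    have ds: "d (s l) = c l" for l by (auto simp: d_def s_def)
    have sum: "(\<Sum>l<k. a i l * d l) = a i p * d p + (\<Sum>l<k'. a i (s l) * c l)" for i
      using p(1) sum.reindex_bij_betw[OF bij, of "\<lambda>l. a i l * d l"]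
      by (simp add: sum.remove[of "{..<k}" p] ds)
    have "(\<Sum>l<k. a i l * d l) = 0" if "i < Suc m" for i
    proof (cases "i = m")
      case True
      then show ?thesis using p unfolding sum by (simp add: d_def)
    next
      case False
      then have "0 = (\<Sum>l<k'. b i l * c l)" using c that by auto
      also have "\<dots> = a i p * d p + (\<Sum>l<k'. a i (s l) * c l)"
        by (simp add: b_def d_def ring_distribs sum_subtractf sum_distrib_left sum_divide_distrib sum_negf mult_ac)
      finally show ?thesis unfolding sum by simp
    qed
    moreover obtain l where l: "l < k'" "c l \<noteq> 0" using c by auto
    then have "d (s l) \<noteq> 0" "s l < k" using ds k by (auto simp: s_def)
    ultimately show ?thesis by (intro exI[of _ d]) auto
  qed
qed

definition qform :: "nat \<Rightarrow> (nat \<Rightarrow> nat \<Rightarrow> complex) \<Rightarrow> (nat \<Rightarrow> complex) \<Rightarrow> real" where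
  "qform n G z = Re (\<Sum>i<n. \<Sum>j<n. cnj (z i) * G i j * z j)"

text \<open>
  The vectors \<open>y l\<close> span a space of dimension \<open>k\<close> on which the form is negative definite. The uniform bound
  implies their linear independence, and it survives a small change of the form.
\<close>

definition neg_dim_ge :: "nat \<Rightarrow> nat \<Rightarrow> (nat \<Rightarrow> nat \<Rightarrow> complex) \<Rightarrow> bool" where
  "neg_dim_ge k n G \<longleftrightarrow> (\<exists>y \<delta>. \<delta> > 0 \<and>
     (\<forall>c. qform n G (\<lambda>i. \<Sum>l<k. c l * y l i) \<le> - \<delta> * (\<Sum>l<k. (norm (c l))\<^sup>2)))"

lemma order_prod_linear:
  "Polynomial.order a (\<Prod>e\<leftarrow>es. [:- e, 1:]) = count_list es (a :: complex)"
proof (induction es)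
  case (Cons e es)
  have "Polynomial.order a [:- e, 1:] = (if e = a then 1 else 0)"
    using order_power_n_n[of a 1] by (auto simp: order_0I)
  moreover have "(\<Prod>e\<leftarrow>e # es. [:- e, 1:]) \<noteq> 0" unfolding prod_list_zero_iff by auto
  then have "[:- e, 1:] * (\<Prod>e\<leftarrow>es. [:- e, 1:]) \<noteq> 0" by simp
  note order_mult[OF this, of a]
  ultimately show ?case using Cons by simp
qed (auto simp: order_0I)

lemma count_list_card: "count_list xs a = card {l. l < length xs \<and> xs ! l = a}"
  by (simp add: count_list_eq_length_filter length_filter_conv_card eq_commute[of a])

text \<open>
  The diagonalization in coordinates. The diagonal entries are the roots of the characteristic polynomial
  with their multiplicities, and this is what \<open>num_neg_eigenvalues\<close> counts.
\<close>

lemma spectral_theorem_num_neg: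
  assumes "\<And>i j. i < n \<Longrightarrow> j < n \<Longrightarrow> G i j = cnj (G j i)"
  obtains U :: "nat \<Rightarrow> nat \<Rightarrow> complex" and \<mu> :: "nat \<Rightarrow> real" where
    "\<And>i j. i < n \<Longrightarrow> j < n \<Longrightarrow> (\<Sum>l<n. cnj (U l i) * U l j) = (if i = j then 1 else 0)"
    "\<And>i j. i < n \<Longrightarrow> j < n \<Longrightarrow> G i j = (\<Sum>l<n. U i l * of_real (\<mu> l) * cnj (U j l))"
    "num_neg_eigenvalues (Matrix.mat n n (\<lambda>(i, j). G i j)) = card {l. l < n \<and> \<mu> l < 0}"
proof -
  define A where "A = Matrix.mat n n (\<lambda>(i, j). G i j)"
  have A: "A \<in> carrier_mat n n" by (simp add: A_def)
  have hA: "adj A = A" by (intro eq_matI) (auto simp: A_def assms[symmetric])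
  obtain es where es: "char_poly A = (\<Prod>e\<leftarrow>es. [:- e, 1:])" "length es = n"
    using char_poly_factorized[OF A] by blast
  obtain U where U: "U \<in> carrier_mat n n" "adj U * U = 1\<^sub>m n"
     "adj U * A * U = Matrix.mat n n (\<lambda>(i, j). if i = j then es ! i else 0)" (is "_ = ?D")
    using hermitian_unitary_diagonalization[OF A hA es(1)] by blast
  have U': "adj U \<in> carrier_mat n n" using U by auto
  have UU': "U * adj U = 1\<^sub>m n" using mat_mult_left_right_inverse[OF U' U(1) U(2)] .
  have "adj ?D = ?D"
  proof -
    have "adj (adj U) = U" by (intro eq_matI) auto
    then have "adj (adj U * A * U) = adj U * (A * U)"
      using U' U(1) A by (simp add: adj_mult[of _ n n _ n] hA)
    also have "\<dots> = adj U * A * U" using U' U(1) A by (simp add: assoc_mult_mat[of _ n n _ n _ n])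
    finally show ?thesis unfolding U(3) .
  qed
  then have real: "cnj (es ! l) = es ! l" if "l < n" for l
  proof -
    have "adj ?D $$ (l, l) = ?D $$ (l, l)" using \<open>adj ?D = ?D\<close> by (rule arg_cong)
    then show ?thesis using that by simp
  qed
  define \<mu> where "\<mu> l = Re (es ! l)" for l
  have mu: "es ! l = of_real (\<mu> l)" if "l < n" for l
    using real[OF that] by (simp add: \<mu>_def complex_eq_iff)
  have AU: "A = U * ?D * adj U"
  proof -
    have "U * ?D * adj U = (U * adj U) * A * (U * adj U)"
      unfolding U(3)[symmetric] using U(1) U' A by (simp add: assoc_mult_mat[of _ n n _ n _ n])
    then show ?thesis using A unfolding UU' by simp
  qed
  have "G i j = (\<Sum>l<n. U $$ (i, l) * of_real (\<mu> l) * cnj (U $$ (j, l)))" if "i < n" "j < n" for i j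
  proof -
    have UD: "(U * ?D) $$ (i, l) = U $$ (i, l) * of_real (\<mu> l)" if l: "l < n" for l
    proof -
      have "(U * ?D) $$ (i, l) = (\<Sum>r<n. U $$ (i, r) * (if r = l then es ! r else 0))"
        using l \<open>i < n\<close> U(1) by (auto simp: scalar_prod_def atLeast0LessThan intro!: sum.cong)
      also have "\<dots> = U $$ (i, l) * es ! l" using l by (simp add: if_distrib sum.delta cong: if_cong)
      finally show ?thesis using mu l by simp
    qed
    have "G i j = A $$ (i, j)" using that by (simp add: A_def)
    also have "\<dots> = (U * ?D * adj U) $$ (i, j)" using AU by (rule arg_cong)
    also have "\<dots> = (\<Sum>l<n. (U * ?D) $$ (i, l) * cnj (U $$ (j, l)))"
      using that U(1) by (auto simp: scalar_prod_def atLeast0LessThan simp del: index_mult_mat(1) intro!: sum.cong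
          simp: index_mult_mat(1)[of i "U * ?D" j "adj U"])
    finally show ?thesis by (simp add: UD)
  qed
  moreover have "(\<Sum>l<n. cnj (U $$ (l, i)) * U $$ (l, j)) = (if i = j then 1 else 0)" if "i < n" "j < n" for i j
    using that arg_cong[OF U(2), of "\<lambda>M. M $$ (i, j)"] U(1)
    by (auto simp: scalar_prod_def atLeast0LessThan)
  moreover have "num_neg_eigenvalues A = card {l. l < n \<and> \<mu> l < 0}"
  proof -
    let ?S = "{l. l < n \<and> \<mu> l < 0}"
    have ev: "eigenvalue A (of_real x) \<longleftrightarrow> (\<exists>l<n. \<mu> l = x)" for x
    proof -
      have "poly (\<Prod>e\<leftarrow>xs. [:- e, 1:]) a = 0 \<longleftrightarrow> a \<in> set xs" for a :: complex and xs
        by (induct xs) auto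
      then show ?thesis
        unfolding eigenvalue_root_char_poly[OF A] es(1) using es(2) mu by (auto simp: in_set_conv_nth)
    qed
    then have X: "{x. x < 0 \<and> eigenvalue A (of_real x)} = \<mu> ` ?S" by auto
    have "card ?S = (\<Sum>l\<in>?S. 1)" by simp
    also have "\<dots> = (\<Sum>x\<in>\<mu> ` ?S. sum (\<lambda>_. 1) {l. l \<in> ?S \<and> \<mu> l = x})"
      by (rule sum.image_gen) simp
    also have "\<dots> = (\<Sum>x\<in>\<mu> ` ?S. Polynomial.order (of_real x) (char_poly A))"
    proof (rule sum.cong)
      fix x assume "x \<in> \<mu> ` ?S"
      then have "{l. l \<in> ?S \<and> \<mu> l = x} = {l. l < length es \<and> es ! l = of_real x}"
        using es(2) mu by auto
      then show "sum (\<lambda>_. 1) {l. l \<in> ?S \<and> \<mu> l = x} = Polynomial.order (of_real x) (char_poly A)"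
        unfolding es(1) order_prod_linear count_list_card by simp
    qed simp
    finally show ?thesis unfolding num_neg_eigenvalues_def X by simp
  qed
  ultimately show ?thesis using that[of "\<lambda>i j. U $$ (i, j)" \<mu>] unfolding A_def by blast
qed

text \<open>
  Sylvester's law of inertia. Eigenvectors for negative eigenvalues span a negative space. A negative
  space of larger dimension would contain a nonzero vector orthogonal to all of them, and there the form is
  nonnegative.
\<close>

lemma neg_dim_ge_iff:
  assumes "\<And>i j. i < n \<Longrightarrow> j < n \<Longrightarrow> G i j = cnj (G j i)"
  shows "neg_dim_ge k n G \<longleftrightarrow> k \<le> num_neg_eigenvalues (Matrix.mat n n (\<lambda>(i, j). G i j))"
proof -
  obtain U :: "nat \<Rightarrow> nat \<Rightarrow> complex" and \<mu> :: "nat \<Rightarrow> real" where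
    U: "\<And>i j. i < n \<Longrightarrow> j < n \<Longrightarrow> (\<Sum>l<n. cnj (U l i) * U l j) = (if i = j then 1 else 0)" and
    G: "\<And>i j. i < n \<Longrightarrow> j < n \<Longrightarrow> G i j = (\<Sum>l<n. U i l * of_real (\<mu> l) * cnj (U j l))" and
    num: "num_neg_eigenvalues (Matrix.mat n n (\<lambda>(i, j). G i j)) = card {l. l < n \<and> \<mu> l < 0}"
    by (rule spectral_theorem_num_neg[of n G, OF assms]) (assumption | rule that)+
  let ?S = "{l. l < n \<and> \<mu> l < 0}"
  have q: "qform n G z = (\<Sum>l<n. \<mu> l * (norm (\<Sum>i<n. cnj (U i l) * z i))\<^sup>2)" for z
  proof -
    have "(\<Sum>i<n. \<Sum>j<n. cnj (z i) * G i j * z j) =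
        (\<Sum>i<n. \<Sum>j<n. \<Sum>l<n. of_real (\<mu> l) * ((cnj (z i) * U i l) * (cnj (U j l) * z j)))"
      by (intro sum.cong refl) (simp add: G sum_distrib_left sum_distrib_right mult_ac)
    also have "\<dots> = (\<Sum>i<n. \<Sum>l<n. \<Sum>j<n. of_real (\<mu> l) * ((cnj (z i) * U i l) * (cnj (U j l) * z j)))"
      by (rule sum.cong[OF refl], rule sum.swap)
    also have "\<dots> = (\<Sum>l<n. \<Sum>i<n. \<Sum>j<n. of_real (\<mu> l) * ((cnj (z i) * U i l) * (cnj (U j l) * z j)))"
      by (rule sum.swap)
    also have "\<dots> = (\<Sum>l<n. of_real (\<mu> l) * (cnj (\<Sum>i<n. cnj (U i l) * z i) * (\<Sum>j<n. cnj (U j l) * z j)))"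
      by (simp add: sum_product sum_distrib_left mult_ac)
    also have "\<dots> = (\<Sum>l<n. of_real (\<mu> l * (norm (\<Sum>i<n. cnj (U i l) * z i))\<^sup>2))"
    proof (intro sum.cong refl)
      fix l
      define w where "w = (\<Sum>i<n. cnj (U i l) * z i)"
      show "of_real (\<mu> l) * (cnj (\<Sum>i<n. cnj (U i l) * z i) * (\<Sum>j<n. cnj (U j l) * z j)) =
            of_real (\<mu> l * (norm (\<Sum>i<n. cnj (U i l) * z i))\<^sup>2)"
        unfolding w_def[symmetric] of_real_mult complex_norm_square by (simp only: mult.commute)
    qed
    finally show ?thesis unfolding qform_def by simp
  qed
  show ?thesis
  proof
    assume "k \<le> num_neg_eigenvalues (Matrix.mat n n (\<lambda>(i, j). G i j))"
    then obtain T where T: "T \<subseteq> ?S" "card T = k" unfolding num by (meson obtain_subset_with_card_n)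
    have finT: "finite T" using T(1) by (rule finite_subset) simp
    then obtain e where e: "bij_betw e {..<k} T"
      using T(2) ex_bij_betw_nat_finite[of T] by (auto simp: atLeast0LessThan)
    have "\<exists>\<delta>>0. \<forall>l\<in>T. \<mu> l \<le> - \<delta>"
    proof (cases "T = {}")
      case False
      have "Max (\<mu> ` T) < 0" "\<forall>l\<in>T. \<mu> l \<le> Max (\<mu> ` T)"
        using finT False T(1) by auto
      then show ?thesis by (intro exI[of _ "- Max (\<mu> ` T)"]) (simp del: Max_less_iff)
    qed (auto intro: exI[of _ 1])
    then obtain \<delta> where \<delta>: "\<delta> > 0" "\<And>l. l \<in> T \<Longrightarrow> \<mu> l \<le> - \<delta>" by blast
    have eT: "e l \<in> T" "e l < n" if "l < k" for l using e that T(1) by (auto simp: bij_betw_def)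
    have comp: "(\<Sum>i<n. cnj (U i r) * (\<Sum>l<k. c l * U i (e l))) = (\<Sum>l<k. if r = e l then c l else 0)"
      if "r < n" for r and c :: "nat \<Rightarrow> complex"
    proof -
      have "(\<Sum>i<n. cnj (U i r) * (\<Sum>l<k. c l * U i (e l))) = (\<Sum>i<n. \<Sum>l<k. c l * (cnj (U i r) * U i (e l)))"
        by (simp add: sum_distrib_left mult_ac)
      also have "\<dots> = (\<Sum>l<k. \<Sum>i<n. c l * (cnj (U i r) * U i (e l)))" by (rule sum.swap)
      also have "\<dots> = (\<Sum>l<k. c l * (if r = e l then 1 else 0))"
        by (intro sum.cong refl) (simp add: U[OF that] eT flip: sum_distrib_left)
      finally show ?thesis by (simp add: if_distrib cong: if_cong)
    qed
    have compT: "(\<Sum>l<k. if e r = e l then c l else 0) = c r" if "r < k" for r and c :: "nat \<Rightarrow> complex"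
    proof -
      have "(\<Sum>l<k. if e r = e l then c l else 0) = (\<Sum>l<k. if r = l then c l else 0)"
        using e that by (intro sum.cong refl) (auto simp: bij_betw_def inj_on_def)
      then show ?thesis using that by simp
    qed
    have "qform n G (\<lambda>i. \<Sum>l<k. c l * U i (e l)) \<le> - \<delta> * (\<Sum>l<k. (norm (c l))\<^sup>2)" for c
    proof -
      have "qform n G (\<lambda>i. \<Sum>l<k. c l * U i (e l)) = (\<Sum>r<n. \<mu> r * (norm (\<Sum>l<k. if r = e l then c l else 0))\<^sup>2)"
        unfolding q by (intro sum.cong refl) (simp add: comp)
      also have "\<dots> = (\<Sum>r\<in>T. \<mu> r * (norm (\<Sum>l<k. if r = e l then c l else 0))\<^sup>2)"
      proof (rule sum.mono_neutral_right)
        show "\<forall>r\<in>{..<n} - T. \<mu> r * (norm (\<Sum>l<k. if r = e l then c l else 0))\<^sup>2 = 0"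
          using eT by (auto intro!: sum.neutral)
      qed (use T in auto)
      also have "\<dots> = (\<Sum>l<k. \<mu> (e l) * (norm (c l))\<^sup>2)"
        by (subst sum.reindex_bij_betw[OF e, symmetric]) (auto intro!: sum.cong simp: compT)
      also have "\<dots> \<le> (\<Sum>l<k. - \<delta> * (norm (c l))\<^sup>2)"
        using \<delta>(2)[OF eT(1)] by (intro sum_mono mult_right_mono) auto
      finally show ?thesis by (simp add: sum_distrib_left sum_negf)
    qed
    then show "neg_dim_ge k n G" unfolding neg_dim_ge_def using \<delta>(1) 
      by (intro exI[of _ "\<lambda>l i. U i (e l)"] exI[of _ \<delta>]) simp
  next
    assume "neg_dim_ge k n G"
    then obtain y \<delta> where \<delta>: "\<delta> > 0" and
      y: "\<And>c. qform n G (\<lambda>i. \<Sum>l<k. c l * y l i) \<le> - \<delta> * (\<Sum>l<k. (norm (c l))\<^sup>2)"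
      unfolding neg_dim_ge_def by blast
    show "k \<le> num_neg_eigenvalues (Matrix.mat n n (\<lambda>(i, j). G i j))"
    proof (rule ccontr)
      assume "\<not> ?thesis"
      then have lt: "card ?S < k" unfolding num by simp
      obtain f where f: "bij_betw f {..<card ?S} ?S"
        using ex_bij_betw_nat_finite[of ?S] by (auto simp: atLeast0LessThan)
      obtain c where c: "\<exists>l<k. c l \<noteq> 0" "\<And>r. r < card ?S \<Longrightarrow> (\<Sum>l<k. (\<Sum>i<n. cnj (U i (f r)) * y l i) * c l) = 0"
        using ex_nontrivial_solution[OF lt, of "\<lambda>r l. \<Sum>i<n. cnj (U i (f r)) * y l i"] by blast
      have "(\<Sum>i<n. cnj (U i l) * (\<Sum>p<k. c p * y p i)) = 0" if "l \<in> ?S" for l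
      proof -
        have "l \<in> f ` {..<card ?S}" unfolding bij_betw_imp_surj_on[OF f] by (rule that)
        then obtain r where r: "r < card ?S" "f r = l" by blast
        have "(\<Sum>i<n. cnj (U i l) * (\<Sum>p<k. c p * y p i)) = (\<Sum>i<n. \<Sum>p<k. (cnj (U i l) * y p i) * c p)"
          by (simp add: sum_distrib_left mult_ac)
        also have "\<dots> = (\<Sum>p<k. (\<Sum>i<n. cnj (U i (f r)) * y p i) * c p)"
          unfolding r(2) sum_distrib_right by (rule sum.swap)
        finally show ?thesis using c(2)[OF r(1)] by simp
      qed
      then have "\<mu> l * (norm (\<Sum>i<n. cnj (U i l) * (\<Sum>p<k. c p * y p i)))\<^sup>2 \<ge> 0" if "l < n" for l
        using that by (cases "\<mu> l < 0") auto
      then have "qform n G (\<lambda>i. \<Sum>l<k. c l * y l i) \<ge> 0"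
        unfolding q by (intro sum_nonneg) auto
      moreover have "(\<Sum>l<k. (norm (c l))\<^sup>2) > 0"
      proof -
        obtain l where "l < k" "c l \<noteq> 0" using c(1) by blast
        then show ?thesis by (intro sum_pos2[of _ l]) auto
      qed
      ultimately show False using y[of c] mult_pos_pos[OF \<delta>] by fastforce
    qed
  qed
qed

lemma qform_diff_le:
  assumes "\<And>i j. i < n \<Longrightarrow> j < n \<Longrightarrow> norm (G' i j - G i j) \<le> \<epsilon>"
  shows "\<bar>qform n G' z - qform n G z\<bar> \<le> \<epsilon> * (\<Sum>i<n. norm (z i))\<^sup>2"
proof -
  have "\<bar>qform n G' z - qform n G z\<bar> = \<bar>Re (\<Sum>i<n. \<Sum>j<n. cnj (z i) * (G' i j - G i j) * z j)\<bar>"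
    unfolding qform_def by (simp add: ring_distribs sum_subtractf del: Re_sum)
  also have "\<dots> \<le> norm (\<Sum>i<n. \<Sum>j<n. cnj (z i) * (G' i j - G i j) * z j)" by (rule abs_Re_le_cmod)
  also have "\<dots> \<le> (\<Sum>i<n. \<Sum>j<n. norm (cnj (z i) * (G' i j - G i j) * z j))"
    by (intro sum_norm_le order_refl)
  also have "\<dots> \<le> (\<Sum>i<n. \<Sum>j<n. norm (z i) * \<epsilon> * norm (z j))"
    using assms by (intro sum_mono) (auto simp: norm_mult intro!: mult_right_mono mult_left_mono)
  also have "\<dots> = \<epsilon> * (\<Sum>i<n. norm (z i))\<^sup>2"
    by (simp add: power2_eq_square sum_product sum_distrib_left mult_ac)
  finally show ?thesis .
qed

lemma norm_sum_square_le: "(\<Sum>l<k. norm (c l :: complex))\<^sup>2 \<le> real k * (\<Sum>l<k. (norm (c l))\<^sup>2)"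
  using Cauchy_Schwarz_ineq_sum[of "\<lambda>_. 1" "\<lambda>l. norm (c l)" "{..<k}"] by simp

text \<open>
  On the span of the \<open>y l\<close> a change of the entries by less than \<open>\<epsilon>\<close> changes the form by at most a fixed multiple of
  \<open>\<epsilon> * (\<Sum>l<k. (norm (c l))\<^sup>2)\<close>, so half of the margin \<open>\<delta>\<close> remains.
\<close>

lemma neg_dim_ge_stable:
  assumes "neg_dim_ge k n G"
  shows "\<exists>\<epsilon>>0. \<forall>G'. (\<forall>i<n. \<forall>j<n. norm (G' i j - G i j) < \<epsilon>) \<longrightarrow> neg_dim_ge k n G'"
proof -
  obtain y \<delta> where \<delta>: "\<delta> > 0" and
      y: "\<And>c. qform n G (\<lambda>i. \<Sum>l<k. c l * y l i) \<le> - \<delta> * (\<Sum>l<k. (norm (c l))\<^sup>2)"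
      using assms unfolding neg_dim_ge_def by blast
  define M where "M = 1 + (\<Sum>l<k. \<Sum>i<n. norm (y l i))"
  have M: "M \<ge> 1" unfolding M_def by (auto intro!: sum_nonneg)
  have bound: "(\<Sum>i<n. norm (\<Sum>l<k. c l * y l i))\<^sup>2 \<le> M\<^sup>2 * (real k + 1) * (\<Sum>l<k. (norm (c l))\<^sup>2)" for c
  proof -
    have "(\<Sum>i<n. norm (\<Sum>l<k. c l * y l i)) \<le> (\<Sum>i<n. \<Sum>l<k. norm (c l) * norm (y l i))"
      by (intro sum_mono sum_norm_le) (simp add: norm_mult)
    also have "\<dots> = (\<Sum>l<k. \<Sum>i<n. norm (c l) * norm (y l i))" by (rule sum.swap)
    also have "\<dots> = (\<Sum>l<k. norm (c l) * (\<Sum>i<n. norm (y l i)))" by (simp add: sum_distrib_left)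
    also have "\<dots> \<le> (\<Sum>l<k. norm (c l) * M)"
    proof (intro sum_mono mult_left_mono)
      fix l assume "l \<in> {..<k}"
      then have "(\<Sum>i<n. norm (y l i)) \<le> (\<Sum>l<k. \<Sum>i<n. norm (y l i))"
        by (intro member_le_sum) (auto intro: sum_nonneg)
      then show "(\<Sum>i<n. norm (y l i)) \<le> M" unfolding M_def by simp
    qed simp
    finally have "(\<Sum>i<n. norm (\<Sum>l<k. c l * y l i)) \<le> M * (\<Sum>l<k. norm (c l))"
      by (simp add: sum_distrib_left mult.commute)
    then have "(\<Sum>i<n. norm (\<Sum>l<k. c l * y l i))\<^sup>2 \<le> (M * (\<Sum>l<k. norm (c l)))\<^sup>2"
      by (intro power_mono) (auto intro: sum_nonneg)
    also have "\<dots> \<le> M\<^sup>2 * (real k * (\<Sum>l<k. (norm (c l))\<^sup>2))"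
      unfolding power_mult_distrib using norm_sum_square_le[of c k] by (intro mult_left_mono) auto
    also have "\<dots> \<le> M\<^sup>2 * (real k + 1) * (\<Sum>l<k. (norm (c l))\<^sup>2)"
      by (simp add: mult.assoc) (intro mult_left_mono mult_right_mono; auto intro: sum_nonneg)
    finally show ?thesis .
  qed
  define \<epsilon> where "\<epsilon> = \<delta> / (2 * M\<^sup>2 * (real k + 1))"
  have \<epsilon>: "\<epsilon> > 0" using \<delta> M by (auto simp: \<epsilon>_def)
  have "neg_dim_ge k n G'" if G': "\<forall>i<n. \<forall>j<n. norm (G' i j - G i j) < \<epsilon>" for G'
  proof -
    have "qform n G' (\<lambda>i. \<Sum>l<k. c l * y l i) \<le> - (\<delta> / 2) * (\<Sum>l<k. (norm (c l))\<^sup>2)" for c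
    proof -
      have "\<bar>qform n G' (\<lambda>i. \<Sum>l<k. c l * y l i) - qform n G (\<lambda>i. \<Sum>l<k. c l * y l i)\<bar>
         \<le> \<epsilon> * (\<Sum>i<n. norm (\<Sum>l<k. c l * y l i))\<^sup>2"
        using G' by (intro qform_diff_le) (auto intro: less_imp_le)
      also have "\<dots> \<le> \<epsilon> * (M\<^sup>2 * (real k + 1) * (\<Sum>l<k. (norm (c l))\<^sup>2))"
        using \<epsilon> bound by (intro mult_left_mono) auto
      also have "\<dots> = \<delta> / 2 * (\<Sum>l<k. (norm (c l))\<^sup>2)"
      proof -
        have "\<delta> / (2 * K) * K = \<delta> / 2" if "K \<noteq> 0" for K using that by simp
        from this[of "M\<^sup>2 * (real k + 1)"]
        have "\<epsilon> * (M\<^sup>2 * (real k + 1)) = \<delta> / 2" using M by (simp add: \<epsilon>_def mult.assoc)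
        then show ?thesis by (metis mult.assoc)
      qed
      finally show ?thesis using y[of c] by linarith
    qed
    then show ?thesis unfolding neg_dim_ge_def using \<delta> 
      by (intro exI[of _ y] exI[of _ "\<delta> / 2"]) simp
  qed
  then show ?thesis using \<epsilon> by blast
qed

no_notation fps_nth (infixl "$" 75)

section \<open>Square-summable coefficient sequences\<close>

lemma series_Cauchy_Schwarz:
  fixes a b :: "nat \<Rightarrow> real"
  assumes "\<And>n. a n \<ge> 0" "\<And>n. b n \<ge> 0" "summable (\<lambda>n. (a n)\<^sup>2)" "summable (\<lambda>n. (b n)\<^sup>2)"
  shows "summable (\<lambda>n. a n * b n)" "(\<Sum>n. a n * b n)\<^sup>2 \<le> (\<Sum>n. (a n)\<^sup>2) * (\<Sum>n. (b n)\<^sup>2)"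
proof -
  show s: "summable (\<lambda>n. a n * b n)"
  proof (rule summable_comparison_test'[of "\<lambda>n. (a n)\<^sup>2 + (b n)\<^sup>2" 0])
    show "summable (\<lambda>n. (a n)\<^sup>2 + (b n)\<^sup>2)" using assms by (intro summable_add)
    fix n
    have "a n * b n \<le> (a n)\<^sup>2 + (b n)\<^sup>2"
      using sum_squares_bound[of "a n" "b n"] mult_nonneg_nonneg[OF assms(1,2), of n n] by linarith
    then show "norm (a n * b n) \<le> (a n)\<^sup>2 + (b n)\<^sup>2" using assms(1,2)[of n] by simp
  qed
  have "(\<Sum>n<N. a n * b n)\<^sup>2 \<le> (\<Sum>n. (a n)\<^sup>2) * (\<Sum>n. (b n)\<^sup>2)" for N
  proof -
    have "(\<Sum>n<N. a n * b n)\<^sup>2 \<le> (\<Sum>n<N. (a n)\<^sup>2) * (\<Sum>n<N. (b n)\<^sup>2)"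
      by (rule Cauchy_Schwarz_ineq_sum)
    also have "\<dots> \<le> (\<Sum>n. (a n)\<^sup>2) * (\<Sum>n. (b n)\<^sup>2)"
      using assms(3,4) by (intro mult_mono sum_le_suminf sum_nonneg suminf_nonneg) auto
    finally show ?thesis .
  qed
  then show "(\<Sum>n. a n * b n)\<^sup>2 \<le> (\<Sum>n. (a n)\<^sup>2) * (\<Sum>n. (b n)\<^sup>2)"
    by (intro LIMSEQ_le_const2[OF tendsto_power[OF summable_LIMSEQ[OF s]]]) auto
qed

text \<open>
  Conjugate linear in the first argument, as are the entries of a Gram matrix in the left vector.
\<close>

definition hdot :: "complex^'k \<Rightarrow> complex^'k \<Rightarrow> complex" where
  "hdot u v = (\<Sum>a\<in>UNIV. cnj (u $ a) * v $ a)"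

lemma hdot_simps [simp]:
  "hdot (u + u') v = hdot u v + hdot u' v" "hdot u (v + v') = hdot u v + hdot u v'"
  "hdot (u - u') v = hdot u v - hdot u' v" "hdot u (v - v') = hdot u v - hdot u v'"
  "hdot (c *s u) v = cnj c * hdot u v" "hdot u (c *s v) = c * hdot u v"
  "hdot 0 v = 0" "hdot u 0 = 0"
  by (simp_all add: hdot_def ring_distribs sum.distrib sum_subtractf sum_distrib_left mult_ac)

lemma hdot_sum: "hdot (sum f I) v = (\<Sum>i\<in>I. hdot (f i) v)" "hdot u (sum f I) = (\<Sum>i\<in>I. hdot u (f i))"
  by (induct I rule: infinite_finite_induct; simp)+

lemma norm_vec_square: "(norm (u :: complex^'k))\<^sup>2 = (\<Sum>a\<in>UNIV. (norm (u $ a))\<^sup>2)"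
  by (simp add: norm_vec_def L2_set_def sum_nonneg)

lemma hdot_self: "hdot u u = of_real ((norm u)\<^sup>2)"
  unfolding norm_vec_square hdot_def of_real_sum
  by (intro sum.cong refl) (simp only: complex_norm_square mult.commute)

lemma hdot_commute: "hdot v u = cnj (hdot u v)"
  by (simp add: hdot_def mult.commute)

lemma norm_hdot_le: "norm (hdot u v) \<le> norm u * norm v"
proof -
  have "norm (hdot u v) \<le> (\<Sum>a\<in>UNIV. norm (u $ a) * norm (v $ a))"
    unfolding hdot_def by (rule sum_norm_le) (simp add: norm_mult)
  also have "\<dots> \<le> L2_set (\<lambda>a. norm (u $ a)) UNIV * L2_set (\<lambda>a. norm (v $ a)) UNIV"
    using L2_set_mult_ineq[of "\<lambda>a. norm (u $ a)" "\<lambda>a. norm (v $ a)" UNIV] by simp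
  finally show ?thesis by (simp add: norm_vec_def)
qed

lemma norm_cmult_vec: "norm (c *s (v :: complex^'k)) = norm c * norm v"
proof -
  have "(norm (c *s v))\<^sup>2 = (norm c * norm v)\<^sup>2"
    unfolding power_mult_distrib norm_vec_square
    by (simp add: norm_mult power_mult_distrib sum_distrib_left)
  then show ?thesis by (simp add: power2_eq_iff_nonneg)
qed

lemma hdot_mat: "hdot u (A *v v) = hdot (conj_transpose A *v u) v"
proof -
  have "hdot u (A *v v) = (\<Sum>i\<in>UNIV. \<Sum>j\<in>UNIV. cnj (u $ i) * A $ i $ j * v $ j)"
    by (simp add: hdot_def matrix_vector_mult_def sum_distrib_left mult.assoc)
  also have "\<dots> = (\<Sum>j\<in>UNIV. \<Sum>i\<in>UNIV. cnj (u $ i) * A $ i $ j * v $ j)" by (rule sum.swap)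
  finally show ?thesis
    by (simp add: hdot_def matrix_vector_mult_def conj_transpose_def sum_distrib_left sum_distrib_right mult_ac)
qed

definition l2 :: "(nat \<Rightarrow> complex^'k) \<Rightarrow> bool" where
  "l2 a \<longleftrightarrow> summable (\<lambda>n. (norm (a n))\<^sup>2)"

definition l2norm :: "(nat \<Rightarrow> complex^'k) \<Rightarrow> real" where
  "l2norm a = sqrt (\<Sum>n. (norm (a n))\<^sup>2)"

lemma l2norm_nonneg [simp]: "l2norm a \<ge> 0" if "l2 a"
  using that by (auto simp: l2norm_def l2_def intro: suminf_nonneg)

lemma l2norm_square: "l2 a \<Longrightarrow> (l2norm a)\<^sup>2 = (\<Sum>n. (norm (a n))\<^sup>2)"
  by (simp add: l2norm_def l2_def suminf_nonneg)

lemma l2_pairing: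
  assumes "l2 a" "l2 b"
  shows "summable (\<lambda>n. hdot (a n) (b n))" "norm (\<Sum>n. hdot (a n) (b n)) \<le> l2norm a * l2norm b"
proof -
  note cs = series_Cauchy_Schwarz[of "\<lambda>n. norm (a n)" "\<lambda>n. norm (b n)", OF _ _ assms[unfolded l2_def], simplified]
  have s: "summable (\<lambda>n. norm (hdot (a n) (b n)))"
    by (rule summable_comparison_test'[OF cs(1), of 0]) (simp add: norm_hdot_le)
  show "summable (\<lambda>n. hdot (a n) (b n))" by (rule summable_norm_cancel[OF s])
  have "norm (\<Sum>n. hdot (a n) (b n)) \<le> (\<Sum>n. norm (hdot (a n) (b n)))"
    by (rule summable_norm[OF s])
  also have "\<dots> \<le> (\<Sum>n. norm (a n) * norm (b n))"
    by (rule suminf_le[OF _ s cs(1)]) (rule norm_hdot_le)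
  also have "\<dots> \<le> l2norm a * l2norm b"
    using cs(2) real_le_rsqrt unfolding l2norm_def real_sqrt_mult[symmetric] by blast
  finally show "norm (\<Sum>n. hdot (a n) (b n)) \<le> l2norm a * l2norm b" .
qed

lemma l2_add:
  assumes "l2 a" "l2 b"
  shows "l2 (\<lambda>n. a n + b n)"
  unfolding l2_def
proof (rule summable_comparison_test'[of "\<lambda>n. 2 * (norm (a n))\<^sup>2 + 2 * (norm (b n))\<^sup>2" 0])
  show "summable (\<lambda>n. 2 * (norm (a n))\<^sup>2 + 2 * (norm (b n))\<^sup>2)"
    using assms by (intro summable_add summable_mult) (auto simp: l2_def)
  fix n
  have "(norm (a n + b n))\<^sup>2 \<le> (norm (a n) + norm (b n))\<^sup>2"
    by (intro power_mono norm_triangle_ineq) auto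
  also have "\<dots> \<le> 2 * (norm (a n))\<^sup>2 + 2 * (norm (b n))\<^sup>2"
    using sum_squares_bound[of "norm (a n)" "norm (b n)"] by (simp add: power2_sum)
  finally show "norm ((norm (a n + b n))\<^sup>2) \<le> 2 * (norm (a n))\<^sup>2 + 2 * (norm (b n))\<^sup>2" by simp
qed

lemma l2_cmult: "l2 a \<Longrightarrow> l2 (\<lambda>n. c *s a n)"
  unfolding l2_def norm_cmult_vec power_mult_distrib by (rule summable_mult)

lemma l2_zero [simp]: "l2 (\<lambda>n. 0)" by (simp add: l2_def)

lemma l2_sum: "(\<And>i. i \<in> I \<Longrightarrow> l2 (a i)) \<Longrightarrow> l2 (\<lambda>n. \<Sum>i\<in>I. a i n)"
  by (induct I rule: infinite_finite_induct) (auto intro: l2_add)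

lemma l2norm_cmult: "l2norm (\<lambda>n. c *s a n) = norm c * l2norm a" if "l2 a"
  using that unfolding l2norm_def norm_cmult_vec power_mult_distrib l2_def
  by (simp add: suminf_mult real_sqrt_mult)

lemma l2norm_triangle:
  assumes a: "l2 a" and b: "l2 b"
  shows "l2norm (\<lambda>n. a n + b n) \<le> l2norm a + l2norm b"
proof -
  let ?s = "\<lambda>n. a n + b n"
  note s = l2_add[OF a b]
  have "(norm (?s n))\<^sup>2 = Re (hdot (?s n) (a n) + hdot (?s n) (b n))" for n
    using arg_cong[OF hdot_self[of "?s n"], of Re] by (simp add: algebra_simps)
  then have "(l2norm ?s)\<^sup>2 = Re ((\<Sum>n. hdot (?s n) (a n)) + (\<Sum>n. hdot (?s n) (b n)))"
    using l2norm_square[OF s] l2_pairing(1)[OF s a] l2_pairing(1)[OF s b]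
    by (simp only: suminf_add Re_suminf summable_add)
  also have "\<dots> \<le> norm (\<Sum>n. hdot (?s n) (a n)) + norm (\<Sum>n. hdot (?s n) (b n))"
    using complex_Re_le_cmod norm_triangle_ineq order_trans by blast
  also have "\<dots> \<le> l2norm ?s * (l2norm a + l2norm b)"
    using l2_pairing(2)[OF s a] l2_pairing(2)[OF s b] by (simp add: algebra_simps)
  finally have "l2norm ?s * l2norm ?s \<le> l2norm ?s * (l2norm a + l2norm b)" by (simp add: power2_eq_square)
  then show ?thesis
    using l2norm_nonneg[OF s] l2norm_nonneg[OF a] l2norm_nonneg[OF b]
    by (cases "l2norm ?s = 0") (auto simp: mult_le_cancel_left)
qed

lemma l2norm_sum_le:
  assumes "\<And>i. i \<in> I \<Longrightarrow> l2 (a i)"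
  shows "l2norm (\<lambda>n. \<Sum>i\<in>I. c i *s a i n) \<le> (\<Sum>i\<in>I. norm (c i) * l2norm (a i))"
  using assms
proof (induct I rule: infinite_finite_induct)
  case (insert i I)
  then have "l2norm (\<lambda>n. c i *s a i n + (\<Sum>i\<in>I. c i *s a i n)) \<le> l2norm (\<lambda>n. c i *s a i n) + l2norm (\<lambda>n. \<Sum>i\<in>I. c i *s a i n)"
    by (intro l2norm_triangle l2_cmult l2_sum) auto
  also have "\<dots> \<le> norm (c i) * l2norm (a i) + (\<Sum>i\<in>I. norm (c i) * l2norm (a i))"
    using insert by (intro add_mono) (auto simp: l2norm_cmult)
  finally show ?case using insert by simp
qed (auto simp: l2norm_def)

section \<open>Taylor coefficients and finite combinations of kernel functions\<close>

definition taylor :: "(complex \<Rightarrow> complex) \<Rightarrow> nat \<Rightarrow> complex" where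
  "taylor f n = (deriv ^^ n) f 0 / fact n"

definition hcoef :: "(complex \<Rightarrow> complex^'k) \<Rightarrow> nat \<Rightarrow> complex^'k" where
  "hcoef f n = (\<chi> i. taylor (\<lambda>z. f z $ i) n)"

definition hol :: "(complex \<Rightarrow> complex^'k) \<Rightarrow> bool" where
  "hol f \<longleftrightarrow> (\<forall>i. (\<lambda>z. f z $ i) holomorphic_on \<bbbD>)"

lemma taylor_sums:
  assumes "f holomorphic_on \<bbbD>" "norm z < 1"
  shows "(\<lambda>n. taylor f n * z ^ n) sums f z"
  using holomorphic_power_series[OF assms(1), of z] assms(2) by (simp add: taylor_def)

lemma taylor_unique:
  assumes "\<And>z. norm z < 1 \<Longrightarrow> (\<lambda>n. a n * z ^ n) sums f z"
  shows "f holomorphic_on \<bbbD>" "taylor f n = a n"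
proof -
  show h: "f holomorphic_on \<bbbD>"
    using power_series_holomorphic[of 0 1 a f] assms by simp
  have z: "(\<lambda>n. (taylor f n - a n) * z ^ n) sums 0" if "norm z < 1" for z
    using sums_diff[OF taylor_sums[OF h that] assms[OF that]] by (simp add: ring_distribs)
  have "taylor f n - a n = 0"
  proof (rule ccontr)
    assume n: "taylor f n - a n \<noteq> 0"
    have "taylor f 0 - a 0 = 0"
      using z[of 0] powser_sums_zero[of "\<lambda>n. taylor f n - a n"] sums_unique2 by fastforce
    with n have "n > 0" by (cases n) auto
    obtain s where "0 < s" "\<And>z::complex. z \<in> cball 0 s - {0} \<Longrightarrow> (0::complex) \<noteq> 0"
      using powser_0_nonzero[of 1 0 "\<lambda>n. taylor f n - a n" "\<lambda>_. 0" n] z n \<open>n > 0\<close> by auto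
    from this(2)[of "of_real s"] \<open>0 < s\<close> show False by auto
  qed
  then show "taylor f n = a n" by simp
qed

lemma hcoef_unique:
  assumes "\<And>i z. norm z < 1 \<Longrightarrow> (\<lambda>n. a n $ i * z ^ n) sums (f z $ i)"
  shows "hol f" "hcoef f = a"
proof -
  show "hol f" unfolding hol_def using taylor_unique(1)[OF assms] by blast
  show "hcoef f = a"
    using taylor_unique(2)[OF assms] by (intro ext) (simp add: hcoef_def vec_eq_iff)
qed

lemma hcoef_sums:
  assumes "hol f" "norm z < 1"
  shows "(\<lambda>n. hcoef f n $ i * z ^ n) sums (f z $ i)"
  using taylor_sums[of "\<lambda>z. f z $ i" z] assms by (simp add: hol_def hcoef_def)

lemma hcoef_add:
  assumes "hol f" "hol g"
  shows "hol (\<lambda>z. f z + g z)" "hcoef (\<lambda>z. f z + g z) = (\<lambda>n. hcoef f n + hcoef g n)"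
proof -
  have *: "(\<lambda>n. (hcoef f n + hcoef g n) $ i * z ^ n) sums ((f z + g z) $ i)" if "norm z < 1" for i z
    using sums_add[OF hcoef_sums[OF assms(1) that] hcoef_sums[OF assms(2) that]] by (simp add: ring_distribs)
  show "hol (\<lambda>z. f z + g z)" "hcoef (\<lambda>z. f z + g z) = (\<lambda>n. hcoef f n + hcoef g n)"
    by (rule hcoef_unique[OF *]; assumption)+
qed

lemma hcoef_cmult:
  assumes "hol f"
  shows "hol (\<lambda>z. c *s f z)" "hcoef (\<lambda>z. c *s f z) = (\<lambda>n. c *s hcoef f n)"
proof -
  have *: "(\<lambda>n. (c *s hcoef f n) $ i * z ^ n) sums ((c *s f z) $ i)" if "norm z < 1" for i z
    using sums_mult[OF hcoef_sums[OF assms(1) that], of c] by (simp add: mult_ac)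
  show "hol (\<lambda>z. c *s f z)" "hcoef (\<lambda>z. c *s f z) = (\<lambda>n. c *s hcoef f n)"
    by (rule hcoef_unique[OF *]; assumption)+
qed

lemma hcoef_zero: "hol (\<lambda>z. 0)" "hcoef (\<lambda>z. 0) = (\<lambda>n. 0)"
  using hcoef_unique[of "\<lambda>n. 0" "\<lambda>z. 0"] by auto

lemma hcoef_sum:
  assumes "\<And>i. i \<in> I \<Longrightarrow> hol (f i)"
  shows "hol (\<lambda>z. \<Sum>i\<in>I. c i *s f i z) \<and> hcoef (\<lambda>z. \<Sum>i\<in>I. c i *s f i z) = (\<lambda>n. \<Sum>i\<in>I. c i *s hcoef (f i) n)"
  using assms
proof (induct I rule: infinite_finite_induct)
  case (insert i I)
  then show ?case 
    using hcoef_add[of "\<lambda>z. c i *s f i z" "\<lambda>z. \<Sum>i\<in>I. c i *s f i z"] hcoef_cmult[of "f i" "c i"] by simp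
qed (use hcoef_zero in auto)

lemma hcoef_polynomial:
  "hol (\<lambda>z. \<Sum>n<N. z ^ n *s a n)" "hcoef (\<lambda>z. \<Sum>n<N. z ^ n *s a n) = (\<lambda>n. if n < N then a n else 0)"
proof -
  have *: "(\<lambda>n. (if n < N then a n else 0) $ i * z ^ n) sums ((\<Sum>n<N. z ^ n *s a n) $ i)" for i and z :: complex
  proof -
    have "(\<Sum>n<N. z ^ n *s a n) $ i = (\<Sum>n<N. (if n < N then a n else 0) $ i * z ^ n)"
      by (auto intro!: sum.cong)
    then show ?thesis using sums_finite[of "{..<N}" "\<lambda>n. (if n < N then a n else 0) $ i * z ^ n"] by simp
  qed
  show "hol (\<lambda>z. \<Sum>n<N. z ^ n *s a n)" "hcoef (\<lambda>z. \<Sum>n<N. z ^ n *s a n) = (\<lambda>n. if n < N then a n else 0)"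
    by (rule hcoef_unique[OF *])+
qed

lemma hcoef_shift:
  assumes "hol f"
  shows "hol (\<lambda>z. z ^ k *s f z)" "hcoef (\<lambda>z. z ^ k *s f z) = (\<lambda>n. if n < k then 0 else hcoef f (n - k))"
proof -
  have *: "(\<lambda>n. (if n < k then 0 else hcoef f (n - k)) $ i * z ^ n) sums ((z ^ k *s f z) $ i)" if "norm z < 1" for i z
  proof -
    have "(\<lambda>n. (if n + k < k then 0 else hcoef f (n + k - k)) $ i * z ^ (n + k)) sums ((z ^ k *s f z) $ i)"
      using sums_mult[OF hcoef_sums[OF assms(1) that], of "z ^ k" i] by (simp add: mult_ac power_add)
    then show ?thesis by (subst (asm) sums_iff_shift) simp
  qed
  show "hol (\<lambda>z. z ^ k *s f z)" "hcoef (\<lambda>z. z ^ k *s f z) = (\<lambda>n. if n < k then 0 else hcoef f (n - k))"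
    by (rule hcoef_unique[OF *]; assumption)+
qed

text \<open>
  The Taylor coefficients of \<open>\<Sum>i\<in>I. x i / (1 - z * cnj (w i))\<close>, a combination of reproducing kernels of the
  Hardy space.
\<close>

definition kcoef :: "'i set \<Rightarrow> ('i \<Rightarrow> complex) \<Rightarrow> ('i \<Rightarrow> complex^'k) \<Rightarrow> nat \<Rightarrow> complex^'k" where
  "kcoef I w x n = (\<Sum>i\<in>I. cnj (w i) ^ n *s x i)"

lemma l2_geometric: "l2 (\<lambda>n. c ^ n *s x)" if "norm c < 1"
proof -
  have "(norm c)\<^sup>2 < 1" using that by (simp add: power_less_one_iff)
  then have "summable (\<lambda>n. ((norm c)\<^sup>2) ^ n * (norm x)\<^sup>2)"
    by (intro summable_mult2 summable_geometric) simp
  then show ?thesis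
    by (simp add: l2_def norm_cmult_vec norm_power power_mult_distrib mult.commute flip: power_mult)
qed

lemma l2_kcoef: "(\<And>i. i \<in> I \<Longrightarrow> norm (w i) < 1) \<Longrightarrow> l2 (kcoef I w x)"
  unfolding kcoef_def by (intro l2_sum l2_geometric) simp

text \<open>
  Expanding the reproducing kernels into geometric series gives their scalar products.
\<close>

lemma kernel_norm:
  assumes "\<And>i. i \<in> I \<Longrightarrow> norm (w i) < 1"
  shows "(l2norm (kcoef I w x))\<^sup>2 = Re (\<Sum>i\<in>I. \<Sum>j\<in>I. hdot (x i) (x j) / (1 - w i * cnj (w j)))"
proof -
  have "(\<lambda>n. hdot (x i) (x j) * (w i * cnj (w j)) ^ n) sums (hdot (x i) (x j) * (1 / (1 - w i * cnj (w j))))"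
    if "i \<in> I" "j \<in> I" for i j
  proof (intro sums_mult geometric_sums)
    show "norm (w i * cnj (w j)) < 1" using assms[OF that(1)] assms[OF that(2)]
      by (simp add: norm_mult) (metis mult_strict_mono' norm_ge_zero mult_1)
  qed
  then have "(\<lambda>n. \<Sum>i\<in>I. \<Sum>j\<in>I. hdot (x i) (x j) * (w i * cnj (w j)) ^ n) sums
     (\<Sum>i\<in>I. \<Sum>j\<in>I. hdot (x i) (x j) / (1 - w i * cnj (w j)))"
    by (intro sums_sum) simp
  also have "(\<lambda>n. \<Sum>i\<in>I. \<Sum>j\<in>I. hdot (x i) (x j) * (w i * cnj (w j)) ^ n) =
      (\<lambda>n. hdot (kcoef I w x n) (kcoef I w x n))"
    by (simp only: kcoef_def hdot_sum(1)) (simp add: hdot_sum(2) power_mult_distrib mult_ac sum_distrib_left)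
  finally have "(\<lambda>n. Re (hdot (kcoef I w x n) (kcoef I w x n))) sums
      Re (\<Sum>i\<in>I. \<Sum>j\<in>I. hdot (x i) (x j) / (1 - w i * cnj (w j)))"
    by (rule sums_Re)
  moreover have "l2 (kcoef I w x)" using assms by (rule l2_kcoef)
  ultimately show ?thesis
    by (simp add: l2norm_square hdot_self sums_iff del: Re_sum)
qed

text \<open>
  The reproducing property: the scalar product with the kernel at \<open>w\<close> is evaluation at \<open>w\<close>.
\<close>

lemma kernel_pairing:
  assumes "\<And>i. i \<in> I \<Longrightarrow> norm (w i) < 1" "hol f"
  shows "(\<lambda>n. hdot (kcoef I w x n) (hcoef f n)) sums (\<Sum>i\<in>I. hdot (x i) (f (w i)))"
proof -
  have "(\<lambda>n. hdot (x i) (hcoef f n) * w i ^ n) sums hdot (x i) (f (w i))" if "i \<in> I" for i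
  proof -
    have "(\<lambda>n. \<Sum>a\<in>UNIV. cnj (x i $ a) * (hcoef f n $ a * w i ^ n)) sums (\<Sum>a\<in>UNIV. cnj (x i $ a) * f (w i) $ a)"
      using assms(1)[OF that] assms(2) by (intro sums_sum sums_mult hcoef_sums)
    then show ?thesis by (simp add: hdot_def sum_distrib_right mult.assoc)
  qed
  then have "(\<lambda>n. \<Sum>i\<in>I. hdot (x i) (hcoef f n) * w i ^ n) sums (\<Sum>i\<in>I. hdot (x i) (f (w i)))"
    by (rule sums_sum)
  then show ?thesis by (simp add: kcoef_def hdot_sum mult_ac)
qed

lemma kernel_pairing_le:
  assumes "\<And>i. i \<in> I \<Longrightarrow> norm (w i) < 1" "hol f" "l2 (hcoef f)"
  shows "norm (\<Sum>i\<in>I. hdot (x i) (f (w i))) \<le> l2norm (kcoef I w x) * l2norm (hcoef f)"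
  using l2_pairing(2)[OF l2_kcoef[of I w x] assms(3)] kernel_pairing[of I w f x] assms
  by (simp add: sums_iff)

section \<open>Integral means over circles\<close>

lemma has_integral_cis:
  "((\<lambda>t. cis (of_int k * t)) has_integral (if k = 0 then 2 * pi else 0)) {0..2*pi}"
proof (cases "k = 0")
  case True
  then show ?thesis using has_integral_const_real[of "1::complex" 0 "2*pi"] by (simp add: scaleR_conv_of_real)
next
  case False
  define F where "F t = cis (of_int k * t) / (\<i> * of_int k)" for t
  have "(F has_vector_derivative cis (of_int k * t)) (at t within {0..2*pi})" for t
  proof -
    have "((\<lambda>t. exp (\<i> * complex_of_real (of_int k * t)) / (\<i> * of_int k)) has_vector_derivative exp (\<i> * complex_of_real (of_int k * t))) (at t within {0..2*pi})"
      using False by (auto intro!: derivative_eq_intros has_vector_derivative_real_field simp: scaleR_conv_of_real field_simps)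
    then show ?thesis by (simp add: F_def[abs_def] cis_conv_exp)
  qed
  then have "((\<lambda>t. cis (of_int k * t)) has_integral (F (2*pi) - F 0)) {0..2*pi}"
    by (intro fundamental_theorem_of_calculus) auto
  moreover have "cis (of_int k * (2 * pi)) = 1"
    using cis_multiple_2pi[of "of_int k"] by (simp add: mult.commute)
  ultimately show ?thesis using False by (simp add: F_def)
qed

lemma parseval_finite:
  "((\<lambda>t. (norm (\<Sum>n<N. b n * cis (of_nat n * t)))\<^sup>2) has_integral (2 * pi * (\<Sum>n<N. (norm (b n))\<^sup>2))) {0..2*pi}"
proof -
  have "((\<lambda>t. \<Sum>n<N. \<Sum>m<N. b n * cnj (b m) * cis (of_int (int n - int m) * t)) has_integral
     (\<Sum>n<N. \<Sum>m<N. b n * cnj (b m) * (if int n - int m = 0 then 2 * pi else 0))) {0..2*pi}"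
    by (intro has_integral_sum has_integral_mult_right has_integral_cis) auto
  also have "(\<lambda>t. \<Sum>n<N. \<Sum>m<N. b n * cnj (b m) * cis (of_int (int n - int m) * t)) =
     (\<lambda>t. complex_of_real ((norm (\<Sum>n<N. b n * cis (of_nat n * t)))\<^sup>2))"
  proof
    fix t
    have "cis (of_int (int n - int m) * t) = cis (of_nat n * t) * cnj (cis (of_nat m * t))" for n m
      by (simp add: cis_cnj cis_mult left_diff_distrib)
    then show "(\<Sum>n<N. \<Sum>m<N. b n * cnj (b m) * cis (of_int (int n - int m) * t)) = 
        complex_of_real ((norm (\<Sum>n<N. b n * cis (of_nat n * t)))\<^sup>2)"
      unfolding complex_norm_square cnj_sum sum_product by (simp add: mult_ac)
  qed
  also have "(\<Sum>n<N. \<Sum>m<N. b n * cnj (b m) * (if int n - int m = 0 then 2 * pi else 0)) =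
     complex_of_real (2 * pi * (\<Sum>n<N. (norm (b n))\<^sup>2))"
  proof -
    have "(\<Sum>m<N. b n * cnj (b m) * (if int n - int m = 0 then 2 * pi else 0)) = 2 * pi * complex_of_real ((norm (b n))\<^sup>2)"
      if "n < N" for n
    proof -
      have "(\<Sum>m<N. b n * cnj (b m) * (if int n - int m = 0 then 2 * pi else 0)) = 
         (\<Sum>m<N. if m = n then b n * cnj (b n) * (2 * pi) else 0)"
        by (intro sum.cong refl) auto
      then show ?thesis using that unfolding complex_norm_square by simp
    qed
    then show ?thesis by (simp add: sum_distrib_left)
  qed
  finally show ?thesis
    by (drule_tac has_integral_linear[OF _ bounded_linear_Re]) (simp only: o_def Re_complex_of_real)
qed

text \<open>
  The partial sums converge uniformly, so the finite identity passes to the limit.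
\<close>

lemma parseval_series:
  assumes "summable (\<lambda>n. norm (b n))"
  shows "((\<lambda>t. (norm (\<Sum>n. b n * cis (of_nat n * t)))\<^sup>2) has_integral (2 * pi * (\<Sum>n. (norm (b n))\<^sup>2))) {0..2*pi}"
    "summable (\<lambda>n. (norm (b n))\<^sup>2)"
    "continuous_on {0..2*pi} (\<lambda>t. \<Sum>n. b n * cis (of_nat n * t))"
proof -
  define s where "s N t = (\<Sum>n<N. b n * cis (of_nat n * t))" for N t
  define g where "g t = (\<Sum>n. b n * cis (of_nat n * t))" for t
  have u: "uniform_limit {0..2*pi} s g sequentially"
    unfolding s_def g_def using assms
    by (intro Weierstrass_m_test[of _ _ "\<lambda>n. norm (b n)"]) (auto simp: norm_mult)
  have cs: "continuous_on {0..2*pi} (s N)" for N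
    unfolding s_def by (intro continuous_intros)
  have cg: "continuous_on {0..2*pi} g"
    by (rule uniform_limit_theorem[OF _ u]) (use cs in auto)
  then show "continuous_on {0..2*pi} (\<lambda>t. \<Sum>n. b n * cis (of_nat n * t))" by (simp add: g_def[abs_def])
  have un: "uniform_limit {0..2*pi} (\<lambda>N t. norm (s N t)) (\<lambda>t. norm (g t)) sequentially"
    by (intro uniform_limit_intros u)
  have bd: "bounded ((\<lambda>t. norm (g t)) ` {0..2*pi})"
    by (intro compact_imp_bounded compact_continuous_image continuous_intros cg) auto
  have A: "uniform_limit {0..2*pi} (\<lambda>N t. norm (s N t) * norm (s N t)) (\<lambda>t. norm (g t) * norm (g t)) sequentially"
    by (intro uniform_lim_mult un bd)
  have B: "continuous_on {0..2*pi} (\<lambda>t. norm (s N t) * norm (s N t))" for N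
    by (intro continuous_intros cs)
  obtain I J where I: "\<And>N. ((\<lambda>t. norm (s N t) * norm (s N t)) has_integral I N) {0..2*pi}"
    and J: "((\<lambda>t. norm (g t) * norm (g t)) has_integral J) {0..2*pi}" and lim: "I \<longlonglongrightarrow> J"
    by (rule uniform_limit_integral[OF A B sequentially_bot]) (rule that)
  have "I N = 2 * pi * (\<Sum>n<N. (norm (b n))\<^sup>2)" for N
    using has_integral_unique[OF I[of N]] parseval_finite[where b = b and N = N] by (simp add: s_def power2_eq_square)
  then have "(\<lambda>N. (1 / (2*pi)) * I N) = (\<lambda>N. \<Sum>n<N. (norm (b n))\<^sup>2)" by auto
  moreover have "(\<lambda>N. (1 / (2*pi)) * I N) \<longlonglongrightarrow> (1 / (2*pi)) * J" by (intro tendsto_intros lim)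
  ultimately have "(\<lambda>n. (norm (b n))\<^sup>2) sums ((1 / (2*pi)) * J)" by (simp add: sums_def)
  then show "summable (\<lambda>n. (norm (b n))\<^sup>2)"
    "((\<lambda>t. (norm (\<Sum>n. b n * cis (of_nat n * t)))\<^sup>2) has_integral (2 * pi * (\<Sum>n. (norm (b n))\<^sup>2))) {0..2*pi}"
    using J by (auto simp: sums_iff g_def[symmetric] power2_eq_square)
qed

lemma parseval_vec:
  fixes b :: "nat \<Rightarrow> complex^'k"
  assumes "summable (\<lambda>n. norm (b n))" "\<And>t i. f t $ i = (\<Sum>n. b n $ i * cis (of_nat n * t))"
  shows "((\<lambda>t. (norm (f t))\<^sup>2) has_integral (2 * pi * (l2norm b)\<^sup>2)) {0..2*pi}" "l2 b"
    "continuous_on {0..2*pi} f"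
proof -
  have sm: "summable (\<lambda>n. norm (b n $ i))" for i
    by (rule summable_comparison_test'[OF assms(1), of 0]) (simp add: Finite_Cartesian_Product.norm_nth_le)
  note P = parseval_series[OF sm]
  have "continuous_on {0..2*pi} (\<lambda>t. \<chi> i. f t $ i)"
    unfolding assms(2) by (intro continuous_intros P(3))
  then show "continuous_on {0..2*pi} f" by simp
  have "(\<lambda>n. (norm (b n))\<^sup>2) = (\<lambda>n. \<Sum>i\<in>UNIV. (norm (b n $ i))\<^sup>2)" by (simp add: norm_vec_square)
  then have S: "(\<lambda>n. (norm (b n))\<^sup>2) sums (\<Sum>i\<in>UNIV. \<Sum>n. (norm (b n $ i))\<^sup>2)"
    using sums_sum[of UNIV "\<lambda>i n. (norm (b n $ i))\<^sup>2"] P(2) by (simp add: summable_sums)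
  then show l: "l2 b" by (simp add: l2_def sums_iff)
  have "((\<lambda>t. \<Sum>i\<in>UNIV. (norm (f t $ i))\<^sup>2) has_integral (\<Sum>i\<in>UNIV. 2 * pi * (\<Sum>n. (norm (b n $ i))\<^sup>2))) {0..2*pi}"
    unfolding assms(2) by (intro has_integral_sum P(1)) auto
  then show "((\<lambda>t. (norm (f t))\<^sup>2) has_integral (2 * pi * (l2norm b)\<^sup>2)) {0..2*pi}"
    using S by (simp add: norm_vec_square[of "f _"] l2norm_square[OF l] sums_iff sum_distrib_left)
qed

lemma summable_hcoef:
  assumes "hol f" "0 \<le> r" "r < 1"
  shows "summable (\<lambda>n. norm (of_real r ^ n *s hcoef f n))"
proof -
  obtain \<rho> where \<rho>: "r < \<rho>" "\<rho> < 1" using dense[OF assms(3)] by blast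
  have "summable (\<lambda>n. norm (hcoef f n $ i * (of_real r) ^ n))" for i
    by (rule powser_insidea[of _ "of_real \<rho>"])
       (use hcoef_sums[OF assms(1), of "of_real \<rho>" i] assms \<rho> in \<open>auto simp: sums_iff\<close>)
  then have "summable (\<lambda>n. \<Sum>i\<in>UNIV. norm (hcoef f n $ i * (of_real r) ^ n))" by (rule summable_sum)
  then show ?thesis
    by (rule summable_comparison_test'[of _ 0])
       (use L2_set_le_sum[of UNIV "\<lambda>i. norm ((of_real r ^ n *s hcoef f n) $ i)" for n]
         in \<open>simp add: norm_vec_def mult.commute\<close>)
qed

lemma hol_circle:
  assumes "hol f" "0 \<le> r" "r < 1"
  shows "f (of_real r * cis t) $ i = (\<Sum>n. (of_real r ^ n *s hcoef f n) $ i * cis (of_nat n * t))"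
proof -
  have "norm (of_real r * cis t) < 1" using assms by (simp add: norm_mult)
  note S = hcoef_sums[OF assms(1) this, of i]
  have "hcoef f n $ i * (of_real r * cis t) ^ n = (of_real r ^ n *s hcoef f n) $ i * cis (of_nat n * t)" for n
    unfolding power_mult_distrib Complex.DeMoivre by simp
  with S show ?thesis by (simp only: sums_iff)
qed

lemma parseval_circle:
  assumes "hol f" "0 \<le> r" "r < 1"
  shows "((\<lambda>t. (norm (f (of_real r * cis t)))\<^sup>2) has_integral (2 * pi * (l2norm (\<lambda>n. of_real r ^ n *s hcoef f n))\<^sup>2)) {0..2*pi}"
    "l2 (\<lambda>n. of_real r ^ n *s hcoef f n)" "continuous_on {0..2*pi} (\<lambda>t. f (of_real r * cis t))"
  using parseval_vec[OF summable_hcoef[OF assms], of "\<lambda>t. f (of_real r * cis t)"] hol_circle[OF assms] by auto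

text \<open>
  By Parseval, the integral over the circle of radius \<open>r\<close> is \<open>2 * pi\<close> times \<open>\<Sum>n. r ^ (2 * n) * (norm (hcoef f n))\<^sup>2\<close>,
  and this increases to the same sum without the factors \<open>r ^ (2 * n)\<close>.
\<close>

lemma hardy_disc_iff: "f \<in> hardy_disc \<longleftrightarrow> hol f \<and> l2 (hcoef f)"
proof
  assume f: "f \<in> hardy_disc"
  then have h: "hol f" by (simp add: hardy_disc_def hol_def)
  from f obtain C where C: "\<And>r. 0 \<le> r \<Longrightarrow> r < 1 \<Longrightarrow> integral {0..2*pi} (\<lambda>t. (norm (f (of_real r * cis t)))\<^sup>2) \<le> C"
    unfolding hardy_disc_def mem_Collect_eq by (meson atLeastLessThan_iff)
  have "(\<Sum>n<N. (norm (hcoef f n))\<^sup>2) \<le> C / (2 * pi)" for N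
  proof -
    have r: "(\<Sum>n<N. (r ^ n * norm (hcoef f n))\<^sup>2) \<le> C / (2 * pi)" if "0 \<le> r" "r < 1" for r
    proof -
      have "(\<Sum>n<N. (norm (of_real r ^ n *s hcoef f n))\<^sup>2) \<le> (l2norm (\<lambda>n. of_real r ^ n *s hcoef f n))\<^sup>2"
        using parseval_circle(2)[OF h that] unfolding l2norm_square[OF parseval_circle(2)[OF h that]] l2_def
        by (intro sum_le_suminf) auto
      also have "\<dots> \<le> C / (2 * pi)"
        using C[OF that] integral_unique[OF parseval_circle(1)[OF h that]] by (simp add: field_simps)
      finally show ?thesis using that by (simp add: norm_cmult_vec norm_power)
    qed
    have "((\<lambda>r. \<Sum>n<N. (r ^ n * norm (hcoef f n))\<^sup>2) \<longlongrightarrow> (\<Sum>n<N. (1 ^ n * norm (hcoef f n))\<^sup>2)) (at_left (1::real))"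
      by (intro tendsto_intros)
    moreover have "eventually (\<lambda>r. (\<Sum>n<N. (r ^ n * norm (hcoef f n))\<^sup>2) \<le> C / (2 * pi)) (at_left (1::real))"
    proof -
      have "eventually (\<lambda>r. r \<in> {0<..<1}) (at_left (1::real))" by (intro eventually_at_left_real) simp
      then show ?thesis by eventually_elim (use r in auto)
    qed
    ultimately have "(\<Sum>n<N. (1 ^ n * norm (hcoef f n))\<^sup>2) \<le> C / (2 * pi)"
      by (rule tendsto_upperbound) simp
    then show ?thesis by simp
  qed
  then have "l2 (hcoef f)" unfolding l2_def
    by (intro summableI_nonneg_bounded[of _ "C / (2 * pi)"]) auto
  with h show "hol f \<and> l2 (hcoef f)" by simp
next
  assume f: "hol f \<and> l2 (hcoef f)"
  have "integral {0..2*pi} (\<lambda>t. (norm (f (of_real r * cis t)))\<^sup>2) \<le> 2 * pi * (l2norm (hcoef f))\<^sup>2"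
    if r: "r \<in> {0..<1}" for r
  proof -
    have r': "0 \<le> r" "r < 1" using r by auto
    note p = parseval_circle[OF conjunct1[OF f] r']
    have "(l2norm (\<lambda>n. of_real r ^ n *s hcoef f n))\<^sup>2 \<le> (l2norm (hcoef f))\<^sup>2"
      unfolding l2norm_square[OF p(2)] l2norm_square[OF conjunct2[OF f]]
    proof (rule suminf_le)
      fix n show "(norm (of_real r ^ n *s hcoef f n))\<^sup>2 \<le> (norm (hcoef f n))\<^sup>2"
        using r' by (intro power_mono) (auto simp: norm_cmult_vec norm_power power_le_one mult_left_le_one_le)
    qed (use p(2) f in \<open>auto simp: l2_def\<close>)
    then show ?thesis using integral_unique[OF p(1)] by simp
  qed
  then show "f \<in> hardy_disc" using f unfolding hardy_disc_def hol_def by blast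
qed

section \<open>Radial boundary values\<close>

lemma nn_integral_circle_continuous:
  assumes "continuous_on {0..2*pi} g" "\<And>t. g t \<ge> 0" "(g has_integral I) {0..2*pi}"
  shows "(\<integral>\<^sup>+ t. ennreal (g t) \<partial>lebesgue_on {0..2*pi}) = ennreal I"
proof -
  have i: "integrable (lebesgue_on {0..2*pi}) g"
    using assms(1) by (rule continuous_imp_integrable_real)
  have "(\<integral>\<^sup>+ t. ennreal (g t) \<partial>lebesgue_on {0..2*pi}) = ennreal (integral\<^sup>L (lebesgue_on {0..2*pi}) g)"
    using assms(2) by (intro nn_integral_eq_integral i) auto
  also have "integral\<^sup>L (lebesgue_on {0..2*pi}) g = I"
    using lebesgue_integral_eq_integral[OF i] integral_unique[OF assms(3)] by simp
  finally show ?thesis .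
qed

text \<open>
  The weight \<open>\<eta>\<close> brings the constant in front of the main term as close to \<open>1\<close> as desired.
\<close>

lemma norm_square_split:
  fixes x y :: "'a::real_normed_vector"
  assumes "\<eta> > 0"
  shows "(norm x)\<^sup>2 \<le> (1 + \<eta>) * (norm y)\<^sup>2 + (1 + 1 / \<eta>) * (norm (y - x))\<^sup>2"
proof -
  let ?a = "norm y" and ?b = "norm (y - x)"
  have "norm x \<le> ?a + ?b" using norm_triangle_sub[of x y] by (simp add: norm_minus_commute)
  then have "(norm x)\<^sup>2 \<le> (?a + ?b)\<^sup>2" by (intro power_mono) auto
  moreover have "2 * ?a * ?b \<le> \<eta> * ?a\<^sup>2 + 1 / \<eta> * ?b\<^sup>2"
  proof -
    have "0 \<le> (sqrt \<eta> * ?a - ?b / sqrt \<eta>)\<^sup>2" by simp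
    also have "\<dots> = \<eta> * ?a\<^sup>2 + 1 / \<eta> * ?b\<^sup>2 - 2 * ?a * ?b"
      using assms by (simp add: power2_diff power_mult_distrib power_divide)
    finally show ?thesis by simp
  qed
  ultimately show ?thesis by (simp add: power2_sum algebra_simps)
qed

text \<open>
  Let \<open>F n\<close> be the restriction of \<open>f\<close> to the circle of radius \<open>r n\<close>, where \<open>r n\<close> increases to \<open>1\<close>. By Parseval, the square
  of the \<open>L\<^sup>2\<close> distance of \<open>F n\<close> and \<open>F m\<close> is at most \<open>2 * pi * D m\<close> for \<open>m \<le> n\<close>, where \<open>D m\<close> tends to zero. Fatou's lemma
  transfers this bound to the distance of \<open>g\<close> and \<open>F m\<close>. Therefore the norm of \<open>F m\<close> exceeds that of \<open>g\<close> by an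
  arbitrarily small amount for large \<open>m\<close>.
\<close>

lemma hardy_norm_le_boundary:
  assumes f: "f \<in> hardy_disc"
    and lim: "AE t in lebesgue_on {0..2*pi}. ((\<lambda>r. f (of_real r * cis t)) \<longlongrightarrow> g t) (at_left 1)"
  shows "ennreal (2 * pi * (l2norm (hcoef f))\<^sup>2) \<le> (\<integral>\<^sup>+ t. ennreal ((norm (g t))\<^sup>2) \<partial>lebesgue_on {0..2*pi})"
proof -
  let ?M = "lebesgue_on {0..2*pi}"
  have h: "hol f" and l: "l2 (hcoef f)" using f by (auto simp: hardy_disc_iff)
  define r where "r n = 1 - 1 / (real n + 2)" for n
  have r01: "0 \<le> r n" "r n < 1" for n by (auto simp: r_def field_simps)
  have rlim: "filterlim r (at_left 1) sequentially" unfolding r_def by real_asymp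
  have rmono: "r m \<le> r n" if "m \<le> n" for m n using that by (simp add: r_def frac_le)
  define F where "F n t = f (of_real (r n) * cis t)" for n t
  have cF: "continuous_on {0..2*pi} (F n)" for n unfolding F_def by (rule parseval_circle(3)[OF h r01])
  have limF: "AE t in ?M. (\<lambda>n. F n t) \<longlonglongrightarrow> g t"
    using lim by eventually_elim (use filterlim_compose[OF _ rlim] in \<open>auto simp: F_def\<close>)
  have mF: "F n \<in> borel_measurable ?M" for n
    by (rule continuous_imp_measurable_on_sets_lebesgue[OF cF]) simp
  define D where "D m = (\<Sum>k. (norm ((1 - r m ^ k) * norm (hcoef f k)))\<^sup>2)" for m
  have Dsum: "summable (\<lambda>k. (norm ((1 - r m ^ k) * norm (hcoef f k)))\<^sup>2)" for m
  proof (rule summable_comparison_test'[OF l[unfolded l2_def], of 0])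
    fix k
    have "\<bar>1 - r m ^ k\<bar> \<le> 1" using r01[of m] by (auto simp: power_le_one)
    then have "norm ((1 - r m ^ k) * norm (hcoef f k)) \<le> norm (hcoef f k)"
      by (simp add: abs_mult mult_left_le_one_le)
    from power_mono[OF this norm_ge_zero, of 2] show "norm ((norm ((1 - r m ^ k) * norm (hcoef f k)))\<^sup>2) \<le> (norm (hcoef f k))\<^sup>2"
      by simp
  qed
  have Dlim: "D \<longlonglongrightarrow> 0"
  proof -
    have "(\<lambda>m. \<Sum>k. (norm ((1 - r m ^ k) * norm (hcoef f k)))\<^sup>2) \<longlonglongrightarrow> (\<Sum>k. 0)"
    proof (rule conjunct2[OF conjunct2[OF tannerys_theorem[where M = "\<lambda>k. (norm (hcoef f k))\<^sup>2"]]])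
      fix k
      have "(\<lambda>m. (norm ((1 - r m ^ k) * norm (hcoef f k)))\<^sup>2) \<longlonglongrightarrow> (norm ((1 - 1 ^ k) * norm (hcoef f k)))\<^sup>2"
        using rlim by (intro tendsto_intros) (simp add: filterlim_at)
      then show "(\<lambda>m. (norm ((1 - r m ^ k) * norm (hcoef f k)))\<^sup>2) \<longlonglongrightarrow> 0" by simp
      show "\<forall>\<^sub>F (k, n) in sequentially \<times>\<^sub>F sequentially. norm ((norm ((1 - r n ^ k) * norm (hcoef f k)))\<^sup>2) \<le> (norm (hcoef f k))\<^sup>2"
      proof (rule always_eventually, clarify)
        fix k m
        have "\<bar>1 - r m ^ k\<bar> \<le> 1" using r01[of m] by (auto simp: power_le_one)
        then have "norm ((1 - r m ^ k) * norm (hcoef f k)) \<le> norm (hcoef f k)"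
          by (simp add: abs_mult mult_left_le_one_le)
        from power_mono[OF this norm_ge_zero, of 2] show "norm ((norm ((1 - r m ^ k) * norm (hcoef f k)))\<^sup>2) \<le> (norm (hcoef f k))\<^sup>2"
          by simp
      qed
    qed (use l in \<open>auto simp: l2_def\<close>)
    then show ?thesis by (simp add: D_def[abs_def])
  qed
  have diff: "(\<integral>\<^sup>+ t. ennreal ((norm (F n t - F m t))\<^sup>2) \<partial>?M) \<le> ennreal (2 * pi * D m)" if "m \<le> n" for n m
  proof -
    let ?b = "\<lambda>k. of_real (r n) ^ k *s hcoef f k + (-1) *s (of_real (r m) ^ k *s hcoef f k)"
    have sb: "summable (\<lambda>k. norm (?b k))"
    proof (rule summable_comparison_test'[OF summable_add[OF summable_hcoef[OF h r01, of n] summable_hcoef[OF h r01, of m]], of 0])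
      fix k show "norm (norm (?b k)) \<le> norm (of_real (r n) ^ k *s hcoef f k) + norm (of_real (r m) ^ k *s hcoef f k)"
        using norm_triangle_ineq[of "of_real (r n) ^ k *s hcoef f k" "(-1) *s (of_real (r m) ^ k *s hcoef f k)"]
        by (simp add: norm_cmult_vec)
    qed
    have comp: "(F n t - F m t) $ i = (\<Sum>k. ?b k $ i * cis (of_nat k * t))" for t i
    proof -
      have S: "summable (\<lambda>k. (of_real (r n) ^ k *s hcoef f k) $ i * cis (of_nat k * t))" for n
        by (rule summable_comparison_test'[OF summable_hcoef[OF h r01, of n], of 0])
           (simp add: norm_mult del: vector_smult_component, rule Finite_Cartesian_Product.norm_nth_le)
      show ?thesis
        unfolding F_def vector_minus_component hol_circle[OF h r01] suminf_diff[OF S S]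
        by (simp add: ring_distribs)
    qed
    note P = parseval_vec[OF sb comp]
    have "(l2norm ?b)\<^sup>2 \<le> D m"
      unfolding l2norm_square[OF P(2)] D_def
    proof (rule suminf_le)
      fix k
      have "?b k = of_real (r n ^ k - r m ^ k) *s hcoef f k" by (simp add: vec_eq_iff ring_distribs)
      then have "norm (?b k) = \<bar>r n ^ k - r m ^ k\<bar> * norm (hcoef f k)" by (simp only: norm_cmult_vec norm_of_real)
      also have "\<bar>r n ^ k - r m ^ k\<bar> \<le> \<bar>1 - r m ^ k\<bar>"
        using r01[of n] r01[of m] rmono[OF that] power_mono[OF rmono[OF that], of k] by (auto simp: power_le_one)
      finally have "norm (?b k) \<le> norm ((1 - r m ^ k) * norm (hcoef f k))"
        by (simp add: abs_mult mult_right_mono)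
      then show "(norm (?b k))\<^sup>2 \<le> (norm ((1 - r m ^ k) * norm (hcoef f k)))\<^sup>2" by (rule power_mono) simp
    qed (use P(2) Dsum in \<open>auto simp: l2_def\<close>)
    moreover have "(\<integral>\<^sup>+ t. ennreal ((norm (F n t - F m t))\<^sup>2) \<partial>?M) = ennreal (2 * pi * (l2norm ?b)\<^sup>2)"
      by (rule nn_integral_circle_continuous[OF _ _ P(1)]) (intro continuous_intros cF, simp)
    ultimately show ?thesis by (simp add: ennreal_leI)
  qed
  have gdiff: "(\<integral>\<^sup>+ t. ennreal ((norm (g t - F m t))\<^sup>2) \<partial>?M) \<le> ennreal (2 * pi * D m)" for m
  proof -
    have "(\<integral>\<^sup>+ t. ennreal ((norm (g t - F m t))\<^sup>2) \<partial>?M) = (\<integral>\<^sup>+ t. liminf (\<lambda>n. ennreal ((norm (F n t - F m t))\<^sup>2)) \<partial>?M)"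
    proof (rule nn_integral_cong_AE, use limF in eventually_elim)
      fix t assume "(\<lambda>n. F n t) \<longlonglongrightarrow> g t"
      then have "(\<lambda>n. ennreal ((norm (F n t - F m t))\<^sup>2)) \<longlonglongrightarrow> ennreal ((norm (g t - F m t))\<^sup>2)"
        by (intro tendsto_ennrealI tendsto_intros)
      then show "ennreal ((norm (g t - F m t))\<^sup>2) = liminf (\<lambda>n. ennreal ((norm (F n t - F m t))\<^sup>2))"
        using lim_imp_Liminf[OF sequentially_bot] by metis
    qed
    also have "\<dots> \<le> liminf (\<lambda>n. \<integral>\<^sup>+ t. ennreal ((norm (F n t - F m t))\<^sup>2) \<partial>?M)"
      using mF by (intro nn_integral_liminf) measurable
    also have "\<dots> \<le> ennreal (2 * pi * D m)"
      by (rule order_trans[OF Liminf_le_Limsup Limsup_bounded])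
         (use diff in \<open>auto simp: eventually_sequentially\<close>)
    finally show ?thesis .
  qed
  let ?G = "\<integral>\<^sup>+ t. ennreal ((norm (g t))\<^sup>2) \<partial>?M"
  show ?thesis
  proof (cases "?G = \<infinity>")
    case False
    then obtain I where I: "?G = ennreal I" "I \<ge> 0" by (cases ?G) auto
    \<comment> \<open>Measurable versions of \<open>(norm (g t))\<^sup>2\<close> and \<open>(norm (g t - F m t))\<^sup>2\<close>, for which the integral is additive.\<close>
    define u where "u t = liminf (\<lambda>n. ennreal ((norm (F n t))\<^sup>2))" for t
    define v where "v m t = liminf (\<lambda>n. ennreal ((norm (F n t - F m t))\<^sup>2))" for m t
    have mu: "u \<in> borel_measurable ?M" "v m \<in> borel_measurable ?M" for m
      unfolding u_def v_def using mF by measurable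
    have uv: "AE t in ?M. u t = ennreal ((norm (g t))\<^sup>2) \<and> v m t = ennreal ((norm (g t - F m t))\<^sup>2)" for m
      using limF
    proof eventually_elim
      fix t assume "(\<lambda>n. F n t) \<longlonglongrightarrow> g t"
      then have "(\<lambda>n. ennreal ((norm (F n t - F m t))\<^sup>2)) \<longlonglongrightarrow> ennreal ((norm (g t - F m t))\<^sup>2)"
        "(\<lambda>n. ennreal ((norm (F n t))\<^sup>2)) \<longlonglongrightarrow> ennreal ((norm (g t))\<^sup>2)"
        by (intro tendsto_ennrealI tendsto_intros; assumption)+
      then show "u t = ennreal ((norm (g t))\<^sup>2) \<and> v m t = ennreal ((norm (g t - F m t))\<^sup>2)"
        unfolding u_def v_def using lim_imp_Liminf[OF sequentially_bot] by metis
    qed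
    have key: "2 * pi * (\<Sum>k<K. (r m ^ k * norm (hcoef f k))\<^sup>2) \<le> (1 + \<eta>) * I + (1 + 1 / \<eta>) * (2 * pi * D m)"
      if \<eta>: "\<eta> > 0" for \<eta> m K
    proof -
      have D0: "D m \<ge> 0" unfolding D_def by (intro suminf_nonneg Dsum) auto
      note p = parseval_circle[OF h r01, of m]
      have "ennreal (2 * pi * (l2norm (\<lambda>n. of_real (r m) ^ n *s hcoef f n))\<^sup>2) = (\<integral>\<^sup>+ t. ennreal ((norm (F m t))\<^sup>2) \<partial>?M)"
        unfolding F_def by (rule nn_integral_circle_continuous[OF _ _ p(1), symmetric]) (intro continuous_intros p(3), simp)
      also have "\<dots> \<le> (\<integral>\<^sup>+ t. ennreal (1 + \<eta>) * u t + ennreal (1 + 1 / \<eta>) * v m t \<partial>?M)"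
      proof (rule nn_integral_mono_AE, use uv[of m] in eventually_elim)
        fix t assume "u t = ennreal ((norm (g t))\<^sup>2) \<and> v m t = ennreal ((norm (g t - F m t))\<^sup>2)"
        then have "ennreal (1 + \<eta>) * u t + ennreal (1 + 1 / \<eta>) * v m t =
           ennreal ((1 + \<eta>) * (norm (g t))\<^sup>2 + (1 + 1 / \<eta>) * (norm (g t - F m t))\<^sup>2)"
          using \<eta> by (simp add: ennreal_mult ennreal_plus)
        then show "ennreal ((norm (F m t))\<^sup>2) \<le> ennreal (1 + \<eta>) * u t + ennreal (1 + 1 / \<eta>) * v m t"
          using norm_square_split[OF \<eta>, of "F m t" "g t"] by (simp add: ennreal_leI)
      qed
      also have "\<dots> = ennreal (1 + \<eta>) * (\<integral>\<^sup>+ t. u t \<partial>?M) + ennreal (1 + 1 / \<eta>) * (\<integral>\<^sup>+ t. v m t \<partial>?M)"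
        using mu by (simp add: nn_integral_add nn_integral_cmult)
      also have "(\<integral>\<^sup>+ t. u t \<partial>?M) = ennreal I"
        unfolding I(1)[symmetric] by (rule nn_integral_cong_AE) (use uv[of m] in auto)
      also have "(\<integral>\<^sup>+ t. v m t \<partial>?M) = (\<integral>\<^sup>+ t. ennreal ((norm (g t - F m t))\<^sup>2) \<partial>?M)"
        by (rule nn_integral_cong_AE) (use uv[of m] in auto)
      also have "ennreal (1 + \<eta>) * ennreal I + ennreal (1 + 1 / \<eta>) * (\<integral>\<^sup>+ t. ennreal ((norm (g t - F m t))\<^sup>2) \<partial>?M)
         \<le> ennreal (1 + \<eta>) * ennreal I + ennreal (1 + 1 / \<eta>) * ennreal (2 * pi * D m)"
        by (intro add_left_mono mult_left_mono gdiff) auto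
      also have "\<dots> = ennreal ((1 + \<eta>) * I + (1 + 1 / \<eta>) * (2 * pi * D m))"
        using \<eta> I(2) D0 by (simp add: ennreal_mult ennreal_plus)
      finally have "2 * pi * (l2norm (\<lambda>n. of_real (r m) ^ n *s hcoef f n))\<^sup>2 \<le> (1 + \<eta>) * I + (1 + 1 / \<eta>) * (2 * pi * D m)"
        using \<eta> I(2) D0 by (subst (asm) ennreal_le_iff) auto
      moreover have "(\<Sum>k<K. (r m ^ k * norm (hcoef f k))\<^sup>2) \<le> (l2norm (\<lambda>n. of_real (r m) ^ n *s hcoef f n))\<^sup>2"
      proof -
        have "(\<Sum>k<K. (norm (of_real (r m) ^ k *s hcoef f k))\<^sup>2) \<le> (l2norm (\<lambda>n. of_real (r m) ^ n *s hcoef f n))\<^sup>2"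
          unfolding l2norm_square[OF p(2)] using p(2)[unfolded l2_def] by (intro sum_le_suminf) auto
        then show ?thesis using r01[of m] by (simp add: norm_cmult_vec norm_power)
      qed
      ultimately show ?thesis by (smt (verit) mult_left_mono pi_gt_zero)
    qed
    have "2 * pi * (\<Sum>k<K. (norm (hcoef f k))\<^sup>2) \<le> (1 + \<eta>) * I" if \<eta>: "\<eta> > 0" for \<eta> K
    proof -
      have rl: "r \<longlonglongrightarrow> 1" using rlim by (simp add: filterlim_at)
      have "(\<lambda>m. 2 * pi * (\<Sum>k<K. (r m ^ k * norm (hcoef f k))\<^sup>2)) \<longlonglongrightarrow> 2 * pi * (\<Sum>k<K. (1 ^ k * norm (hcoef f k))\<^sup>2)"
        by (intro tendsto_intros rl)
      from LIMSEQ_le[OF this, of "\<lambda>m. (1 + \<eta>) * I + (1 + 1 / \<eta>) * (2 * pi * D m)" "(1 + \<eta>) * I + (1 + 1 / \<eta>) * (2 * pi * 0)"] key[OF \<eta>]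
      have "2 * pi * (\<Sum>k<K. (1 ^ k * norm (hcoef f k))\<^sup>2) \<le> (1 + \<eta>) * I + (1 + 1 / \<eta>) * (2 * pi * 0)"
        if "(\<lambda>m. (1 + \<eta>) * I + (1 + 1 / \<eta>) * (2 * pi * D m)) \<longlonglongrightarrow> (1 + \<eta>) * I + (1 + 1 / \<eta>) * (2 * pi * 0)"
        using that by blast
      moreover have "(\<lambda>m. (1 + \<eta>) * I + (1 + 1 / \<eta>) * (2 * pi * D m)) \<longlonglongrightarrow> (1 + \<eta>) * I + (1 + 1 / \<eta>) * (2 * pi * 0)"
        by (intro tendsto_intros Dlim)
      ultimately have "2 * pi * (\<Sum>k<K. (1 ^ k * norm (hcoef f k))\<^sup>2) \<le> (1 + \<eta>) * I + (1 + 1 / \<eta>) * (2 * pi * 0)"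
        by blast
      then show ?thesis by simp
    qed
    note fin = this
    have "2 * pi * (\<Sum>k<K. (norm (hcoef f k))\<^sup>2) \<le> I" for K
    proof -
      have "((\<lambda>\<eta>. (1 + \<eta>) * I) \<longlongrightarrow> (1 + 0) * I) (at_right 0)" by (intro tendsto_intros)
      moreover have "eventually (\<lambda>\<eta>. 2 * pi * (\<Sum>k<K. (norm (hcoef f k))\<^sup>2) \<le> (1 + \<eta>) * I) (at_right 0)"
      proof -
        have "eventually (\<lambda>\<eta>. \<eta> \<in> {0<..<1}) (at_right (0::real))" by (intro eventually_at_right_real) simp
        then show ?thesis by eventually_elim (use fin in auto)
      qed
      ultimately have "2 * pi * (\<Sum>k<K. (norm (hcoef f k))\<^sup>2) \<le> (1 + 0) * I"
        by (rule tendsto_lowerbound) simp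
      then show ?thesis by simp
    qed
    note bound = this
    have L: "(\<lambda>K. 2 * pi * (\<Sum>k<K. (norm (hcoef f k))\<^sup>2)) \<longlonglongrightarrow> 2 * pi * (l2norm (hcoef f))\<^sup>2"
      unfolding l2norm_square[OF l] using l by (intro tendsto_intros summable_LIMSEQ) (simp add: l2_def)
    have "2 * pi * (l2norm (hcoef f))\<^sup>2 \<le> I" by (rule LIMSEQ_le_const2[OF L]) (use bound in blast)
    then show ?thesis unfolding I(1) by (rule ennreal_leI)
  qed simp
qed

section \<open>Small vectors dual to unbounded functionals\<close>

text \<open>
  The set \<open>V\<close> with the operations \<open>pl\<close> and \<open>sc\<close> stands for a vector space. It will consist of finite lists of points
  with weights, where addition is concatenation; such lists obey no vector space laws, but the seminorm
  \<open>N\<close> and the functionals \<open>\<phi> i\<close> see only the vectors that they represent.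
\<close>

lemma finite_combination_exists:
  fixes N :: "'v \<Rightarrow> real" and \<phi> :: "nat \<Rightarrow> 'v \<Rightarrow> complex" and k :: nat
  assumes clos: "\<And>u v. u \<in> V \<Longrightarrow> v \<in> V \<Longrightarrow> pl u v \<in> V" "\<And>c v. v \<in> V \<Longrightarrow> sc c v \<in> V"
    and N: "\<And>u v. u \<in> V \<Longrightarrow> v \<in> V \<Longrightarrow> N (pl u v) \<le> N u + N v" "\<And>c v. v \<in> V \<Longrightarrow> N (sc c v) = norm c * N v"
    and \<phi>: "\<And>i u v. u \<in> V \<Longrightarrow> v \<in> V \<Longrightarrow> \<phi> i (pl u v) = \<phi> i u + \<phi> i v" "\<And>i c v. v \<in> V \<Longrightarrow> \<phi> i (sc c v) = c * \<phi> i v"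
    and v: "v \<in> V" "\<And>j. j < k \<Longrightarrow> x j \<in> V"
  shows "\<exists>u\<in>V. (\<forall>i. \<phi> i u = \<phi> i v + (\<Sum>j<k. c j * \<phi> i (x j))) \<and> N u \<le> N v + (\<Sum>j<k. norm (c j) * N (x j))"
  using v(2)
proof (induction k)
  case 0
  then show ?case using v(1) by auto
next
  case (Suc k)
  then obtain u where u: "u \<in> V" "\<And>i. \<phi> i u = \<phi> i v + (\<Sum>j<k. c j * \<phi> i (x j))" 
    "N u \<le> N v + (\<Sum>j<k. norm (c j) * N (x j))" by auto
  have x: "x k \<in> V" "sc (c k) (x k) \<in> V" using Suc.prems clos by auto
  show ?case
    using u x clos(1)[OF u(1) x(2)] N(1)[OF u(1) x(2)] N(2)[OF x(1), of "c k"] \<phi>(1)[OF u(1) x(2)] \<phi>(2)[OF x(1)]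
    by (intro bexI[of _ "pl u (sc (c k) (x k))"]) auto
qed

text \<open>
  In the induction step the functional \<open>\<phi> k\<close> is unbounded on the common kernel \<open>K\<close> of its predecessors. Otherwise
  take dual vectors \<open>x m j\<close> of the predecessors with norms tending to zero. The differences
  \<open>x m j - x m' j\<close> are in \<open>K\<close>, so \<open>\<phi> k (x m j)\<close> converges to some \<open>a j\<close>, and removing the components of a vector
  \<open>v\<close> along \<open>x m j\<close> shows that \<open>\<phi> k - (\<Sum>j<k. a j * \<phi> j)\<close> is bounded, contrary to the hypothesis. So \<open>K\<close> contains a
  small vector on which \<open>\<phi> k\<close> is \<open>1\<close>, and subtracting multiples of it from dual vectors of the predecessors
  makes \<open>\<phi> k\<close> vanish on them.
\<close>

lemma small_dual_vectors:
  fixes N :: "'v \<Rightarrow> real" and \<phi> :: "nat \<Rightarrow> 'v \<Rightarrow> complex" and k :: nat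
  assumes clos: "\<And>u v. u \<in> V \<Longrightarrow> v \<in> V \<Longrightarrow> pl u v \<in> V" "\<And>c v. v \<in> V \<Longrightarrow> sc c v \<in> V"
    and N: "\<And>u v. u \<in> V \<Longrightarrow> v \<in> V \<Longrightarrow> N (pl u v) \<le> N u + N v" "\<And>c v. v \<in> V \<Longrightarrow> N (sc c v) = norm c * N v" "\<And>v. v \<in> V \<Longrightarrow> N v \<ge> 0"
    and \<phi>: "\<And>i u v. u \<in> V \<Longrightarrow> v \<in> V \<Longrightarrow> \<phi> i (pl u v) = \<phi> i u + \<phi> i v" "\<And>i c v. v \<in> V \<Longrightarrow> \<phi> i (sc c v) = c * \<phi> i v"
    and unbounded: "\<And>c C. \<exists>i<k. c i \<noteq> 0 \<Longrightarrow> \<exists>v\<in>V. norm (\<Sum>i<k. c i * \<phi> i v) > C * N v"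
    and \<epsilon>: "\<epsilon> > 0"
  shows "\<exists>x. \<forall>j<k. x j \<in> V \<and> N (x j) < \<epsilon> \<and> (\<forall>i<k. \<phi> i (x j) = (if i = j then 1 else 0))"
  using unbounded \<epsilon>
proof (induction k arbitrary: \<epsilon>)
  case (Suc k)
  have comb: "\<exists>u\<in>V. (\<forall>i. \<phi> i u = \<phi> i v + (\<Sum>j<n. c j * \<phi> i (x j))) \<and> N u \<le> N v + (\<Sum>j<n. norm (c j) * N (x j))"
    if "v \<in> V" "\<And>j. j < n \<Longrightarrow> x j \<in> V" for v and n :: nat and x c
    by (rule finite_combination_exists[where V = V and pl = pl and sc = sc and N = N and \<phi> = \<phi>]) (assumption | rule clos N \<phi> that)+
  have IH: "\<exists>x. \<forall>j<k. x j \<in> V \<and> N (x j) < \<epsilon> \<and> (\<forall>i<k. \<phi> i (x j) = (if i = j then 1 else 0))"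
    if "\<epsilon> > 0" for \<epsilon>
  proof (rule Suc.IH[OF _ that])
    fix c C assume "\<exists>i<k. c i \<noteq> (0 :: complex)"
    then have "\<exists>i<Suc k. (if i < k then c i else 0) \<noteq> 0" by (metis less_SucI)
    from Suc.prems(1)[OF this, of C] show "\<exists>v\<in>V. norm (\<Sum>i<k. c i * \<phi> i v) > C * N v" by simp
  qed
  define K where "K = {v \<in> V. \<forall>i<k. \<phi> i v = 0}"
  have unb: "\<exists>v\<in>K. norm (\<phi> k v) > C * N v" for C
  proof (rule ccontr)
    assume "\<not> ?thesis"
    then have C: "norm (\<phi> k v) \<le> C * N v" if "v \<in> K" for v using that by fastforce
    define C' where "C' = max C 0"
    have C': "norm (\<phi> k v) \<le> C' * N v" "C' \<ge> 0" if "v \<in> K" for v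
      using C[OF that] N(3)[of v] that mult_right_mono[of C C' "N v"] by (auto simp: C'_def K_def)
    have C'0: "C' \<ge> 0" by (simp add: C'_def)
    have "\<exists>x. \<forall>m. \<forall>j<k. x m j \<in> V \<and> N (x m j) < inverse (real (Suc m)) \<and> (\<forall>i<k. \<phi> i (x m j) = (if i = j then 1 else 0))"
      by (rule choice) (use IH in auto)
    then obtain x where x: "\<And>m j. j < k \<Longrightarrow> x m j \<in> V" "\<And>m j. j < k \<Longrightarrow> N (x m j) < inverse (real (Suc m))"
      "\<And>m j i. j < k \<Longrightarrow> i < k \<Longrightarrow> \<phi> i (x m j) = (if i = j then 1 else 0)" by blast
    have "\<exists>a. (\<lambda>m. \<phi> k (x m j)) \<longlonglongrightarrow> a" if j: "j < k" for j
    proof -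
      have d: "norm (\<phi> k (x m j) - \<phi> k (x m' j)) \<le> C' * (inverse (real (Suc m)) + inverse (real (Suc m')))" for m m'
      proof -
        obtain u where u: "u \<in> V" "\<And>i. \<phi> i u = \<phi> i (x m j) + (\<Sum>l<(1::nat). (-1) * \<phi> i (x m' j))" 
          "N u \<le> N (x m j) + (\<Sum>l<(1::nat). norm (-1::complex) * N (x m' j))"
          using comb[OF x(1)[OF j, of m], of 1 "\<lambda>_. x m' j" "\<lambda>_. -1", OF x(1)[OF j]] by blast
        have "u \<in> K" using u x(3)[OF j] by (auto simp: K_def)
        from C'(1)[OF this] u(2)[of k] have "norm (\<phi> k (x m j) - \<phi> k (x m' j)) \<le> C' * N u" by simp
        also have "\<dots> \<le> C' * (inverse (real (Suc m)) + inverse (real (Suc m')))"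
          using u(3) x(2)[OF j, of m] x(2)[OF j, of m'] C'0 by (intro mult_left_mono) auto
        finally show ?thesis .
      qed
      have "Cauchy (\<lambda>m. \<phi> k (x m j))"
      proof (rule metric_CauchyI)
        fix e :: real assume e: "e > 0"
        obtain M where M: "inverse (real (Suc M)) < e / (2 * (C' + 1))"
          using reals_Archimedean[of "e / (2 * (C' + 1))"] e C'0 by auto
        have "dist (\<phi> k (x m j)) (\<phi> k (x m' j)) < e" if "m \<ge> M" "m' \<ge> M" for m m'
        proof -
          have "inverse (real (Suc m)) \<le> inverse (real (Suc M))" "inverse (real (Suc m')) \<le> inverse (real (Suc M))"
            using that by (auto intro!: le_imp_inverse_le)
          then have "inverse (real (Suc m)) + inverse (real (Suc m')) \<le> 2 * inverse (real (Suc M))" by linarith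
          then have "C' * (inverse (real (Suc m)) + inverse (real (Suc m'))) \<le> C' * (2 * inverse (real (Suc M)))"
            using C'0 by (rule mult_left_mono)
          also have "\<dots> \<le> C' * (e / (C' + 1))"
            using M C'0 by (intro mult_left_mono) (auto simp: field_simps)
          also have "\<dots> < e" using e C'0 by (simp add: field_simps)
          finally show ?thesis using d[of m m'] by (simp add: dist_norm)
        qed
        then show "\<exists>M. \<forall>m\<ge>M. \<forall>n\<ge>M. dist (\<phi> k (x m j)) (\<phi> k (x n j)) < e" by blast
      qed
      then show ?thesis using Cauchy_convergent convergent_def by blast
    qed
    then obtain a where a: "\<And>j. j < k \<Longrightarrow> (\<lambda>m. \<phi> k (x m j)) \<longlonglongrightarrow> a j" by metis
    have "norm (\<phi> k v - (\<Sum>j<k. \<phi> j v * a j)) \<le> C' * N v" if v: "v \<in> V" for v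
    proof -
      have m: "norm (\<phi> k v - (\<Sum>j<k. \<phi> j v * \<phi> k (x m j))) \<le> C' * (N v + (\<Sum>j<k. norm (\<phi> j v)) * inverse (real (Suc m)))" for m
      proof -
        obtain u where u: "u \<in> V" "\<And>i. \<phi> i u = \<phi> i v + (\<Sum>j<k. - \<phi> j v * \<phi> i (x m j))" 
          "N u \<le> N v + (\<Sum>j<k. norm (- \<phi> j v) * N (x m j))"
          using comb[OF v, of k "x m" "\<lambda>j. - \<phi> j v", OF x(1)] by blast
        have "\<phi> i u = 0" if "i < k" for i
        proof -
          have "(\<Sum>j<k. - \<phi> j v * \<phi> i (x m j)) = (\<Sum>j<k. if i = j then - \<phi> j v else 0)"
            using x(3) that by (intro sum.cong refl) auto
          then show ?thesis using u(2)[of i] that by simp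
        qed
        then have "u \<in> K" using u by (auto simp: K_def)
        from C'(1)[OF this] u(2)[of k] have "norm (\<phi> k v - (\<Sum>j<k. \<phi> j v * \<phi> k (x m j))) \<le> C' * N u" by (simp add: sum_negf)
        also have "(\<Sum>j<k. norm (- \<phi> j v) * N (x m j)) \<le> (\<Sum>j<k. norm (\<phi> j v) * inverse (real (Suc m)))"
          using less_imp_le[OF x(2)] by (intro sum_mono) (simp add: mult_left_mono)
        then have "C' * N u \<le> C' * (N v + (\<Sum>j<k. norm (\<phi> j v)) * inverse (real (Suc m)))"
          using u(3) C'0 by (intro mult_left_mono) (auto simp: sum_distrib_right)
        finally show ?thesis .
      qed
      have "(\<lambda>m. norm (\<phi> k v - (\<Sum>j<k. \<phi> j v * \<phi> k (x m j)))) \<longlonglongrightarrow> norm (\<phi> k v - (\<Sum>j<k. \<phi> j v * a j))"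
        by (intro tendsto_intros a) auto
      moreover have "(\<lambda>m. C' * (N v + (\<Sum>j<k. norm (\<phi> j v)) * inverse (real (Suc m)))) \<longlonglongrightarrow> C' * (N v + (\<Sum>j<k. norm (\<phi> j v)) * 0)"
        by (intro tendsto_intros LIMSEQ_inverse_real_of_nat)
      ultimately show ?thesis using m by (auto intro: LIMSEQ_le)
    qed
    note bounded = this
    have eq: "(\<Sum>i<Suc k. (if i < k then - a i else 1) * \<phi> i v) = \<phi> k v - (\<Sum>j<k. \<phi> j v * a j)" for v
      by (simp add: sum_negf mult.commute)
    have "\<exists>i<Suc k. (if i < k then - a i else 1) \<noteq> 0" by (intro exI[of _ k]) simp
    from Suc.prems(1)[OF this, of C'] obtain v
      where v: "v \<in> V" "norm (\<Sum>i<Suc k. (if i < k then - a i else 1) * \<phi> i v) > C' * N v" by blast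
    show False using bounded[OF v(1)] v(2) unfolding eq by simp
  qed
  obtain x where x: "\<And>j. j < k \<Longrightarrow> x j \<in> V" "\<And>j. j < k \<Longrightarrow> N (x j) < \<epsilon> / 2"
      "\<And>j i. j < k \<Longrightarrow> i < k \<Longrightarrow> \<phi> i (x j) = (if i = j then 1 else 0)" 
    using IH[of "\<epsilon> / 2"] Suc.prems(2) by (metis half_gt_zero)
  \<comment> \<open>\<open>B\<close> bounds the multiples of \<open>y\<close> that will be subtracted, so \<open>y\<close> has to be smaller than \<open>\<epsilon> / (2 * B)\<close>.\<close>
  define B where "B = 1 + (\<Sum>j<k. norm (\<phi> k (x j)))"
  have B: "B \<ge> 1" "\<And>j. j < k \<Longrightarrow> norm (\<phi> k (x j)) \<le> B"
    using member_le_sum[of _ "{..<k}" "\<lambda>j. norm (\<phi> k (x j))"] by (force simp: B_def intro!: sum_nonneg)+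
  obtain v where v: "v \<in> V" "\<And>i. i < k \<Longrightarrow> \<phi> i v = 0" "norm (\<phi> k v) > (2 * B / \<epsilon>) * N v"
    using unb[of "2 * B / \<epsilon>"] by (auto simp: K_def)
  have "(2 * B / \<epsilon>) * N v \<ge> 0" using B(1) Suc.prems(2) N(3)[OF v(1)] by simp
  then have nz: "\<phi> k v \<noteq> 0" using v(3) by auto
  define y where "y = sc (1 / \<phi> k v) v"
  have y: "y \<in> V" "\<And>i. i < k \<Longrightarrow> \<phi> i y = 0" "\<phi> k y = 1"
    using v nz clos \<phi> by (auto simp: y_def)
  have "N y = N v / norm (\<phi> k v)" using N(2)[OF v(1)] by (simp add: y_def norm_divide)
  also have "\<dots> < \<epsilon> / (2 * B)" using v(3) nz B(1) Suc.prems(2) by (simp add: field_simps)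
  finally have Ny: "N y < \<epsilon> / (2 * B)" .
  also have "\<dots> \<le> \<epsilon> / 2" using B(1) Suc.prems(2) by (simp add: field_simps)
  finally have Ny2: "N y < \<epsilon> / 2" .
  define z where "z j = (if j < k then pl (x j) (sc (- \<phi> k (x j)) y) else y)" for j
  have "z j \<in> V \<and> N (z j) < \<epsilon> \<and> (\<forall>i<Suc k. \<phi> i (z j) = (if i = j then 1 else 0))" if "j < Suc k" for j
  proof (cases "j < k")
    case True
    have s: "sc (- \<phi> k (x j)) y \<in> V" using clos y by auto
    have "N (z j) \<le> N (x j) + norm (\<phi> k (x j)) * N y"
      using N(1)[OF x(1)[OF True] s] N(2)[OF y(1)] True by (simp add: z_def)
    also have "norm (\<phi> k (x j)) * N y \<le> B * (\<epsilon> / (2 * B))"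
      using B True Ny N(3)[OF y(1)] by (intro mult_mono) auto
    also have "\<dots> = \<epsilon> / 2" using B(1) by simp
    finally have "N (z j) < \<epsilon>" using x(2)[OF True] by simp
    then show ?thesis using True s clos(1)[OF x(1)[OF True] s] \<phi>(1)[OF x(1)[OF True] s] \<phi>(2)[OF y(1)] y x(3)[OF True]
      by (auto simp: z_def less_Suc_eq)
  next
    case False
    then have "j = k" using that by simp
    then show ?thesis using y Ny2 Suc.prems(2) by (auto simp: z_def less_Suc_eq)
  qed
  then show ?case by blast
qed auto

section \<open>Functions bounded against combinations of kernels\<close>

lemma sum_roots_of_unity:
  assumes "k < N" "n < N"
  shows "(\<Sum>j<N. cis (2 * pi * real j / real N) ^ k * cnj (cis (2 * pi * real j / real N)) ^ n) = (if k = n then of_nat N else 0)"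
proof (cases "k = n")
  case True
  have "cis (2 * pi * real j / real N) ^ n * cnj (cis (2 * pi * real j / real N)) ^ n = 1" for j :: nat
    by (simp add: cis_cnj cis_mult flip: power_mult_distrib)
  then show ?thesis using True by simp
next
  case False
  define q where "q = cis (2 * pi * (real k - real n) / N)"
  have "cis (2 * pi * real j / real N) ^ k * cnj (cis (2 * pi * real j / real N)) ^ n = q ^ j" for j :: nat
    unfolding cis_cnj Complex.DeMoivre q_def cis_mult using assms by (intro arg_cong[of _ _ cis]) (simp add: field_simps)
  moreover have "q ^ N = 1"
  proof -
    have "q ^ N = cis (2 * pi * of_int (int k - int n))"
      unfolding q_def Complex.DeMoivre using assms by (intro arg_cong[of _ _ cis]) simp
    then show ?thesis using cis_multiple_2pi[of "of_int (int k - int n)"] by simp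
  qed
  moreover have "q \<noteq> 1"
  proof
    assume "q = 1"
    then have "cos (2 * pi * (real k - real n) / N) = 1" by (simp add: q_def cis.code complex_eq_iff)
    then obtain m :: int where m: "2 * pi * (real k - real n) / N = real_of_int m * 2 * pi"
      using cos_one_2pi_int by blast
    then have "(2 * pi) * (real k - real n) = (2 * pi) * (real_of_int m * real N)"
      using assms by (simp add: divide_eq_eq mult_ac)
    then have "real k - real n = m * N" by (simp only: mult_cancel_left) simp
    then have "int k - int n = m * int N" by (metis of_int_eq_iff of_int_diff of_int_mult of_int_of_nat_eq)
    moreover have "\<bar>int k - int n\<bar> < int N" using assms by auto
    ultimately have "m = 0" by (metis abs_mult abs_of_nat mult_less_cancel_right2 of_nat_less_0_iff zero_less_abs_iff int_one_le_iff_zero_less not_less)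
    with \<open>int k - int n = m * int N\<close> False show False by simp
  qed
  ultimately show ?thesis using False by (simp add: sum_gp_strict geometric_sum)
qed

text \<open>
  By duality, \<open>G\<close> is tested against its own Taylor polynomial of degree less than \<open>K\<close>, which is approximated by
  combinations of kernels at the \<open>N\<close>-th roots of unity times \<open>r\<close>. With the weights \<open>x j\<close> the coefficients \<open>\<xi> n\<close> of
  the combination are \<open>r ^ (2 * n)\<close> times those of \<open>G\<close> for \<open>n < K\<close>, they are zero for \<open>K \<le> n < N\<close>, and after that
  they repeat with period \<open>N\<close>, damped by \<open>r ^ N\<close>. As \<open>N\<close> grows, the pairing with \<open>G\<close> tends to the sum \<open>S\<close> to be
  estimated, while the squared norm of \<open>\<xi>\<close> is at most about \<open>S\<close>. This gives \<open>S \<le> C * sqrt S\<close>.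
\<close>

lemma kernel_bounded_circle:
  fixes G :: "complex \<Rightarrow> complex^'k"
  assumes h: "hol G" and r: "0 < r" "r < 1"
    and bd: "\<And>(n::nat) w x. (\<And>i. i < n \<Longrightarrow> norm (w i) = r) \<Longrightarrow>
       norm (\<Sum>i<n. hdot (x i) (G (w i))) \<le> C * l2norm (kcoef {..<n} w x)"
    and C: "C \<ge> 0"
  shows "(\<Sum>k<K. r ^ (2 * k) * (norm (hcoef G k))\<^sup>2) \<le> C\<^sup>2"
proof -
  define a where "a = hcoef G"
  define S where "S = (\<Sum>k<K. r ^ (2 * k) * (norm (a k))\<^sup>2)"
  have S0: "S \<ge> 0" unfolding S_def using r by (intro sum_nonneg) auto
  define A where "A = (\<Sum>k<K. norm (a k))"
  have A0: "A \<ge> 0" unfolding A_def by (intro sum_nonneg) auto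
  have ra: "summable (\<lambda>n. r ^ n * norm (a n))"
    using summable_hcoef[OF h less_imp_le[OF r(1)] r(2)] r by (simp add: norm_cmult_vec norm_power a_def)
  define tail where "tail N = A * (\<Sum>n. r ^ (n + N) * norm (a (n + N)))" for N
  have key: "S - tail N \<le> C * sqrt (S / (1 - r ^ (2 * N)))" if N: "K < N" for N
  proof -
    have N0: "N > 0" using N by simp
    define \<zeta> where "\<zeta> j = cis (2 * pi * real j / real N)" for j :: nat
    define w where "w j = of_real r * \<zeta> j" for j
    define x where "x j = (1 / of_nat N) *s (\<Sum>k<K. (of_real r ^ k * \<zeta> j ^ k) *s a k)" for j
    define \<xi> where "\<xi> = kcoef {..<N} w x"
    have w: "norm (w j) = r" for j using r by (simp add: w_def \<zeta>_def norm_mult)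
    have w1: "norm (w j) < 1" for j using w r by simp
    have zN: "\<zeta> j ^ N = 1" for j
    proof -
      have "\<zeta> j ^ N = cis (2 * pi * of_int (int j))" unfolding \<zeta>_def Complex.DeMoivre using N0 by simp
      then show ?thesis using cis_multiple_2pi[of "of_int (int j)"] by simp
    qed
    have low: "\<xi> n = (if n < K then of_real (r ^ (2 * n)) *s a n else 0)" if n: "n < N" for n
    proof -
      have "\<xi> n = (\<Sum>j<N. \<Sum>k<K. (of_real (r ^ n * r ^ k / N) * (\<zeta> j ^ k * cnj (\<zeta> j) ^ n)) *s a k)"
        unfolding \<xi>_def kcoef_def x_def w_def vec_eq_iff
        by (simp add: sum_component sum_distrib_left mult_ac power_mult_distrib sum_divide_distrib)
      also have "\<dots> = (\<Sum>k<K. \<Sum>j<N. (of_real (r ^ n * r ^ k / N) * (\<zeta> j ^ k * cnj (\<zeta> j) ^ n)) *s a k)"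
        by (rule sum.swap)
      also have "\<dots> = (\<Sum>k<K. (of_real (r ^ n * r ^ k / N) * (\<Sum>j<N. \<zeta> j ^ k * cnj (\<zeta> j) ^ n)) *s a k)"
        by (simp add: vec_eq_iff sum_component sum_distrib_left sum_distrib_right)
      also have "\<dots> = (\<Sum>k<K. if k = n then of_real (r ^ (2 * n)) *s a n else 0)"
      proof (intro sum.cong refl)
        fix k assume "k \<in> {..<K}"
        then have "(\<Sum>j<N. \<zeta> j ^ k * cnj (\<zeta> j) ^ n) = (if k = n then of_nat N else 0)"
          unfolding \<zeta>_def using N n by (intro sum_roots_of_unity) auto
        then show "(of_real (r ^ n * r ^ k / N) * (\<Sum>j<N. \<zeta> j ^ k * cnj (\<zeta> j) ^ n)) *s a k = (if k = n then of_real (r ^ (2 * n)) *s a n else 0)"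
          using N0 by (simp add: mult_2 power_add)
      qed
      finally show ?thesis by simp
    qed
    have per: "\<xi> (n + N) = of_real (r ^ N) *s \<xi> n" for n
      unfolding \<xi>_def kcoef_def w_def vec_eq_iff
      by (simp add: sum_component sum_distrib_left power_add power_mult_distrib mult_ac zN flip: complex_cnj_power)
    have lxi: "l2 \<xi>" unfolding \<xi>_def using w1 by (intro l2_kcoef) auto
    have rN: "r ^ (2 * N) < 1" using r N0 by (simp add: power_less_one_iff)
    have "(l2norm \<xi>)\<^sup>2 = (\<Sum>n. (norm (\<xi> (n + N)))\<^sup>2) + (\<Sum>n<N. (norm (\<xi> n))\<^sup>2)"
      unfolding l2norm_square[OF lxi] by (rule suminf_split_initial_segment) (use lxi in \<open>simp add: l2_def\<close>)
    also have "(\<Sum>n. (norm (\<xi> (n + N)))\<^sup>2) = r ^ (2 * N) * (l2norm \<xi>)\<^sup>2"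
    proof -
      have "(norm (\<xi> (n + N)))\<^sup>2 = r ^ (2 * N) * (norm (\<xi> n))\<^sup>2" for n
        using r by (simp add: per norm_cmult_vec norm_power power_mult_distrib power_even_eq)
      then show ?thesis
        unfolding l2norm_square[OF lxi] using lxi by (simp add: l2_def suminf_mult)
    qed
    finally have "(1 - r ^ (2 * N)) * (l2norm \<xi>)\<^sup>2 = (\<Sum>n<N. (norm (\<xi> n))\<^sup>2)"
      unfolding left_diff_distrib by linarith
    also have "\<dots> = (\<Sum>n<K. (norm (\<xi> n))\<^sup>2)"
      using N low by (intro sum.mono_neutral_right) auto
    also have "\<dots> \<le> S"
      unfolding S_def
    proof (intro sum_mono)
      fix n assume "n \<in> {..<K}"
      then have "norm (\<xi> n) = r ^ (2 * n) * norm (a n)" using low[of n] N r by (simp add: norm_cmult_vec norm_power)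
      then have "(norm (\<xi> n))\<^sup>2 = r ^ (2 * n) * (r ^ (2 * n) * (norm (a n))\<^sup>2)" by (simp add: power2_eq_square)
      also have "\<dots> \<le> 1 * (r ^ (2 * n) * (norm (a n))\<^sup>2)" using r by (intro mult_right_mono) (auto simp: power_le_one)
      finally show "(norm (\<xi> n))\<^sup>2 \<le> r ^ (2 * n) * (norm (a n))\<^sup>2" by simp
    qed
    finally have "(l2norm \<xi>)\<^sup>2 \<le> S / (1 - r ^ (2 * N))" using rN by (simp add: field_simps)
    then have norm: "l2norm \<xi> \<le> sqrt (S / (1 - r ^ (2 * N)))" by (rule real_le_rsqrt)
    have xi_le: "norm (\<xi> n) \<le> A * r ^ n" for n
    proof (induction n rule: less_induct)
      case (less n)
      show ?case
      proof (cases "n < N")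
        case True
        show ?thesis
        proof (cases "n < K")
          case nK: True
          have "norm (a n) \<le> A" unfolding A_def using nK by (intro member_le_sum) auto
          moreover have "r ^ (2 * n) \<le> r ^ n" using r by (intro power_decreasing) auto
          ultimately have "r ^ (2 * n) * norm (a n) \<le> r ^ n * A" using r by (intro mult_mono) auto
          then show ?thesis using low[OF True] nK r by (simp add: norm_cmult_vec norm_power mult.commute)
        qed (use low[OF True] A0 r in auto)
      next
        case False
        then obtain m where m: "n = m + N" by (metis add.commute le_Suc_ex not_less)
        have "norm (\<xi> n) = r ^ N * norm (\<xi> m)" unfolding m per using r by (simp add: norm_cmult_vec norm_power)
        also have "\<dots> \<le> r ^ N * (A * r ^ m)" using less.IH[of m] m N0 r by (intro mult_left_mono) auto
        finally show ?thesis by (simp add: m power_add mult_ac)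
      qed
    qed
    have P: "(\<lambda>n. hdot (\<xi> n) (a n)) sums (\<Sum>j<N. hdot (x j) (G (w j)))"
      unfolding \<xi>_def a_def using w1 h by (intro kernel_pairing) auto
    have sP: "summable (\<lambda>n. hdot (\<xi> n) (a n))" using P by (rule sums_summable)
    have "(\<Sum>j<N. hdot (x j) (G (w j))) = (\<Sum>n. hdot (\<xi> (n + N)) (a (n + N))) + (\<Sum>n<N. hdot (\<xi> n) (a n))"
      using sums_unique[OF P] suminf_split_initial_segment[OF sP, of N] by simp
    also have "(\<Sum>n<N. hdot (\<xi> n) (a n)) = (\<Sum>n<K. hdot (\<xi> n) (a n))"
      using N low by (intro sum.mono_neutral_right) auto
    also have "\<dots> = complex_of_real S"
      unfolding S_def of_real_sum using N low by (intro sum.cong) (auto simp: hdot_self)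
    finally have e: "complex_of_real S = (\<Sum>j<N. hdot (x j) (G (w j))) - (\<Sum>n. hdot (\<xi> (n + N)) (a (n + N)))" by simp
    have "S = norm (complex_of_real S)" using S0 by simp
    also have "\<dots> \<le> norm (\<Sum>j<N. hdot (x j) (G (w j))) + norm (\<Sum>n. hdot (\<xi> (n + N)) (a (n + N)))"
      unfolding e by (rule norm_triangle_ineq4)
    also have "norm (\<Sum>j<N. hdot (x j) (G (w j))) \<le> C * l2norm \<xi>"
      unfolding \<xi>_def by (rule bd) (rule w)
    also have "C * l2norm \<xi> \<le> C * sqrt (S / (1 - r ^ (2 * N)))" using norm C by (rule mult_left_mono)
    also have "norm (\<Sum>n. hdot (\<xi> (n + N)) (a (n + N))) \<le> tail N"
    proof -
      have s1: "summable (\<lambda>n. A * (r ^ (n + N) * norm (a (n + N))))"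
        by (intro summable_mult) (rule summable_ignore_initial_segment[OF ra])
      have le: "norm (hdot (\<xi> (n + N)) (a (n + N))) \<le> A * (r ^ (n + N) * norm (a (n + N)))" for n
        using norm_hdot_le[of "\<xi> (n + N)" "a (n + N)"] mult_right_mono[OF xi_le[of "n + N"], of "norm (a (n + N))"]
        by (simp add: mult.assoc)
      have s2: "summable (\<lambda>n. norm (hdot (\<xi> (n + N)) (a (n + N))))"
        by (rule summable_comparison_test'[OF s1, of 0]) (use le in simp)
      have "norm (\<Sum>n. hdot (\<xi> (n + N)) (a (n + N))) \<le> (\<Sum>n. norm (hdot (\<xi> (n + N)) (a (n + N))))"
        by (rule summable_norm[OF s2])
      also have "\<dots> \<le> (\<Sum>n. A * (r ^ (n + N) * norm (a (n + N))))" by (rule suminf_le[OF le s2 s1])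
      also have "\<dots> = tail N" unfolding tail_def
        by (rule suminf_mult) (rule summable_ignore_initial_segment[OF ra])
      finally show ?thesis .
    qed
    finally show ?thesis by simp
  qed
  have "(\<lambda>N. S - tail N) \<longlonglongrightarrow> S - A * 0"
    unfolding tail_def by (intro tendsto_intros suminf_exist_split2 ra)
  moreover have "(\<lambda>N. C * sqrt (S / (1 - r ^ (2 * N)))) \<longlonglongrightarrow> C * sqrt (S / (1 - 0))"
  proof -
    have "(\<lambda>N. (r ^ 2) ^ N) \<longlonglongrightarrow> 0" using r by (intro LIMSEQ_realpow_zero) (auto simp: power_less_one_iff)
    then show ?thesis by (intro tendsto_intros) (auto simp: power_mult)
  qed
  ultimately have "S - A * 0 \<le> C * sqrt (S / (1 - 0))"
    by (rule LIMSEQ_le) (use key in \<open>auto intro!: exI[of _ "Suc K"]\<close>)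
  then have "S \<le> C * sqrt S" by simp
  then have "sqrt S * sqrt S \<le> C * sqrt S" using S0 by simp
  then have "sqrt S \<le> C"
  proof (cases "S = 0")
    case False
    then have "sqrt S > 0" using S0 by simp
    then show ?thesis using \<open>sqrt S * sqrt S \<le> C * sqrt S\<close> mult_right_le_imp_le by blast
  qed (use C in simp)
  then have "(sqrt S)\<^sup>2 \<le> C\<^sup>2" using S0 by (intro power_mono) auto
  then show ?thesis using S0 by (simp add: S_def a_def)
qed

text \<open>
  The hypothesis for a single point bounds \<open>g\<close> near each exceptional point, so the singularities there are
  removable. Only countably many circles around \<open>0\<close> meet exceptional points. On the others
  \<open>kernel_bounded_circle\<close> applies, and their radii may be chosen to tend to \<open>1\<close>.
\<close>

lemma kernel_bounded_imp_hardy: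
  fixes g :: "complex \<Rightarrow> complex^'k"
  assumes \<Omega>: "open \<Omega>" "\<Omega> \<subseteq> \<bbbD>" "(\<bbbD> - \<Omega>) sparse_in \<bbbD>"
    and g: "\<And>i. (\<lambda>z. g z $ i) holomorphic_on \<Omega>"
    and bd: "\<And>(n::nat) w x. (\<And>i. i < n \<Longrightarrow> w i \<in> \<Omega>) \<Longrightarrow>
       norm (\<Sum>i<n. hdot (x i) (g (w i))) \<le> C * l2norm (kcoef {..<n} w x)"
    and C: "C \<ge> 0"
  shows "\<exists>G\<in>hardy_disc. \<forall>z\<in>\<Omega>. G z = g z"
proof -
  have single: "norm (g z $ i) \<le> C / sqrt (1 - (norm z)\<^sup>2)" if z: "z \<in> \<Omega>" for z i
  proof -
    have z1: "norm z < 1" using z \<Omega>(2) by auto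
    have "norm (\<Sum>j<1::nat. hdot (axis i 1) (g z)) \<le> C * l2norm (kcoef {..<1::nat} (\<lambda>_. z) (\<lambda>_. axis i 1))"
      using z by (intro bd) auto
    moreover have hax: "hdot (axis i 1) v = v $ i" for v :: "complex^'k"
    proof -
      have "cnj (axis i 1 $ a) * v $ a = (if a = i then v $ i else 0)" for a by (simp add: axis_def)
      then show ?thesis by (simp add: hdot_def)
    qed
    moreover have "(l2norm (kcoef {..<1::nat} (\<lambda>_. z) (\<lambda>_. axis i (1::complex) :: complex^'k)))\<^sup>2 = 1 / (1 - (norm z)\<^sup>2)"
    proof -
      have "hdot (axis i 1 :: complex^'k) (axis i 1) = 1" unfolding hax by (simp add: axis_def)
      then have "(l2norm (kcoef {..<1::nat} (\<lambda>_. z) (\<lambda>_. axis i (1::complex) :: complex^'k)))\<^sup>2 = Re (1 / (1 - z * cnj z))"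
        using z1 by (subst kernel_norm) auto
      also have "1 / (1 - z * cnj z) = complex_of_real (1 / (1 - (norm z)\<^sup>2))"
        by (simp flip: complex_norm_square)
      finally show ?thesis by (simp only: Re_complex_of_real)
    qed
    then have "sqrt ((l2norm (kcoef {..<1::nat} (\<lambda>_. z) (\<lambda>_. axis i (1::complex) :: complex^'k)))\<^sup>2) = sqrt (1 / (1 - (norm z)\<^sup>2))"
      by (rule arg_cong)
    then have "l2norm (kcoef {..<1::nat} (\<lambda>_. z) (\<lambda>_. axis i (1::complex) :: complex^'k)) = 1 / sqrt (1 - (norm z)\<^sup>2)"
      using z1 l2norm_nonneg[OF l2_kcoef[of "{..<1::nat}" "\<lambda>_. z" "\<lambda>_. axis i (1::complex) :: complex^'k"]]
      by (simp add: real_sqrt_divide)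
    ultimately show ?thesis by simp
  qed
  define G where "G z = (\<chi> i. remove_sings (\<lambda>z. g z $ i) z)" for z
  have G\<Omega>: "G z = g z" if "z \<in> \<Omega>" for z
    using that g \<Omega>(1) by (simp add: G_def vec_eq_iff remove_sings_at_analytic analytic_on_open analytic_on_subset[of _ \<Omega>])
  have "(\<lambda>z. G z $ i) analytic_on {z}" if z: "z \<in> \<bbbD>" for z i
  proof -
    define f where "f w = g w $ i" for w
    have "\<forall>\<^sub>F w in at z. w \<notin> \<bbbD> - \<Omega>"
      using \<Omega>(3) z sparse_in_eventually_iff[of \<bbbD> "\<bbbD> - \<Omega>"] by blast
    then obtain e1 where e1: "e1 > 0" "\<And>w. w \<noteq> z \<Longrightarrow> dist w z < e1 \<Longrightarrow> w \<notin> \<bbbD> - \<Omega>"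
      unfolding eventually_at by blast
    obtain \<rho> where \<rho>: "norm z < \<rho>" "\<rho> < 1" using z dense[of "norm z" 1] by auto
    define e where "e = min e1 (\<rho> - norm z)"
    have e: "e > 0" using e1 \<rho> by (simp add: e_def)
    have in_ball: "norm w < \<rho>" if "w \<in> ball z e" for w
      using that norm_triangle_sub[of w z] by (auto simp: e_def dist_norm norm_minus_commute)
    have sub: "ball z e - {z} \<subseteq> \<Omega>"
    proof
      fix w assume w: "w \<in> ball z e - {z}"
      then have "w \<in> \<bbbD>" using in_ball[of w] \<rho> by auto
      then show "w \<in> \<Omega>" using e1(2)[of w] w by (auto simp: e_def dist_commute)
    qed
    have holf: "f holomorphic_on (ball z e - {z})"
      unfolding f_def using holomorphic_on_subset[OF g sub] .
    have zi: "z \<in> interior (ball z e)" using e by (simp add: interior_open)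
    have "\<forall>\<^sub>F w in at z. norm (f w) \<le> C / sqrt (1 - \<rho>\<^sup>2) + 1"
      unfolding eventually_at
    proof (intro exI[of _ e] conjI ballI impI e)
      fix w assume w: "w \<noteq> z \<and> dist w z < e"
      then have "w \<in> ball z e" "w \<in> \<Omega>" using sub by (auto simp: dist_commute)
      then have "norm (f w) \<le> C / sqrt (1 - (norm w)\<^sup>2)" using single by (simp add: f_def)
      also have "\<dots> \<le> C / sqrt (1 - \<rho>\<^sup>2)"
      proof (rule divide_left_mono)
        have "(norm w)\<^sup>2 \<le> \<rho>\<^sup>2" using in_ball[OF \<open>w \<in> ball z e\<close>] by (intro power_mono) auto
        moreover have "\<rho>\<^sup>2 < 1" using \<rho> norm_ge_zero[of z] by (intro abs_square_less_1[THEN iffD2]) linarith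
        ultimately show "sqrt (1 - \<rho>\<^sup>2) \<le> sqrt (1 - (norm w)\<^sup>2)" "0 < sqrt (1 - (norm w)\<^sup>2) * sqrt (1 - \<rho>\<^sup>2)" by auto
      qed (rule C)
      finally show "norm (f w) \<le> C / sqrt (1 - \<rho>\<^sup>2) + 1" by simp
    qed
    then have "\<exists>B. \<forall>\<^sub>F w in at z. norm (f w) \<le> B" by blast
    then obtain f' where f': "f' holomorphic_on ball z e" "\<And>w. w \<in> ball z e - {z} \<Longrightarrow> f' w = f w"
      using holomorphic_on_extend_bounded[OF holf zi] by blast
    have "isCont f' z"
      using f'(1) e holomorphic_on_imp_continuous_on continuous_on_eq_continuous_at[of "ball z e" f'] by auto
    then have "f' \<midarrow>z\<rightarrow> f' z" by (simp add: isCont_def)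
    then have "f \<midarrow>z\<rightarrow> f' z"
    proof (rule Lim_transform_eventually)
      have "\<forall>\<^sub>F w in at z. w \<in> ball z e - {z}" using e by (intro eventually_at_in_open) auto
      then show "\<forall>\<^sub>F w in at z. f' w = f w" by eventually_elim (rule f'(2))
    qed
    moreover have "isolated_singularity_at f z"
      unfolding isolated_singularity_at_def using e holf by (intro exI[of _ e]) (simp add: analytic_on_open open_delete)
    ultimately have "remove_sings f analytic_on {z}" by (intro remove_sings_analytic_at)
    then show ?thesis by (simp add: G_def f_def[abs_def])
  qed
  then have hG: "hol G"
    unfolding hol_def using analytic_on_analytic_at analytic_imp_holomorphic by blast
  define bad where "bad = norm ` (\<bbbD> - \<Omega>)"
  have "countable (\<bbbD> \<inter> (\<bbbD> - \<Omega>))" using \<Omega>(3) by (intro sparse_imp_countable) auto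
  then have cb: "countable bad" unfolding bad_def by (simp add: Int_absorb1)
  have "\<exists>r. r \<notin> bad \<and> 1 - 1 / (real m + 2) < r \<and> r < 1" for m
  proof -
    have "uncountable ({1 - 1 / (real m + 2)<..<1} - bad)"
      using cb by (intro uncountable_minus_countable) (auto simp: uncountable_open_interval)
    then have "{1 - 1 / (real m + 2)<..<1} - bad \<noteq> {}" by (metis countable_empty)
    then show ?thesis by auto
  qed
  then obtain r where r: "\<And>m. r m \<notin> bad" "\<And>m. 1 - 1 / (real m + 2) < r m" "\<And>m. r m < 1" by metis
  have r0: "r m > 0" for m
  proof -
    have "1 - 1 / (real m + 2) \<ge> 0" by simp
    then show ?thesis using r(2)[of m] by linarith
  qed
  have rlim: "r \<longlonglongrightarrow> 1"
  proof (rule tendsto_sandwich[of "\<lambda>m. 1 - 1 / (real m + 2)" _ _ "\<lambda>_. 1"])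
    show "(\<lambda>m. 1 - 1 / (real m + 2)) \<longlonglongrightarrow> 1" by real_asymp
  qed (use r in \<open>auto intro!: always_eventually less_imp_le\<close>)
  have "(\<Sum>k<K. (norm (hcoef G k))\<^sup>2) \<le> C\<^sup>2" for K
  proof -
    have b: "(\<Sum>k<K. r m ^ (2 * k) * (norm (hcoef G k))\<^sup>2) \<le> C\<^sup>2" for m
    proof (rule kernel_bounded_circle[OF hG r0 r(3) _ C])
      fix n :: nat and w :: "nat \<Rightarrow> complex" and x :: "nat \<Rightarrow> complex^'k"
      assume w: "\<And>i. i < n \<Longrightarrow> norm (w i) = r m"
      have w\<Omega>: "w i \<in> \<Omega>" if "i < n" for i
        using w[OF that] r(1)[of m] r(3)[of m] by (force simp: bad_def)
      then show "norm (\<Sum>i<n. hdot (x i) (G (w i))) \<le> C * l2norm (kcoef {..<n} w x)"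
        using bd[of n w x] G\<Omega> by simp
    qed
    have "(\<lambda>m. \<Sum>k<K. r m ^ (2 * k) * (norm (hcoef G k))\<^sup>2) \<longlonglongrightarrow> (\<Sum>k<K. 1 ^ (2 * k) * (norm (hcoef G k))\<^sup>2)"
      by (intro tendsto_intros rlim)
    then have "(\<Sum>k<K. 1 ^ (2 * k) * (norm (hcoef G k))\<^sup>2) \<le> C\<^sup>2"
      by (rule LIMSEQ_le_const2) (use b in auto)
    then show ?thesis by simp
  qed
  then have "l2 (hcoef G)" unfolding l2_def by (intro summableI_nonneg_bounded[of _ "C\<^sup>2"]) auto
  then have "G \<in> hardy_disc" using hG by (simp add: hardy_disc_iff)
  then show ?thesis using G\<Omega> by blast
qed

section \<open>Negative squares and multiplication operators\<close>

lemma matrix_vector_cmult: "A *v (c *s (x :: complex^'n)) = c *s (A *v x)"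
  by (simp add: vec_eq_iff matrix_vector_mult_def sum_distrib_left mult_ac)

definition kentry :: "(complex \<Rightarrow> complex \<Rightarrow> complex^'k^'k) \<Rightarrow> (nat \<Rightarrow> complex) \<Rightarrow> (nat \<Rightarrow> complex^'k) \<Rightarrow> nat \<Rightarrow> nat \<Rightarrow> complex" where
  "kentry K w u i j = hdot (u i) (K (w i) (w j) *v u j)"

lemma gram_matrix_kentry: "gram_matrix K n w u = Matrix.mat n n (\<lambda>(i, j). kentry K w u i j)"
  by (simp add: gram_matrix_def kentry_def hdot_def)

abbreviation schur_kernel :: "(complex \<Rightarrow> complex^'c^'r) \<Rightarrow> complex \<Rightarrow> complex \<Rightarrow> complex^'r^'r" where
  "schur_kernel F \<equiv> mvf_kernel (mat 1) (mat 1) F"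

lemma schur_kernel_apply:
  "schur_kernel F z w *v y = (1 / (1 - z * cnj w)) *s (y - F z *v (conj_transpose (F w) *v y))"
proof -
  have "schur_kernel F z w *v y = (1 / (1 - z * cnj w)) *s ((mat 1 - F z ** conj_transpose (F w)) *v y)"
    by (simp add: mvf_kernel_def vec_eq_iff matrix_vector_mult_def sum_distrib_left sum_distrib_right mult_ac)
  then show ?thesis by (simp add: matrix_vector_mult_diff_rdistrib matrix_vector_mul_assoc)
qed

text \<open>
  The second sequence belongs to the image of the first under the adjoint of multiplication by \<open>F\<close>. A negative
  value of the form means that this adjoint increases the norm.
\<close>

lemma qform_schur_kernel:
  assumes "\<And>i. i < n \<Longrightarrow> norm (w i) < 1"
  shows "qform n (kentry (schur_kernel F) w u) z =
    (l2norm (kcoef {..<n} w (\<lambda>i. z i *s u i)))\<^sup>2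
    - (l2norm (kcoef {..<n} w (\<lambda>i. z i *s (conj_transpose (F (w i)) *v u i))))\<^sup>2"
proof -
  have "cnj (z i) * kentry (schur_kernel F) w u i j * z j =
     hdot (z i *s u i) (z j *s u j) / (1 - w i * cnj (w j)) -
     hdot (z i *s (conj_transpose (F (w i)) *v u i)) (z j *s (conj_transpose (F (w j)) *v u j)) / (1 - w i * cnj (w j))" for i j
    by (simp add: kentry_def schur_kernel_apply hdot_mat[of "u i" "F (w i)"] diff_divide_distrib ring_distribs mult_ac)
  moreover have "(l2norm (kcoef {..<n} w (\<lambda>i. z i *s u i)))\<^sup>2 =
      Re (\<Sum>i<n. \<Sum>j<n. hdot (z i *s u i) (z j *s u j) / (1 - w i * cnj (w j)))"
    by (rule kernel_norm) (use assms in auto)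
  moreover have "(l2norm (kcoef {..<n} w (\<lambda>i. z i *s (conj_transpose (F (w i)) *v u i))))\<^sup>2 =
      Re (\<Sum>i<n. \<Sum>j<n. hdot (z i *s (conj_transpose (F (w i)) *v u i)) (z j *s (conj_transpose (F (w j)) *v u j)) / (1 - w i * cnj (w j)))"
    by (rule kernel_norm) (use assms in auto)
  ultimately show ?thesis
    unfolding qform_def by (simp only: sum_subtractf minus_complex.simps(1))
qed

text \<open>
  The families are placed one after the other, the \<open>l\<close>-th one at offset \<open>s l\<close>.
\<close>

lemma concatenate_families:
  fixes fw :: "nat \<Rightarrow> nat \<Rightarrow> complex" and fx :: "nat \<Rightarrow> nat \<Rightarrow> 'b"
  assumes "\<And>l i. l < k \<Longrightarrow> i < fn l \<Longrightarrow> fw l i \<in> \<Omega>"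
  shows "\<exists>n w x s. (\<forall>i<n. w i \<in> \<Omega>) \<and>
     (\<forall>l<k. s l + fn l \<le> n \<and> (\<forall>i<fn l. w (s l + i) = fw l i \<and> x (s l + i) = fx l i))"
  using assms
proof (induction k)
  case (Suc k)
  then obtain n w x s where IH: "\<forall>i<n. w i \<in> \<Omega>"
    "\<forall>l<k. s l + fn l \<le> n \<and> (\<forall>i<fn l. w (s l + i) = fw l i \<and> x (s l + i) = fx l i)" 
    by (metis less_SucI)
  define w' where "w' i = (if i < n then w i else fw k (i - n))" for i
  define x' where "x' i = (if i < n then x i else fx k (i - n))" for i
  have "w' i \<in> \<Omega>" if "i < n + fn k" for i
    using that IH(1) Suc.prems[of k "i - n"] by (auto simp: w'_def)
  moreover have "(s(k := n)) l + fn l \<le> n + fn k \<and> (\<forall>i<fn l. w' ((s(k := n)) l + i) = fw l i \<and> x' ((s(k := n)) l + i) = fx l i)"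
    if "l < Suc k" for l
  proof (cases "l = k")
    case False
    then have l: "l < k" using that by simp
    then have "s l + fn l \<le> n" using IH(2) by blast
    then show ?thesis using IH(2) l by (auto simp: w'_def x'_def)
  qed (auto simp: w'_def x'_def)
  ultimately show ?case by (intro exI[of _ "n + fn k"] exI[of _ w'] exI[of _ x'] exI[of _ "s(k := n)"]) blast
qed auto

lemma sum_block:
  fixes g :: "nat \<Rightarrow> complex"
  assumes "\<And>l. l < k \<Longrightarrow> s l + fn l \<le> n"
  shows "(\<Sum>i<n. (\<Sum>l<k. c l * (if s l \<le> i \<and> i < s l + fn l then 1 else 0)) * g i) = (\<Sum>l<k. c l * (\<Sum>i<fn l. g (s l + i)))"
proof -
  have "(\<Sum>i<n. (\<Sum>l<k. c l * (if s l \<le> i \<and> i < s l + fn l then 1 else 0)) * g i) =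
     (\<Sum>i<n. \<Sum>l<k. c l * (if s l \<le> i \<and> i < s l + fn l then g i else 0))"
    by (intro sum.cong refl) (auto simp: sum_distrib_right intro!: sum.cong)
  also have "\<dots> = (\<Sum>l<k. c l * (\<Sum>i<n. if s l \<le> i \<and> i < s l + fn l then g i else 0))"
    unfolding sum_distrib_left by (rule sum.swap)
  also have "\<dots> = (\<Sum>l<k. c l * (\<Sum>i<fn l. g (s l + i)))"
  proof (rule sum.cong[OF refl])
    fix l assume "l \<in> {..<k}"
    then have le: "s l + fn l \<le> n" using assms by simp
    have "(\<Sum>i<n. if s l \<le> i \<and> i < s l + fn l then g i else 0) = (\<Sum>i\<in>{s l..<s l + fn l}. g i)"
      using le by (subst sum.inter_filter[symmetric]) (auto intro!: sum.cong)
    also have "\<dots> = (\<Sum>i<fn l. g (s l + i))"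
      using sum.shift_bounds_nat_ivl[of g 0 "s l" "fn l"] by (simp add: atLeast0LessThan add.commute)
    finally show "c l * (\<Sum>i<n. if s l \<le> i \<and> i < s l + fn l then g i else 0) = c l * (\<Sum>i<fn l. g (s l + i))" by simp
  qed
  finally show ?thesis .
qed

lemma sum_lessThan_add: "(\<Sum>i<n + m. f i) = (\<Sum>i<n. f i) + (\<Sum>i<m. f (n + i))" for n m :: nat and f :: "nat \<Rightarrow> 'a::comm_monoid_add"
  by (induction m) (simp_all add: add.assoc)

text \<open>
  Let \<open>\<phi> i\<close> be the functional on kernel combinations given by pairing with \<open>F\<close> times \<open>h i\<close>. If a nontrivial
  combination of these functionals is bounded, \<open>kernel_bounded_imp_hardy\<close> shows that the corresponding
  combination of the functions is in the Hardy space. Otherwise there are dual kernel combinations of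
  arbitrarily small norm (\<open>small_dual_vectors\<close>). The adjoint of multiplication by \<open>F\<close> maps them to sequences whose
  pairings with the fixed functions \<open>h i\<close> are \<open>0\<close> or \<open>1\<close>, so on their span it increases the norm at least by the
  factor \<open>2\<close>. The form is then negative definite on a space of dimension \<open>Suc \<kappa>\<close>, a contradiction.
\<close>

lemma few_negative_squares_imp_finite_codim:
  fixes F :: "complex \<Rightarrow> complex^'c^'r" and h :: "nat \<Rightarrow> complex \<Rightarrow> complex^'c"
  assumes \<Omega>: "open \<Omega>" "\<Omega> \<subseteq> \<bbbD>" "(\<bbbD> - \<Omega>) sparse_in \<bbbD>"
    and F: "\<And>i j. (\<lambda>z. F z $ i $ j) holomorphic_on \<Omega>"
    and neg: "\<And>(n::nat) w u. (\<And>i. i < n \<Longrightarrow> w i \<in> \<Omega>) \<Longrightarrow> \<not> neg_dim_ge (Suc \<kappa>) n (kentry (schur_kernel F) w u)"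
    and h: "\<And>i. i < Suc \<kappa> \<Longrightarrow> h i \<in> hardy_disc"
  shows "\<exists>c. (\<exists>i<Suc \<kappa>. c i \<noteq> 0) \<and> (\<exists>k\<in>hardy_disc. \<forall>z\<in>\<Omega>. F z *v (\<Sum>i<Suc \<kappa>. c i *s h i z) = k z)"
proof -
  let ?k = "Suc \<kappa>"
  define V where "V = {(n :: nat, w :: nat \<Rightarrow> complex, x :: nat \<Rightarrow> complex^'r). \<forall>i<n. w i \<in> \<Omega>}"
  define pl :: "nat \<times> (nat \<Rightarrow> complex) \<times> (nat \<Rightarrow> complex^'r) \<Rightarrow> _ \<Rightarrow> _" where
    "pl = (\<lambda>(n, w, x) (n', w', x'). (n + n', \<lambda>i. if i < n then w i else w' (i - n), \<lambda>i. if i < n then x i else x' (i - n)))"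
  define sc :: "complex \<Rightarrow> nat \<times> (nat \<Rightarrow> complex) \<times> (nat \<Rightarrow> complex^'r) \<Rightarrow> _" where
    "sc c = (\<lambda>(n, w, x). (n, w, \<lambda>i. c *s x i))" for c
  define N :: "nat \<times> (nat \<Rightarrow> complex) \<times> (nat \<Rightarrow> complex^'r) \<Rightarrow> real" where
    "N = (\<lambda>(n, w, x). l2norm (kcoef {..<n} w x))"
  define \<phi> :: "nat \<Rightarrow> nat \<times> (nat \<Rightarrow> complex) \<times> (nat \<Rightarrow> complex^'r) \<Rightarrow> complex" where
    "\<phi> i = (\<lambda>(n, w, x). \<Sum>j<n. hdot (F (w j) *v h i (w j)) (x j))" for i
  have D: "norm z < 1" if "z \<in> \<Omega>" for z using that \<Omega>(2) by auto
  have lk: "l2 (kcoef {..<n} w x)" if "\<forall>i<n. w i \<in> \<Omega>" for n :: nat and w and x :: "nat \<Rightarrow> complex^'r"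
    using that D by (intro l2_kcoef) auto
  have kpl: "kcoef {..<n + n'} (\<lambda>i. if i < n then w i else w' (i - n)) (\<lambda>i. if i < n then x i else x' (i - n)) =
     (\<lambda>m. kcoef {..<n} w x m + kcoef {..<n'} w' x' m)" for n n' :: nat and w w' and x x' :: "nat \<Rightarrow> complex^'r"
    by (rule ext) (simp add: kcoef_def sum_lessThan_add)
  have ksc: "kcoef {..<n} w (\<lambda>i. c *s x i) = (\<lambda>m. c *s kcoef {..<n} w x m)" for n :: nat and w c and x :: "nat \<Rightarrow> complex^'r"
    by (rule ext) (simp add: kcoef_def vec_eq_iff sum_component sum_distrib_left mult_ac)
  show ?thesis
  proof (cases "\<exists>c C. (\<exists>i<?k. c i \<noteq> 0) \<and> (\<forall>v\<in>V. norm (\<Sum>i<?k. c i * \<phi> i v) \<le> C * N v)")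
    case True
    then obtain c C where c: "\<exists>i<?k. c i \<noteq> 0" and C: "\<And>v. v \<in> V \<Longrightarrow> norm (\<Sum>i<?k. c i * \<phi> i v) \<le> C * N v" by blast
    define hh where "hh z = (\<Sum>i<?k. cnj (c i) *s h i z)" for z
    define g where "g z = F z *v hh z" for z
    have "\<exists>G\<in>hardy_disc. \<forall>z\<in>\<Omega>. G z = g z"
    proof (rule kernel_bounded_imp_hardy[OF \<Omega>, of g "\<bar>C\<bar>"])
      fix i
      have "(\<lambda>z. h l z $ j) holomorphic_on \<Omega>" if "l < ?k" for l j
        using h[OF that] \<Omega>(2) by (auto simp: hardy_disc_def intro: holomorphic_on_subset)
      then show "(\<lambda>z. g z $ i) holomorphic_on \<Omega>"
        unfolding g_def hh_def matrix_vector_mult_def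
        by (simp add: sum_component) (intro holomorphic_intros F; simp)
    next
      fix n :: nat and w and x :: "nat \<Rightarrow> complex^'r" assume w: "\<And>i. i < n \<Longrightarrow> w i \<in> \<Omega>"
      then have V: "(n, w, x) \<in> V" by (simp add: V_def)
      have "hdot (x j) (g (w j)) = (\<Sum>i<?k. cnj (c i) * hdot (x j) (F (w j) *v h i (w j)))" for j
        by (simp add: g_def hh_def hdot_mat hdot_sum del: sum.lessThan_Suc)
      also have "\<dots> j = (\<Sum>i<?k. cnj (c i * hdot (F (w j) *v h i (w j)) (x j)))" for j
        by (simp add: hdot_commute[of "x j"] del: sum.lessThan_Suc)
      finally have "(\<Sum>j<n. hdot (x j) (g (w j))) = (\<Sum>j<n. \<Sum>i<?k. cnj (c i * hdot (F (w j) *v h i (w j)) (x j)))"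
        by simp
      also have "\<dots> = cnj (\<Sum>i<?k. c i * \<phi> i (n, w, x))"
        by (subst sum.swap) (simp add: \<phi>_def sum_distrib_left del: sum.lessThan_Suc)
      finally have "norm (\<Sum>j<n. hdot (x j) (g (w j))) = norm (\<Sum>i<?k. c i * \<phi> i (n, w, x))"
        by (simp only: complex_mod_cnj)
      also have "\<dots> \<le> C * N (n, w, x)" by (rule C[OF V])
      also have "\<dots> \<le> \<bar>C\<bar> * l2norm (kcoef {..<n} w x)"
        using l2norm_nonneg[OF lk[of n w x]] w by (auto simp: N_def intro: mult_right_mono)
      finally show "norm (\<Sum>i<n. hdot (x i) (g (w i))) \<le> \<bar>C\<bar> * l2norm (kcoef {..<n} w x)" .
    qed simp
    then obtain G where G: "G \<in> hardy_disc" "\<And>z. z \<in> \<Omega> \<Longrightarrow> g z = G z" by auto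
    have "\<exists>i<?k. cnj (c i) \<noteq> 0" using c by simp
    moreover have "\<forall>z\<in>\<Omega>. F z *v (\<Sum>i<?k. cnj (c i) *s h i z) = G z" using G(2) by (simp only: g_def hh_def) simp
    ultimately show ?thesis using G(1) by (intro exI[of _ "\<lambda>i. cnj (c i)"] conjI bexI[of _ G])
  next
    case False
    define H where "H = 1 + (\<Sum>i<?k. l2norm (hcoef (h i)))"
    have hh: "hol (h i)" "l2 (hcoef (h i))" if "i < ?k" for i using h[OF that] by (auto simp: hardy_disc_iff)
    have H: "l2norm (hcoef (h i)) \<le> H" if "i < ?k" for i
    proof -
      have "l2norm (hcoef (h i)) \<le> (\<Sum>i<?k. l2norm (hcoef (h i)))"
        using that hh by (intro member_le_sum) auto
      then show ?thesis by (simp add: H_def)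
    qed
    have H1: "H \<ge> 1" unfolding H_def using hh by (auto intro!: sum_nonneg simp del: sum.lessThan_Suc)
    define M where "M = real ?k * H"
    have M: "M > 0" using H1 by (simp add: M_def)
    have "\<exists>v. \<forall>j<?k. v j \<in> V \<and> N (v j) < 1 / (2 * M) \<and> (\<forall>i<?k. \<phi> i (v j) = (if i = j then 1 else 0))"
    proof (rule small_dual_vectors[where V = V and pl = pl and sc = sc and N = N and \<phi> = \<phi>])
      show "pl u v \<in> V" if "u \<in> V" "v \<in> V" for u v using that by (auto simp: V_def pl_def)
      show "sc c v \<in> V" if "v \<in> V" for c v using that by (auto simp: V_def sc_def)
      show "N (pl u v) \<le> N u + N v" if "u \<in> V" "v \<in> V" for u v
        using that lk by (auto simp: V_def N_def pl_def kpl intro!: l2norm_triangle)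
      show "N (sc c v) = norm c * N v" if "v \<in> V" for c v
        using that lk by (auto simp: V_def N_def sc_def ksc intro!: l2norm_cmult)
      show "N v \<ge> 0" if "v \<in> V" for v
        using that lk by (auto simp: V_def N_def)
      show "\<phi> i (pl u v) = \<phi> i u + \<phi> i v" for i u v
        by (auto simp: \<phi>_def pl_def sum_lessThan_add split: prod.splits)
      show "\<phi> i (sc c v) = c * \<phi> i v" for i c v
        by (auto simp: \<phi>_def sc_def sum_distrib_left split: prod.splits)
      show "\<exists>v\<in>V. C * N v < norm (\<Sum>i<?k. c i * \<phi> i v)" if "\<exists>i<?k. c i \<noteq> 0" for c C
        using False that by (meson not_le)
      show "1 / (2 * M) > 0" using M by simp
    qed
    then obtain v where v: "\<And>j. j < ?k \<Longrightarrow> v j \<in> V" "\<And>j. j < ?k \<Longrightarrow> N (v j) < 1 / (2 * M)"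
      "\<And>i j. i < ?k \<Longrightarrow> j < ?k \<Longrightarrow> \<phi> i (v j) = (if i = j then 1 else 0)" by blast
    define fn where "fn l = fst (v l)" for l
    define fw where "fw l = fst (snd (v l))" for l
    define fx where "fx l = snd (snd (v l))" for l
    have vl: "v l = (fn l, fw l, fx l)" for l by (simp add: fn_def fw_def fx_def)
    have fw: "fw l i \<in> \<Omega>" if "l < ?k" "i < fn l" for l i using v(1)[OF that(1)] that(2) by (simp add: vl V_def)
    obtain n w x s where cat: "\<forall>i<n. w i \<in> \<Omega>"
      "\<forall>l<?k. s l + fn l \<le> n \<and> (\<forall>i<fn l. w (s l + i) = fw l i \<and> x (s l + i) = fx l i)"
      using concatenate_families[of ?k fn fw \<Omega> fx] fw by blast
    have w1: "norm (w i) < 1" if "i < n" for i using cat(1) that D by blast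
    define y where "y l i = (if s l \<le> i \<and> i < s l + fn l then 1 else 0 :: complex)" for l i
    have block: "(\<Sum>i<n. (\<Sum>l<?k. c l * y l i) * g (w i) (x i)) = (\<Sum>l<?k. c l * (\<Sum>i<fn l. g (fw l i) (fx l i)))"
      for c and g :: "complex \<Rightarrow> complex^'r \<Rightarrow> complex"
    proof -
      have "(\<Sum>i<n. (\<Sum>l<?k. c l * y l i) * g (w i) (x i)) = (\<Sum>l<?k. c l * (\<Sum>i<fn l. g (w (s l + i)) (x (s l + i))))"
        unfolding y_def using cat(2) by (intro sum_block) blast
      also have "\<dots> = (\<Sum>l<?k. c l * (\<Sum>i<fn l. g (fw l i) (fx l i)))"
        using cat(2) by (intro sum.cong refl arg_cong[of _ _ "(*) _"]) auto
      finally show ?thesis .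
    qed
    have "qform n (kentry (schur_kernel F) w x) (\<lambda>i. \<Sum>l<?k. c l * y l i) \<le> - (3 / (4 * M\<^sup>2)) * (\<Sum>l<?k. (norm (c l))\<^sup>2)" for c
    proof -
      define z where "z i = (\<Sum>l<?k. c l * y l i)" for i
      define a where "a = kcoef {..<n} w (\<lambda>i. z i *s x i)"
      define b where "b = kcoef {..<n} w (\<lambda>i. z i *s (conj_transpose (F (w i)) *v x i))"
      have la: "l2 a" "l2 b" unfolding a_def b_def using w1 by (auto intro!: l2_kcoef)
      have "a m = (\<Sum>l<?k. c l *s kcoef {..<fn l} (fw l) (fx l) m)" for m
        using block[of c "\<lambda>w x. cnj w ^ m * x $ r" for r]
        by (simp add: a_def kcoef_def z_def vec_eq_iff sum_component mult_ac del: sum.lessThan_Suc)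
      then have a: "a = (\<lambda>m. \<Sum>l<?k. c l *s kcoef {..<fn l} (fw l) (fx l) m)" by blast
      have "l2norm a \<le> (\<Sum>l<?k. norm (c l) * l2norm (kcoef {..<fn l} (fw l) (fx l)))"
        unfolding a using fw by (intro l2norm_sum_le lk) auto
      also have "\<dots> \<le> (\<Sum>l<?k. norm (c l) * (1 / (2 * M)))"
        using v(2) by (intro sum_mono mult_left_mono) (auto simp: vl N_def less_imp_le)
      finally have na: "l2norm a \<le> (\<Sum>l<?k. norm (c l)) / (2 * M)" by (simp add: sum_divide_distrib del: sum.lessThan_Suc)
      have ci: "norm (c i) \<le> H * l2norm b" if i: "i < ?k" for i
      proof -
        have "(\<Sum>j<n. z j * hdot (F (w j) *v h i (w j)) (x j)) = (\<Sum>l<?k. c l * \<phi> i (v l))"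
          unfolding z_def using block[of c "\<lambda>w x. hdot (F w *v h i w) x"] by (simp add: \<phi>_def vl)
        also have "\<dots> = (\<Sum>l<?k. if i = l then c l else 0)" using v(3) i by (intro sum.cong refl) auto
        also have "\<dots> = c i" using i by simp
        finally have "c i = (\<Sum>j<n. z j * hdot (F (w j) *v h i (w j)) (x j))" by simp
        also have "\<dots> = cnj (\<Sum>j<n. hdot (z j *s (conj_transpose (F (w j)) *v x j)) (h i (w j)))"
          by (simp add: hdot_mat[symmetric]) (simp add: hdot_commute[of "x _"])
        finally have "norm (c i) = norm (\<Sum>j<n. hdot (z j *s (conj_transpose (F (w j)) *v x j)) (h i (w j)))" by (simp only: complex_mod_cnj)
        also have "\<dots> \<le> l2norm b * l2norm (hcoef (h i))"
          unfolding b_def using w1 hh[OF i] by (intro kernel_pairing_le) auto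
        also have "\<dots> \<le> l2norm b * H" using H[OF i] l2norm_nonneg[OF la(2)] by (intro mult_left_mono)
        finally show ?thesis by (simp add: mult.commute)
      qed
      have "(\<Sum>l<?k. norm (c l)) \<le> (\<Sum>l<?k. H * l2norm b)" using ci by (intro sum_mono) auto
      then have sb: "(\<Sum>l<?k. norm (c l)) \<le> M * l2norm b" by (simp add: M_def mult_ac del: sum.lessThan_Suc)
      have "l2norm a \<le> l2norm b / 2"
      proof -
        have "(\<Sum>l<?k. norm (c l)) / (2 * M) \<le> M * l2norm b / (2 * M)"
          using M by (intro divide_right_mono sb) simp
        also have "\<dots> = l2norm b / 2" using M by simp
        finally show ?thesis using na by linarith
      qed
      then have "(l2norm a)\<^sup>2 \<le> (l2norm b / 2)\<^sup>2" using l2norm_nonneg[OF la(1)] by (intro power_mono)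
      moreover have "(\<Sum>l<?k. (norm (c l))\<^sup>2) \<le> (M * l2norm b)\<^sup>2"
      proof -
        have "(\<Sum>l<?k. (norm (c l))\<^sup>2) \<le> (\<Sum>l<?k. norm (c l) * (\<Sum>l<?k. norm (c l)))"
          unfolding power2_eq_square by (intro sum_mono mult_left_mono member_le_sum) auto
        also have "\<dots> = (\<Sum>l<?k. norm (c l))\<^sup>2" by (simp only: power2_eq_square sum_distrib_right)
        also have "\<dots> \<le> (M * l2norm b)\<^sup>2" using sb by (intro power_mono sum_nonneg) auto
        finally show ?thesis .
      qed
      then have "(\<Sum>l<?k. (norm (c l))\<^sup>2) / M\<^sup>2 \<le> (l2norm b)\<^sup>2"
        using M by (simp add: power_mult_distrib divide_le_eq mult.commute)
      ultimately have "(l2norm a)\<^sup>2 - (l2norm b)\<^sup>2 \<le> - (3 / (4 * M\<^sup>2)) * (\<Sum>l<?k. (norm (c l))\<^sup>2)"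
        by (simp add: power_divide field_simps del: sum.lessThan_Suc)
      moreover have "qform n (kentry (schur_kernel F) w x) z = (l2norm a)\<^sup>2 - (l2norm b)\<^sup>2"
        unfolding a_def b_def by (rule qform_schur_kernel) (rule w1)
      ultimately show ?thesis unfolding z_def[symmetric] by simp
    qed
    then have "neg_dim_ge ?k n (kentry (schur_kernel F) w x)"
      unfolding neg_dim_ge_def using M by (intro exI[of _ y] exI[of _ "3 / (4 * M\<^sup>2)"]) simp
    then show ?thesis using neg[of n w x] cat(1) by blast
  qed
qed

text \<open>
  Suppose that the form is negative definite on the span of \<open>y 0, \<dots>, y (k - 1)\<close>, and let \<open>b l\<close> be the image of the kernel
  combination of \<open>y l\<close> under the adjoint of multiplication by \<open>F\<close>. The hypothesis, applied to these images
  truncated at a large degree \<open>L\<close>, provides a combination \<open>a\<close> of kernels with image \<open>B\<close> such that \<open>F\<close> does not increase the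
  norm of the truncation of \<open>B\<close>. Then \<open>T\<close>, the squared norm of the truncation, is the pairing of \<open>a\<close> with \<open>F\<close> times the truncation,
  whence \<open>T \<le> norm a * sqrt T\<close>. So the form, the squared norm of \<open>a\<close> minus that of \<open>B\<close>, is nonnegative up to the tail of
  \<open>B\<close>, and the choice of \<open>L\<close> makes this tail smaller than the margin \<open>\<delta>\<close>.
\<close>

lemma contractive_finite_codim_imp_few_negative_squares:
  fixes F :: "complex \<Rightarrow> complex^'c^'r"
  assumes codim: "\<And>(L::nat) (b :: nat \<Rightarrow> nat \<Rightarrow> complex^'c). \<exists>c. (\<exists>l<k. c l \<noteq> 0) \<and>
      (\<exists>g\<in>hardy_disc. (\<forall>z\<in>\<Omega>. F z *v (\<Sum>l<k. c l *s (\<Sum>n<L. z ^ n *s b l n)) = g z) \<and>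
         (l2norm (hcoef g))\<^sup>2 \<le> (\<Sum>n<L. (norm (\<Sum>l<k. c l *s b l n))\<^sup>2))"
    and \<Omega>: "\<Omega> \<subseteq> \<bbbD>" and w: "\<And>i. i < n \<Longrightarrow> w i \<in> \<Omega>"
  shows "\<not> neg_dim_ge k n (kentry (schur_kernel F) w u)"
proof
  assume "neg_dim_ge k n (kentry (schur_kernel F) w u)"
  then obtain y \<delta> where \<delta>: "\<delta> > 0" and
    y: "\<And>c. qform n (kentry (schur_kernel F) w u) (\<lambda>i. \<Sum>l<k. c l * y l i) \<le> - \<delta> * (\<Sum>l<k. (norm (c l))\<^sup>2)"
    unfolding neg_dim_ge_def by blast
  have w1: "norm (w i) < 1" if "i < n" for i using w[OF that] \<Omega> by auto
  define b where "b l = kcoef {..<n} w (\<lambda>i. y l i *s (conj_transpose (F (w i)) *v u i))" for l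
  have lb: "l2 (b l)" for l unfolding b_def using w1 by (intro l2_kcoef) auto
  have st: "summable (\<lambda>m. \<Sum>l<k. (norm (b l m))\<^sup>2)" using lb by (intro summable_sum) (simp add: l2_def)
  from suminf_exist_split[OF _ st, of "\<delta> / 2"] \<delta> obtain L where
    L: "norm (\<Sum>m. \<Sum>l<k. (norm (b l (m + L)))\<^sup>2) < \<delta> / 2" by auto
  obtain c g where c: "\<exists>l<k. c l \<noteq> 0" and g: "g \<in> hardy_disc"
    "\<And>z. z \<in> \<Omega> \<Longrightarrow> F z *v (\<Sum>l<k. c l *s (\<Sum>n<L. z ^ n *s b l n)) = g z"
    "(l2norm (hcoef g))\<^sup>2 \<le> (\<Sum>n<L. (norm (\<Sum>l<k. c l *s b l n))\<^sup>2)"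
    using codim[where L = L and b = b] by blast
  define z where "z i = (\<Sum>l<k. c l * y l i)" for i
  define a where "a = kcoef {..<n} w (\<lambda>i. z i *s u i)"
  define B where "B = kcoef {..<n} w (\<lambda>i. z i *s (conj_transpose (F (w i)) *v u i))"
  have la: "l2 a" "l2 B" unfolding a_def B_def using w1 by (auto intro!: l2_kcoef)
  have B: "B m = (\<Sum>l<k. c l *s b l m)" for m
    unfolding B_def b_def kcoef_def z_def vec_eq_iff
    by (simp add: sum_component sum_distrib_left sum_distrib_right mult_ac sum.swap[of _ "{..<k}"])
  define h where "h = (\<lambda>\<zeta>. \<Sum>m<L. \<zeta> ^ m *s B m)"
  have hh: "hol h" "hcoef h = (\<lambda>m. if m < L then B m else 0)" unfolding h_def by (rule hcoef_polynomial)+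
  have h: "h \<zeta> = (\<Sum>l<k. c l *s (\<Sum>m<L. \<zeta> ^ m *s b l m))" for \<zeta>
    unfolding h_def B vec_eq_iff
    by (simp add: sum_component sum_distrib_left mult_ac sum.swap[of _ "{..<k}"])
  define T where "T = (\<Sum>m<L. (norm (B m))\<^sup>2)"
  have T0: "T \<ge> 0" unfolding T_def by (intro sum_nonneg) auto
  have "(\<lambda>m. hdot (B m) (hcoef h m)) sums (\<Sum>i<n. hdot (z i *s (conj_transpose (F (w i)) *v u i)) (h (w i)))"
    unfolding B_def using w1 hh(1) by (intro kernel_pairing) auto
  moreover have "(\<lambda>m. hdot (B m) (hcoef h m)) sums (\<Sum>m<L. hdot (B m) (hcoef h m))"
    by (rule sums_finite) (auto simp: hh)
  ultimately have "(\<Sum>i<n. hdot (z i *s (conj_transpose (F (w i)) *v u i)) (h (w i))) = (\<Sum>m<L. hdot (B m) (hcoef h m))"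
    by (rule sums_unique2)
  also have "\<dots> = complex_of_real T" by (simp add: T_def hh hdot_self)
  also have "(\<Sum>i<n. hdot (z i *s (conj_transpose (F (w i)) *v u i)) (h (w i))) = (\<Sum>i<n. hdot (z i *s u i) (g (w i)))"
    using g(2) w by (intro sum.cong refl) (simp add: hdot_mat[symmetric] h)
  finally have "T = norm (\<Sum>i<n. hdot (z i *s u i) (g (w i)))" using T0 by simp
  also have "\<dots> \<le> l2norm a * l2norm (hcoef g)"
    unfolding a_def using w1 g(1) by (intro kernel_pairing_le) (auto simp: hardy_disc_iff)
  also have "\<dots> \<le> l2norm a * sqrt T"
    using g(3) l2norm_nonneg[OF la(1)] by (intro mult_left_mono real_le_rsqrt) (auto simp: T_def B)
  finally have "sqrt T * sqrt T \<le> l2norm a * sqrt T" using T0 by simp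
  then have "sqrt T \<le> l2norm a"
  proof (cases "T = 0")
    case False
    then have "sqrt T > 0" using T0 by simp
    then show ?thesis using \<open>sqrt T * sqrt T \<le> l2norm a * sqrt T\<close> mult_right_le_imp_le by blast
  qed (use l2norm_nonneg[OF la(1)] in simp)
  then have "(sqrt T)\<^sup>2 \<le> (l2norm a)\<^sup>2" using T0 by (intro power_mono) auto
  then have Ta: "T \<le> (l2norm a)\<^sup>2" using T0 by simp
  define C where "C = (\<Sum>l<k. (norm (c l))\<^sup>2)"
  have C: "C > 0"
  proof -
    obtain l where "l < k" "c l \<noteq> 0" using c by blast
    then show ?thesis unfolding C_def by (intro sum_pos2[of _ l]) auto
  qed
  have Bm: "(norm (B m))\<^sup>2 \<le> C * (\<Sum>l<k. (norm (b l m))\<^sup>2)" for m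
  proof -
    have "norm (B m) \<le> (\<Sum>l<k. norm (c l) * norm (b l m))"
      unfolding B by (rule sum_norm_le) (simp add: norm_cmult_vec)
    then have "(norm (B m))\<^sup>2 \<le> (\<Sum>l<k. norm (c l) * norm (b l m))\<^sup>2" by (intro power_mono) auto
    also have "\<dots> \<le> C * (\<Sum>l<k. (norm (b l m))\<^sup>2)" unfolding C_def by (rule Cauchy_Schwarz_ineq_sum)
    finally show ?thesis .
  qed
  have "(l2norm B)\<^sup>2 = (\<Sum>m. (norm (B (m + L)))\<^sup>2) + T"
    unfolding l2norm_square[OF la(2)] T_def by (rule suminf_split_initial_segment) (use la in \<open>simp add: l2_def\<close>)
  also have "(\<Sum>m. (norm (B (m + L)))\<^sup>2) \<le> (\<Sum>m. C * (\<Sum>l<k. (norm (b l (m + L)))\<^sup>2))"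
    using la(2) Bm summable_ignore_initial_segment[OF st, of L]
    by (intro suminf_le summable_mult) (auto simp: l2_def intro!: summable_ignore_initial_segment)
  also have "\<dots> = C * (\<Sum>m. \<Sum>l<k. (norm (b l (m + L)))\<^sup>2)"
    by (rule suminf_mult[OF summable_ignore_initial_segment[OF st]])
  also have "\<dots> \<le> C * (\<delta> / 2)" using L C by (intro mult_left_mono) auto
  finally have "(l2norm B)\<^sup>2 \<le> C * (\<delta> / 2) + T" by simp
  moreover have "(l2norm a)\<^sup>2 - (l2norm B)\<^sup>2 \<le> - \<delta> * C"
  proof -
    have "qform n (kentry (schur_kernel F) w u) z = (l2norm a)\<^sup>2 - (l2norm B)\<^sup>2"
      unfolding a_def B_def by (rule qform_schur_kernel) (rule w1)
    then show ?thesis using y[of c] unfolding z_def[symmetric] C_def by simp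
  qed
  moreover have "C * (\<delta> / 2) < \<delta> * C" using \<delta> C by simp
  ultimately show False using Ta by linarith
qed

section \<open>The Potapov-Ginzburg transform\<close>

definition proj1 :: "complex^('p::finite + 'q::finite)^('p + 'q)" where
  "proj1 = (\<chi> i j. if i = j then (case i of Inl _ \<Rightarrow> 1 | Inr _ \<Rightarrow> 0) else 0)"

definition proj2 :: "complex^('p::finite + 'q::finite)^('p + 'q)" where
  "proj2 = (\<chi> i j. if i = j then (case i of Inl _ \<Rightarrow> 0 | Inr _ \<Rightarrow> 1) else 0)"

definition upper :: "complex^('p::finite + 'q::finite) \<Rightarrow> complex^'p" where "upper x = (\<chi> a. x $ Inl a)"
definition lower :: "complex^('p::finite + 'q::finite) \<Rightarrow> complex^'q" where "lower x = (\<chi> a. x $ Inr a)"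
definition in_upper :: "complex^'p \<Rightarrow> complex^('p::finite + 'q::finite)" where
  "in_upper x = (\<chi> i. case i of Inl a \<Rightarrow> x $ a | Inr _ \<Rightarrow> 0)"
definition in_lower :: "complex^'q \<Rightarrow> complex^('p::finite + 'q::finite)" where
  "in_lower x = (\<chi> i. case i of Inl _ \<Rightarrow> 0 | Inr a \<Rightarrow> x $ a)"

lemma proj_apply:
  "proj1 *v x = in_upper (upper x)" "proj2 *v x = in_lower (lower x)" "j_pq *v x = proj1 *v x - proj2 *v x"
proof -
  have *: "(\<Sum>j\<in>UNIV. (if i = j then c else 0) * x $ j) = c * x $ i" for i c
  proof -
    have "(\<Sum>j\<in>UNIV. (if i = j then c else 0) * x $ j) = (\<Sum>j\<in>UNIV. if i = j then c * x $ j else 0)"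
      by (intro sum.cong) auto
    then show ?thesis by simp
  qed
  show "proj1 *v x = in_upper (upper x)" "proj2 *v x = in_lower (lower x)" "j_pq *v x = proj1 *v x - proj2 *v x"
    by (auto simp: vec_eq_iff matrix_vector_mult_def proj1_def proj2_def j_pq_def in_upper_def upper_def in_lower_def lower_def * split: sum.splits)
qed

lemma hdot_minus [simp]: "hdot (- u) v = - hdot u v" "hdot u (- v) = - hdot u v"
  by (simp_all add: hdot_def sum_negf)

lemma parts_simps [simp]:
  "upper (in_upper x) = x" "lower (in_upper x) = 0" "upper (in_lower y) = 0" "lower (in_lower y) = y"
  "in_upper (upper z) + in_lower (lower z) = z"
  "upper (x' + y') = upper x' + upper y'" "lower (x' + y') = lower x' + lower y'"
  "upper (- x') = - upper x'" "lower (- x') = - lower x'" "upper (x' - y') = upper x' - upper y'" "lower (x' - y') = lower x' - lower y'"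
  "upper (c *s x') = c *s upper x'" "lower (c *s x') = c *s lower x'"
  "upper 0 = 0" "lower 0 = 0" "in_upper 0 = 0" "in_lower 0 = 0"
  by (auto simp: vec_eq_iff upper_def lower_def in_upper_def in_lower_def split: sum.splits)

lemma parts_sum: "upper (sum f I) = (\<Sum>i\<in>I. upper (f i))" "lower (sum f I) = (\<Sum>i\<in>I. lower (f i))"
  by (induct I rule: infinite_finite_induct; simp)+

lemma UNIV_sum_type: "(\<Sum>i\<in>UNIV. f (i :: 'p::finite + 'q::finite)) = (\<Sum>a\<in>UNIV. f (Inl a)) + (\<Sum>b\<in>UNIV. f (Inr b))"
  by (simp add: UNIV_Plus_UNIV[symmetric] sum.Plus del: UNIV_Plus_UNIV)

lemma hdot_parts: "hdot x y = hdot (upper x) (upper y) + hdot (lower x) (lower y)"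
  by (simp add: hdot_def UNIV_sum_type upper_def lower_def)

lemma norm_parts: "(norm x)\<^sup>2 = (norm (upper x))\<^sup>2 + (norm (lower x))\<^sup>2"
  by (simp add: norm_vec_square UNIV_sum_type upper_def lower_def)

lemma zero_id_apply: "zero_id *v x = lower x"
proof -
  have "(\<Sum>j\<in>UNIV. (if j = Inr i then 1 else 0) * x $ j) = (\<Sum>j\<in>UNIV. if j = Inr i then x $ j else 0)" for i
    by (intro sum.cong) auto
  then show ?thesis by (simp add: vec_eq_iff matrix_vector_mult_def zero_id_def lower_def)
qed

definition pgC :: "complex^('p::finite + 'q::finite)^('p + 'q) \<Rightarrow> complex^('p + 'q)^('p + 'q)" where
  "pgC A = proj1 - A ** proj2"

definition pgD :: "complex^('p::finite + 'q::finite)^('p + 'q) \<Rightarrow> complex^('p + 'q)^('p + 'q)" where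
  "pgD A = A ** proj1 - proj2"

text \<open>
  The meaning of the three matrices is \<open>pg_relation\<close> together with \<open>pgS_iff\<close>: \<open>pgS A\<close> maps \<open>h\<close> to \<open>k\<close> when \<open>A\<close> maps
  the upper component of \<open>h\<close> and the lower component of \<open>k\<close> to the upper component of \<open>k\<close> and the lower component of \<open>h\<close>.
\<close>

definition pgS :: "complex^('p::finite + 'q::finite)^('p + 'q) \<Rightarrow> complex^('p + 'q)^('p + 'q)" where
  "pgS A = matrix_inv (pgC A) ** pgD A"

lemma pg_apply:
  "pgC A *v k = in_upper (upper k) - A *v in_lower (lower k)"
  "pgD A *v h = A *v in_upper (upper h) - in_lower (lower h)"
  by (simp_all add: pgC_def pgD_def matrix_vector_mult_diff_rdistrib matrix_vector_mul_assoc[symmetric] proj_apply)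

lemma pg_relation:
  fixes A :: "complex^('p::finite + 'q::finite)^('p + 'q)"
  shows
  "pgC A *v k = pgD A *v h \<longleftrightarrow> A *v (in_upper (upper h) + in_lower (lower k)) = in_upper (upper k) + in_lower (lower h)"
proof -
  have "x - b = a - y \<longleftrightarrow> a + b = x + y" for x y a b :: "complex^('p + 'q)"
  proof -
    have "x - b = a - y \<longleftrightarrow> (x - b) + (b + y) = (a - y) + (b + y)" by (simp only: add_right_cancel)
    moreover have "(x - b) + (b + y) = x + y" "(a - y) + (b + y) = a + b" by simp_all
    ultimately show ?thesis by metis
  qed
  then show ?thesis unfolding pg_apply by (simp add: matrix_vector_right_distrib)
qed

lemma conj_transpose_apply: "hdot (A *v x) y = hdot x (conj_transpose A *v y)"
proof -
  have "hdot (A *v x) y = cnj (hdot y (A *v x))" by (rule hdot_commute)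
  also have "\<dots> = cnj (hdot (conj_transpose A *v y) x)" by (simp only: hdot_mat)
  also have "\<dots> = hdot x (conj_transpose A *v y)" by (rule hdot_commute[symmetric])
  finally show ?thesis .
qed

lemma hdot_eqI: "(\<And>x. hdot x u = hdot x v) \<Longrightarrow> u = v"
proof -
  assume *: "\<And>x. hdot x u = hdot x v"
  have "hdot (u - v) (u - v) = 0" using *[of "u - v"] by simp
  then show "u = v" by (simp add: hdot_self)
qed

lemma matrix_vector_mult_minus: "(- A) *v x = - (A *v (x :: complex^'n))" "A *v (- x) = - (A *v x)"
  by (simp_all add: vec_eq_iff matrix_vector_mult_def sum_negf)

lemma mat_eqI: "(\<And>x. A *v x = B *v x) \<Longrightarrow> A = (B :: complex^'n^'m)"
  by (simp add: matrix_eq)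

text \<open>
  The adjoint of \<open>pgC A\<close> keeps the upper component of \<open>x\<close> and takes the lower component, up to sign, from the
  adjoint of \<open>A\<close>; for \<open>pgD A\<close> the roles are exchanged. In the difference the four terms regroup to the forms
  of \<open>j\<close>.
\<close>

lemma pg_form:
  fixes A B :: "complex^('p::finite + 'q::finite)^('p + 'q)"
  shows
  "hdot (conj_transpose (pgC A) *v x) (conj_transpose (pgC B) *v y) - hdot (conj_transpose (pgD A) *v x) (conj_transpose (pgD B) *v y)
   = hdot x (j_pq *v y) - hdot (conj_transpose A *v x) (j_pq *v (conj_transpose B *v y))"
proof -
  have C: "conj_transpose (pgC B) *v y = in_upper (upper y) - in_lower (lower (conj_transpose B *v y))" for B and y :: "complex^('p + 'q)"
  proof (rule hdot_eqI)
    fix x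
    have "hdot x (conj_transpose (pgC B) *v y) = hdot (in_upper (upper x)) y - hdot (B *v in_lower (lower x)) y"
      unfolding conj_transpose_apply[symmetric] by (simp add: pg_apply)
    also have "hdot (B *v in_lower (lower x)) y = hdot (in_lower (lower x)) (conj_transpose B *v y)"
      by (rule conj_transpose_apply)
    finally show "hdot x (conj_transpose (pgC B) *v y) = hdot x (in_upper (upper y) - in_lower (lower (conj_transpose B *v y)))"
      by (simp add: hdot_parts)
  qed
  have D: "conj_transpose (pgD B) *v y = in_upper (upper (conj_transpose B *v y)) - in_lower (lower y)" for B and y :: "complex^('p + 'q)"
  proof (rule hdot_eqI)
    fix x
    have "hdot x (conj_transpose (pgD B) *v y) = hdot (B *v in_upper (upper x)) y - hdot (in_lower (lower x)) y"
      unfolding conj_transpose_apply[symmetric] by (simp add: pg_apply)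
    also have "hdot (B *v in_upper (upper x)) y = hdot (in_upper (upper x)) (conj_transpose B *v y)"
      by (rule conj_transpose_apply)
    finally show "hdot x (conj_transpose (pgD B) *v y) = hdot x (in_upper (upper (conj_transpose B *v y)) - in_lower (lower y))"
      by (simp add: hdot_parts)
  qed
  show ?thesis unfolding C D proj_apply by (simp add: hdot_parts)
qed

lemma j_pq_hdot: "hdot x (j_pq *v y) = hdot (upper x) (upper y) - hdot (lower x) (lower y)"
  by (simp add: proj_apply hdot_parts)

lemma det_conj_transpose: "Determinants.det (conj_transpose M) = cnj (Determinants.det (M :: complex^'n^'n))"
proof -
  have "conj_transpose M = (\<chi> i j. cnj (transpose M $ i $ j))" by (simp add: conj_transpose_def transpose_def)
  moreover have "Determinants.det (\<chi> i j. cnj (N $ i $ j)) = cnj (Determinants.det N)" for N :: "complex^'n^'n"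
    by (simp add: Determinants.det_def)
  ultimately show ?thesis by simp
qed

text \<open>
  A vector in the kernel of the adjoint of \<open>pgC A\<close> is also in the kernel of the adjoint of \<open>pgD A\<close>, by \<open>pg_form\<close>. So it
  is orthogonal to both ranges; the first contains the upper coordinate space, the second the lower one.
\<close>

lemma pgC_invertible_if_j_unitary:
  assumes "A ** j_pq ** conj_transpose A = j_pq"
  shows "Determinants.det (pgC A) \<noteq> 0"
proof -
  have form: "hdot x (j_pq *v y) = hdot (conj_transpose A *v x) (j_pq *v (conj_transpose A *v y))" for x y
    using arg_cong[OF assms, of "\<lambda>M. hdot x (M *v y)"] by (simp add: matrix_vector_mul_assoc[symmetric] hdot_mat)
  have "x = 0" if x: "conj_transpose (pgC A) *v x = 0" for x
  proof -
    have "hdot (conj_transpose (pgD A) *v x) (conj_transpose (pgD A) *v x) = 0"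
      using pg_form[of A x A x] form[of x x] x by simp
    then have d: "conj_transpose (pgD A) *v x = 0" by (simp add: hdot_self)
    have a: "hdot x (pgC A *v y) = 0" "hdot x (pgD A *v y) = 0" for y using x d by (simp_all add: hdot_mat)
    have "hdot x (in_upper (upper x)) = 0" using a(1)[of "in_upper (upper x)"] by (simp add: pg_apply)
    moreover have "hdot x (in_lower (lower x)) = 0" using a(2)[of "in_lower (lower x)"] by (simp add: pg_apply)
    ultimately have "upper x = 0" "lower x = 0" by (simp_all add: hdot_parts hdot_self)
    then show "x = 0" using parts_simps(5)[of x] by simp
  qed
  then have "invertible (conj_transpose (pgC A))"
    by (simp add: invertible_left_inverse matrix_left_invertible_ker)
  then have "Determinants.det (conj_transpose (pgC A)) \<noteq> 0" by (simp add: invertible_det_nz)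
  then show ?thesis by (simp add: det_conj_transpose)
qed

lemma matrix_inv_cancel:
  assumes "invertible A"
  shows "matrix_inv A ** A = mat 1" "A ** matrix_inv A = mat 1"
  using someI_ex[OF assms[unfolded invertible_def]] by (auto simp: matrix_inv_def)

lemma pgS_iff:
  assumes "Determinants.det (pgC A) \<noteq> 0"
  shows "pgS A *v h = k \<longleftrightarrow> pgC A *v k = pgD A *v h"
proof -
  have "invertible (pgC A)" using assms by (simp add: invertible_det_nz)
  then have "matrix_inv (pgC A) ** pgC A = mat 1" "pgC A ** matrix_inv (pgC A) = mat 1"
    by (simp_all add: matrix_inv_cancel)
  then have "matrix_inv (pgC A) *v (pgC A *v x) = x" "pgC A *v (matrix_inv (pgC A) *v x) = x" for x
    by (simp_all add: matrix_vector_mul_assoc)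
  moreover have "pgS A *v h = matrix_inv (pgC A) *v (pgD A *v h)" by (simp add: pgS_def matrix_vector_mul_assoc)
  ultimately show ?thesis by metis
qed

lemma pgC_pgS: "Determinants.det (pgC A) \<noteq> 0 \<Longrightarrow> pgC A ** pgS A = pgD A"
proof (rule mat_eqI)
  fix x assume d: "Determinants.det (pgC A) \<noteq> 0"
  have "pgC A *v (pgS A *v x) = pgD A *v x" by (rule iffD1[OF pgS_iff[OF d] refl])
  then show "(pgC A ** pgS A) *v x = pgD A *v x" by (simp only: matrix_vector_mul_assoc)
qed

text \<open>
  If the right lower block annihilates \<open>y\<close>, then \<open>A\<close> maps \<open>in_lower y\<close> to an upper vector \<open>u\<close>, and \<open>pgC A\<close> annihilates
  \<open>u + in_lower y\<close>.
\<close>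

lemma block22_invertible:
  fixes A :: "complex^('p::finite + 'q::finite)^('p + 'q)"
  assumes "Determinants.det (pgC A) \<noteq> 0"
  shows "invertible (block22 A)"
proof -
  have "y = 0" if y: "block22 A *v y = 0" for y
  proof -
    have "lower (A *v in_lower y) = block22 A *v y"
      by (simp add: vec_eq_iff lower_def matrix_vector_mult_def UNIV_sum_type in_lower_def block22_def)
    then have l: "lower (A *v in_lower y) = 0" using y by simp
    let ?k = "in_upper (upper (A *v in_lower y)) + in_lower y"
    have "pgC A *v ?k = in_upper (upper (A *v in_lower y)) - A *v in_lower y" by (simp add: pg_apply)
    also have "\<dots> = 0" using l parts_simps(5)[of "A *v in_lower y"] by simp
    finally have "pgC A *v ?k = 0" .
    moreover have "invertible (pgC A)" using assms by (simp add: invertible_det_nz)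
    ultimately have "?k = 0"
      unfolding invertible_left_inverse matrix_left_invertible_ker by blast
    then have "lower ?k = 0" by simp
    then show "y = 0" by simp
  qed
  then show ?thesis by (simp add: invertible_left_inverse matrix_left_invertible_ker)
qed

text \<open>
  For an argument without lower component the relation between \<open>W z\<close> and its transform says that
  \<open>w\<^sub>2\<^sub>1 x + w\<^sub>2\<^sub>2 k\<^sub>2 = 0\<close>.
\<close>

lemma lower_pgS:
  fixes W :: "complex \<Rightarrow> complex^('p::finite + 'q::finite)^('p + 'q)"
  assumes "Determinants.det (pgC (W z)) \<noteq> 0"
  shows "lower (pgS (W z) *v in_upper x) = s21 W z *v x"
proof -
  let ?A = "W z"
  define k where "k = pgS ?A *v in_upper x"
  have "pgC ?A *v k = pgD ?A *v in_upper x" using iffD1[OF pgS_iff[OF assms] k_def[symmetric]] .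
  then have "?A *v (in_upper x + in_lower (lower k)) = in_upper (upper k)" by (simp add: pg_relation)
  then have "lower (?A *v (in_upper x + in_lower (lower k))) = lower (in_upper (upper k) :: complex^('p + 'q))" by (rule arg_cong)
  then have "lower (?A *v in_upper x) + lower (?A *v in_lower (lower k)) = 0"
    by (simp add: matrix_vector_right_distrib)
  moreover have "lower (?A *v in_upper x) = block21 ?A *v x"
    by (simp add: vec_eq_iff lower_def matrix_vector_mult_def UNIV_sum_type in_upper_def block21_def)
  moreover have "lower (?A *v in_lower (lower k)) = block22 ?A *v lower k"
    by (simp add: vec_eq_iff lower_def matrix_vector_mult_def UNIV_sum_type in_lower_def block22_def)
  ultimately have "block22 ?A *v lower k = - (block21 ?A *v x)" by (simp add: add_eq_0_iff)
  then have "matrix_inv (block22 ?A) *v (block22 ?A *v lower k) =  matrix_inv (block22 ?A) *v (- (block21 ?A *v x))" by simp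
  then have "lower k = matrix_inv (block22 ?A) *v (- (block21 ?A *v x))"
    using matrix_inv_cancel(1)[OF block22_invertible[OF assms]] by (simp add: matrix_vector_mul_assoc)
  also have "\<dots> = s21 W z *v x"
    by (simp add: s21_def matrix_vector_mult_minus matrix_vector_mul_assoc)
  finally show ?thesis by (simp add: k_def)
qed

lemma mvf_kernel_apply:
  "mvf_kernel J J' F z w *v y = (1 / (1 - z * cnj w)) *s (J *v y - F z *v (J' *v (conj_transpose (F w) *v y)))"
proof -
  have "mvf_kernel J J' F z w *v y = (1 / (1 - z * cnj w)) *s ((J - F z ** J' ** conj_transpose (F w)) *v y)"
    by (simp add: mvf_kernel_def vec_eq_iff matrix_vector_mult_def sum_distrib_left sum_distrib_right mult_ac)
  then show ?thesis by (simp add: matrix_vector_mult_diff_rdistrib matrix_vector_mul_assoc matrix_mul_assoc)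
qed

lemma conj_transpose_mult: "conj_transpose (A ** B) = conj_transpose B ** conj_transpose A"
  by (rule mat_eqI, rule hdot_eqI) (simp add: conj_transpose_apply[symmetric] matrix_vector_mul_assoc[symmetric])

text \<open>
  The adjoint of \<open>pgS\<close> maps the vectors \<open>conj_transpose (pgC A) *v u\<close> to \<open>conj_transpose (pgD A) *v u\<close>; the rest is
  \<open>pg_form\<close>.
\<close>

lemma pg_kernel_congruence:
  fixes R :: "complex \<Rightarrow> complex^('p::finite + 'q::finite)^('p + 'q)"
  assumes "\<And>i. i < n \<Longrightarrow> Determinants.det (pgC (R (w i))) \<noteq> 0" "i < n" "j < n"
  shows "kentry (mvf_kernel j_pq j_pq R) w u i j =
     kentry (schur_kernel (\<lambda>z. pgS (R z))) w (\<lambda>i. conj_transpose (pgC (R (w i))) *v u i) i j"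
proof -
  let ?A = "R (w i)" and ?B = "R (w j)"
  have S: "conj_transpose (pgS M) *v (conj_transpose (pgC M) *v v) = conj_transpose (pgD M) *v v"
    if "Determinants.det (pgC M) \<noteq> 0" for M :: "complex^('p + 'q)^('p + 'q)" and v
    by (simp add: matrix_vector_mul_assoc conj_transpose_mult[symmetric] pgC_pgS[OF that])
  have A: "Determinants.det (pgC ?A) \<noteq> 0" "Determinants.det (pgC ?B) \<noteq> 0" using assms by auto
  have "kentry (schur_kernel (\<lambda>z. pgS (R z))) w (\<lambda>i. conj_transpose (pgC (R (w i))) *v u i) i j =
      (hdot (conj_transpose (pgC ?A) *v u i) (conj_transpose (pgC ?B) *v u j) -
       hdot (conj_transpose (pgD ?A) *v u i) (conj_transpose (pgD ?B) *v u j)) / (1 - w i * cnj (w j))"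
    by (simp add: kentry_def schur_kernel_apply hdot_mat[of _ "pgS ?A"] S A diff_divide_distrib)
  also have "\<dots> = kentry (mvf_kernel j_pq j_pq R) w u i j"
    unfolding pg_form by (simp add: kentry_def mvf_kernel_apply hdot_mat[of _ ?A] diff_divide_distrib)
  finally show ?thesis by simp
qed

lemma neg_dim_ge_cong:
  assumes "\<And>i j. i < n \<Longrightarrow> j < n \<Longrightarrow> G i j = G' i j"
  shows "neg_dim_ge k n G \<longleftrightarrow> neg_dim_ge k n G'"
proof -
  have "qform n G = qform n G'" using assms by (intro ext) (auto simp: qform_def)
  then show ?thesis by (simp add: neg_dim_ge_def)
qed

text \<open>
  On vectors without upper component the adjoint of \<open>s\<close> is the upper component of the adjoint of \<open>S\<close>. By
  \<open>qform_schur_kernel\<close> the form of \<open>S\<close> subtracts a larger norm than that of \<open>s\<close>.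
\<close>

lemma neg_dim_ge_lower_left:
  fixes S :: "complex \<Rightarrow> complex^('p::finite + 'q::finite)^('p + 'q)"
  assumes s: "\<And>i x. i < n \<Longrightarrow> lower (S (w i) *v in_upper x) = s (w i) *v x"
    and w: "\<And>i. i < n \<Longrightarrow> norm (w i) < 1"
    and neg: "neg_dim_ge k n (kentry (schur_kernel s) w u)"
  shows "neg_dim_ge k n (kentry (schur_kernel S) w (\<lambda>i. in_lower (u i)))"
proof -
  have le: "qform n (kentry (schur_kernel S) w (\<lambda>i. in_lower (u i))) z \<le> qform n (kentry (schur_kernel s) w u) z" for z
  proof -
    have up: "upper (conj_transpose (S (w i)) *v in_lower (u i)) = conj_transpose (s (w i)) *v u i" if "i < n" for i
    proof (rule hdot_eqI)
      fix x
      have "hdot x (upper (conj_transpose (S (w i)) *v in_lower (u i))) = hdot (in_upper x) (conj_transpose (S (w i)) *v in_lower (u i))"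
        by (simp add: hdot_parts)
      also have "\<dots> = hdot (s (w i) *v x) (u i)"
        unfolding conj_transpose_apply[symmetric] by (simp add: hdot_parts[of "S (w i) *v _"] s[OF that])
      finally show "hdot x (upper (conj_transpose (S (w i)) *v in_lower (u i))) = hdot x (conj_transpose (s (w i)) *v u i)"
        by (simp add: conj_transpose_apply)
    qed
    define a where "a = kcoef {..<n} w (\<lambda>i. z i *s (conj_transpose (S (w i)) *v in_lower (u i)))"
    define b where "b = kcoef {..<n} w (\<lambda>i. z i *s (conj_transpose (s (w i)) *v u i))"
    have l: "l2 a" "l2 b" unfolding a_def b_def using w by (auto intro!: l2_kcoef)
    have "upper (a m) = b m" for m
      unfolding a_def b_def kcoef_def parts_sum by (intro sum.cong refl) (simp add: up)
    then have "(norm (b m))\<^sup>2 \<le> (norm (a m))\<^sup>2" for m using norm_parts[of "a m"] by simp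
    then have "(l2norm b)\<^sup>2 \<le> (l2norm a)\<^sup>2"
      unfolding l2norm_square[OF l(1)] l2norm_square[OF l(2)] using l by (intro suminf_le) (auto simp: l2_def)
    moreover have "l2norm (kcoef {..<n} w (\<lambda>i. z i *s in_lower (u i) :: complex^('p + 'q))) = l2norm (kcoef {..<n} w (\<lambda>i. z i *s u i))"
    proof -
      have "norm (kcoef {..<n} w (\<lambda>i. z i *s in_lower (u i) :: complex^('p + 'q)) m) = norm (kcoef {..<n} w (\<lambda>i. z i *s u i) m)" for m
      proof -
        have "(norm (kcoef {..<n} w (\<lambda>i. z i *s in_lower (u i) :: complex^('p + 'q)) m))\<^sup>2 = (norm (kcoef {..<n} w (\<lambda>i. z i *s u i) m))\<^sup>2"
          unfolding norm_parts by (simp add: kcoef_def parts_sum)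
        then show ?thesis by (simp add: power2_eq_iff_nonneg)
      qed
      then show ?thesis by (simp add: l2norm_def)
    qed
    ultimately show ?thesis using w by (simp add: qform_schur_kernel a_def b_def)
  qed
  from neg obtain y \<delta> where \<delta>: "\<delta> > 0" and
    y: "\<And>c. qform n (kentry (schur_kernel s) w u) (\<lambda>i. \<Sum>l<k. c l * y l i) \<le> - \<delta> * (\<Sum>l<k. (norm (c l))\<^sup>2)"
    unfolding neg_dim_ge_def by blast
  show ?thesis unfolding neg_dim_ge_def using \<delta> order_trans[OF le y] by blast
qed

section \<open>Nontangential limits\<close>

lemma open_stolz_region: "open (stolz_region \<alpha> \<mu>)"
proof -
  have "stolz_region \<alpha> \<mu> = \<bbbD> \<inter> {z. norm (z - \<mu>) < \<alpha> * (1 - norm z)}" by (auto simp: stolz_region_def)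
  moreover have "open {z. norm (z - \<mu>) < \<alpha> * (1 - norm z)}" by (intro open_Collect_less continuous_intros)
  ultimately show ?thesis by auto
qed

lemma radius_in_stolz_region:
  assumes "norm \<mu> = 1" "\<alpha> > 1"
  shows "filterlim (\<lambda>r. of_real r * \<mu>) (at \<mu> within stolz_region \<alpha> \<mu>) (at_left 1)"
  unfolding filterlim_at
proof
  have "((\<lambda>r. of_real r * \<mu>) \<longlongrightarrow> of_real 1 * \<mu>) (at_left 1)" by (intro tendsto_intros)
  then show "((\<lambda>r. of_real r * \<mu>) \<longlongrightarrow> \<mu>) (at_left 1)" by simp
  have "eventually (\<lambda>r. r \<in> {0<..<1}) (at_left (1::real))" by (intro eventually_at_left_real) simp
  then show "eventually (\<lambda>r. of_real r * \<mu> \<in> stolz_region \<alpha> \<mu> \<and> of_real r * \<mu> \<noteq> \<mu>) (at_left 1)"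
  proof eventually_elim
    case (elim r)
    then have n: "norm (of_real r * \<mu>) = r" using assms by (simp add: norm_mult)
    have "of_real r * \<mu> - \<mu> = of_real (r - 1) * \<mu>" by (simp add: algebra_simps)
    then have "norm (of_real r * \<mu> - \<mu>) = 1 - r" using assms elim by (simp only: norm_mult norm_of_real) simp
    moreover have "1 - r < \<alpha> * (1 - r)" using assms elim by simp
    moreover have "of_real r * \<mu> \<noteq> \<mu>" using n elim assms by (metis greaterThanLessThan_iff less_irrefl)
    ultimately show ?case using elim n by (simp add: stolz_region_def)
  qed
qed

lemma at_stolz_nontrivial:
  assumes "norm \<mu> = 1" "\<alpha> > 1"
  shows "at \<mu> within stolz_region \<alpha> \<mu> \<noteq> bot"
  using radius_in_stolz_region[OF assms] by (auto simp: filterlim_def filtermap_bot_iff bot.extremum_unique trivial_limit_at_left_real)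

lemma has_nt_limit_radial:
  assumes "has_nt_limit F \<mu> L" "norm \<mu> = 1"
  shows "((\<lambda>r. F (of_real r * \<mu>)) \<longlongrightarrow> L) (at_left 1)"
  by (rule filterlim_compose[OF assms(1)[unfolded has_nt_limit_def, rule_format, of 2] radius_in_stolz_region[OF assms(2)]]) simp_all

lemma has_nt_limit_unique:
  assumes "has_nt_limit F \<mu> L" "has_nt_limit F \<mu> L'" "norm \<mu> = 1"
  shows "L = (L' :: 'a::t2_space)"
proof (rule tendsto_unique)
  show "at \<mu> within stolz_region 2 \<mu> \<noteq> bot" by (rule at_stolz_nontrivial[OF assms(3)]) simp
  show "(F \<longlongrightarrow> L) (at \<mu> within stolz_region 2 \<mu>)" "(F \<longlongrightarrow> L') (at \<mu> within stolz_region 2 \<mu>)"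
    using assms(1,2) unfolding has_nt_limit_def by simp_all
qed

lemma nt_boundary_eq:
  assumes "has_nt_limit F \<mu> (L :: 'a::t2_space)" "norm \<mu> = 1"
  shows "nt_boundary F \<mu> = L"
  unfolding nt_boundary_def using assms has_nt_limit_unique by blast

lemma ae_circle_mono:
  assumes "ae_circle P" "\<And>\<mu>. norm \<mu> = 1 \<Longrightarrow> P \<mu> \<Longrightarrow> Q \<mu>"
  shows "ae_circle Q"
  using assms(1) unfolding ae_circle_def by eventually_elim (use assms(2) in simp)

lemma ae_circle_conj:
  assumes "ae_circle P" "ae_circle Q"
  shows "ae_circle (\<lambda>\<mu>. P \<mu> \<and> Q \<mu>)"
  using assms unfolding ae_circle_def by eventually_elim simp

lemma ae_circle_all_less:
  assumes "\<And>l. l < (k::nat) \<Longrightarrow> ae_circle (P l)"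
  shows "ae_circle (\<lambda>\<mu>. \<forall>l<k. P l \<mu>)"
proof -
  have "AE t in lebesgue_on {0..2*pi}. \<forall>l\<in>{..<k}. P l (cis t)"
    by (rule AE_finite_allI) (use assms in \<open>auto simp: ae_circle_def\<close>)
  then show ?thesis unfolding ae_circle_def by eventually_elim simp
qed

lemma ae_circle_ex:
  assumes "ae_circle P"
  shows "\<exists>\<mu>. norm \<mu> = 1 \<and> P \<mu>"
proof (rule ccontr)
  assume "\<not> ?thesis"
  then have "AE t in lebesgue_on {0..2*pi}. False"
    using assms unfolding ae_circle_def by (auto elim!: eventually_mono)
  then have "emeasure (lebesgue_on {0..2*pi}) (space (lebesgue_on {0..2*pi})) = 0"
    by (simp only: trivial_limit_def[symmetric] ae_filter_eq_bot_iff)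
  moreover have "emeasure (lebesgue_on {0..2*pi}) (space (lebesgue_on {0..2*pi})) = ennreal (2 * pi)"
    by (subst emeasure_restrict_space) auto
  ultimately show False by simp
qed

lemma tendsto_matrix_vector:
  fixes A :: "complex^'c^'r"
  assumes "(F \<longlongrightarrow> A) net" "(x \<longlongrightarrow> v) net"
  shows "((\<lambda>z. F z *v x z) \<longlongrightarrow> A *v v) net"
  unfolding matrix_vector_mult_def by (intro tendsto_intros assms)

lemma tendsto_cmult_vec:
  fixes v :: "complex^'c"
  assumes "(f \<longlongrightarrow> c) net" "(x \<longlongrightarrow> v) net"
  shows "((\<lambda>z. f z *s x z) \<longlongrightarrow> c *s v) net"
  unfolding vector_scalar_mult_def by (intro tendsto_intros assms)

lemma tendsto_parts:
  fixes v :: "complex^('p::finite + 'q::finite)"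
  assumes "(x \<longlongrightarrow> v) net"
  shows "((\<lambda>z. upper (x z)) \<longlongrightarrow> upper v) net" "((\<lambda>z. lower (x z)) \<longlongrightarrow> lower v) net"
  unfolding upper_def lower_def by (intro tendsto_intros assms)+

lemma tendsto_in_parts:
  shows "(x \<longlongrightarrow> v) net \<Longrightarrow> ((\<lambda>z. in_upper (x z) :: complex^('p::finite + 'q::finite)) \<longlongrightarrow> in_upper v) net"
    "(y \<longlongrightarrow> u) net \<Longrightarrow> ((\<lambda>z. in_lower (y z) :: complex^('p::finite + 'q::finite)) \<longlongrightarrow> in_lower u) net"
  unfolding in_upper_def in_lower_def
  by (rule tendsto_vec_lambda, auto split: sum.split intro!: tendsto_intros)+

lemma tendsto_det:
  fixes A :: "complex^'n^'n"
  assumes "(F \<longlongrightarrow> A) net"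
  shows "((\<lambda>z. Determinants.det (F z)) \<longlongrightarrow> Determinants.det A) net"
  unfolding Determinants.det_def by (intro tendsto_intros assms)

lemma tendsto_pgCD:
  fixes A :: "complex^('p::finite + 'q::finite)^('p + 'q)"
  assumes "(F \<longlongrightarrow> A) net"
  shows "((\<lambda>z. pgC (F z)) \<longlongrightarrow> pgC A) net" "((\<lambda>z. pgD (F z)) \<longlongrightarrow> pgD A) net"
  unfolding pgC_def pgD_def matrix_matrix_mult_def by (intro tendsto_intros assms)+

text \<open>
  By Cramer's rule the solution depends continuously on the matrix and the right-hand side.
\<close>

lemma tendsto_linear_solution:
  fixes A :: "complex^'n^'n"
  assumes F: "(F \<longlongrightarrow> A) net" and b: "(b \<longlongrightarrow> v) net" and A: "Determinants.det A \<noteq> 0"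
    and eq: "eventually (\<lambda>z. F z *v x z = b z) net"
  shows "\<exists>x0. (x \<longlongrightarrow> x0) net \<and> A *v x0 = v"
proof -
  define S where "S M c = (\<chi> k. Determinants.det (\<chi> i j. if j = k then c $ i else M $ i $ j) / Determinants.det M)"
    for M :: "complex^'n^'n" and c :: "complex^'n"
  have S: "M *v y = c \<longleftrightarrow> y = S M c" if "Determinants.det M \<noteq> 0" for M y c
    unfolding S_def by (rule cramer[OF that])
  have lim: "((\<lambda>z. \<chi> i j. if j = k then b z $ i else F z $ i $ j) \<longlongrightarrow> (\<chi> i j. if j = k then v $ i else A $ i $ j)) net" for k
  proof (intro tendsto_vec_lambda)
    fix i j show "((\<lambda>z. if j = k then b z $ i else F z $ i $ j) \<longlongrightarrow> (if j = k then v $ i else A $ i $ j)) net"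
      by (cases "j = k") (auto intro!: tendsto_intros F b)
  qed
  have "((\<lambda>z. S (F z) (b z)) \<longlongrightarrow> S A v) net"
    unfolding S_def by (intro tendsto_vec_lambda tendsto_divide tendsto_det lim F A)
  moreover have "eventually (\<lambda>z. Determinants.det (F z) \<noteq> 0) net"
    using tendsto_det[OF F] A by (rule tendsto_imp_eventually_ne)
  then have "eventually (\<lambda>z. S (F z) (b z) = x z) net"
    using eq by eventually_elim (use S in metis)
  ultimately have "(x \<longlongrightarrow> S A v) net" by (rule Lim_transform_eventually)
  then show ?thesis using S[OF A] by blast
qed

section \<open>Domains of holomorphy and choice of points\<close>

lemma holomorphy_domain_facts:
  fixes F :: "complex \<Rightarrow> complex^'c^'r"
  assumes "mvf_meromorphic F"
  shows "open (holomorphy_domain F)" "(\<bbbD> - holomorphy_domain F) sparse_in \<bbbD>"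
    "\<And>i j. (\<lambda>z. mvf_reg F z $ i $ j) holomorphic_on holomorphy_domain F"
    "\<And>z. z \<in> \<bbbD> \<Longrightarrow> eventually (\<lambda>w. mvf_reg F w = F w) (at z)"
    "\<And>i j. (\<lambda>z. mvf_reg F z $ i $ j) meromorphic_on \<bbbD>"
proof -
  have mero: "(\<lambda>z. F z $ i $ j) meromorphic_on \<bbbD>" for i j using assms by (simp add: mvf_meromorphic_def)
  have "eventually (\<lambda>z. \<forall>i j. \<not> is_pole (\<lambda>w. F w $ i $ j) z) (cosparse \<bbbD>)"
    by (intro eventually_all_finite meromorphic_on_imp_not_pole_cosparse mero)
  then have sp: "{z. \<not> (\<forall>i j. \<not> is_pole (\<lambda>w. F w $ i $ j) z)} sparse_in \<bbbD>" (is "?P sparse_in _") by (simp add: eventually_cosparse)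
  have hd: "holomorphy_domain F = \<bbbD> - ?P" by (auto simp: holomorphy_domain_def)
  show op: "open (holomorphy_domain F)" unfolding hd by (intro open_diff_sparse_pts sp) simp
  show "(\<bbbD> - holomorphy_domain F) sparse_in \<bbbD>" by (rule sparse_in_subset2[OF sp]) (auto simp: hd)
  have iso: "isolated_singularity_at (\<lambda>w. F w $ i $ j) z" "not_essential (\<lambda>w. F w $ i $ j) z" if "z \<in> \<bbbD>" for i j z
    using that mero meromorphic_on_isolated_singularity meromorphic_on_not_essential meromorphic_on_subset[OF mero, of "{z}"]
    by auto
  show "(\<lambda>z. mvf_reg F z $ i $ j) meromorphic_on \<bbbD>" for i j
    unfolding mvf_reg_def using remove_sings_meromorphic[OF mero[of i j]] by simp
  show "eventually (\<lambda>w. mvf_reg F w = F w) (at z)" if "z \<in> \<bbbD>" for z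
  proof -
    have "eventually (\<lambda>w. \<forall>i j. remove_sings (\<lambda>w. F w $ i $ j) w = F w $ i $ j) (at z)"
      by (intro eventually_all_finite eventually_remove_sings_eq_at iso that)
    then show ?thesis by eventually_elim (simp add: mvf_reg_def vec_eq_iff)
  qed
  show "(\<lambda>z. mvf_reg F z $ i $ j) holomorphic_on holomorphy_domain F" for i j
  proof -
    have "(\<lambda>z. mvf_reg F z $ i $ j) analytic_on {z}" if "z \<in> holomorphy_domain F" for z
    proof -
      have z: "z \<in> \<bbbD>" "\<not> is_pole (\<lambda>w. F w $ i $ j) z" using that by (auto simp: holomorphy_domain_def)
      then obtain c where "(\<lambda>w. F w $ i $ j) \<midarrow>z\<rightarrow> c" using iso(2)[OF z(1), of i j] by (auto simp: not_essential_def)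
      from remove_sings_analytic_at[OF iso(1)[OF z(1)] this] show ?thesis by (simp add: mvf_reg_def)
    qed
    then show ?thesis using analytic_on_analytic_at analytic_imp_holomorphic by blast
  qed
qed

text \<open>
  The region is open, so a pole inside it would make the function unbounded along the region arbitrarily close to that pole.
\<close>

lemma nt_limit_in_holomorphy_domain:
  fixes F :: "complex \<Rightarrow> complex^'c^'r"
  assumes F: "mvf_meromorphic F" and \<mu>: "norm \<mu> = 1"
    and lim: "(mvf_reg F \<longlongrightarrow> L) (at \<mu> within stolz_region \<alpha> \<mu>)"
  shows "eventually (\<lambda>z. z \<in> holomorphy_domain F) (at \<mu> within stolz_region \<alpha> \<mu>)"
proof -
  have "eventually (\<lambda>z. dist (mvf_reg F z) L < 1) (at \<mu> within stolz_region \<alpha> \<mu>)" using lim by (rule tendstoD) simp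
  then obtain d where d: "d > 0" "\<And>z. z \<in> stolz_region \<alpha> \<mu> \<Longrightarrow> z \<noteq> \<mu> \<Longrightarrow> dist z \<mu> < d \<Longrightarrow> dist (mvf_reg F z) L < 1"
    unfolding eventually_at by blast
  have notmu: "w \<noteq> \<mu>" if "w \<in> stolz_region \<alpha> \<mu>" for w using that \<mu> by (auto simp: stolz_region_def)
  have "z \<in> holomorphy_domain F" if z: "z \<in> stolz_region \<alpha> \<mu>" "dist z \<mu> < d" for z
  proof (rule ccontr)
    assume "z \<notin> holomorphy_domain F"
    moreover have zD: "z \<in> \<bbbD>" using z by (simp add: stolz_region_def)
    ultimately obtain i j where pole: "is_pole (\<lambda>w. F w $ i $ j) z" by (auto simp: holomorphy_domain_def)
    have "filterlim (\<lambda>w. norm (F w $ i $ j)) at_top (at z)"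
      using pole unfolding is_pole_def by (rule filterlim_at_infinity_imp_norm_at_top)
    then have "eventually (\<lambda>w. norm (F w $ i $ j) \<ge> norm L + 2) (at z)" by (simp add: filterlim_at_top)
    moreover have "open (stolz_region \<alpha> \<mu> \<inter> ball \<mu> d)" by (intro open_Int open_stolz_region open_ball)
    then have "eventually (\<lambda>w. w \<in> stolz_region \<alpha> \<mu> \<inter> ball \<mu> d) (at z)"
      using z by (intro eventually_at_in_open') (auto simp: dist_commute)
    moreover note holomorphy_domain_facts(4)[OF F zD]
    ultimately have "eventually (\<lambda>w. False) (at z)"
    proof eventually_elim
      case (elim w)
      have "norm (F w $ i $ j) \<le> norm (F w)"
        by (rule order_trans[OF Finite_Cartesian_Product.norm_nth_le Finite_Cartesian_Product.norm_nth_le])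
      also have "\<dots> \<le> norm L + dist (mvf_reg F w) L"
        using elim(3) norm_triangle_sub[of "F w" L] by (simp add: dist_norm)
      also have "\<dots> < norm L + 2" using d(2)[of w] notmu[of w] elim(2) by (auto simp: dist_commute)
      finally show ?case using elim(1) by simp
    qed
    then show False by simp
  qed
  then show ?thesis unfolding eventually_at using d(1) by blast
qed

lemma tendsto_matrix_mult:
  fixes A :: "complex^'b^'a" and B :: "complex^'c^'b"
  assumes "(F \<longlongrightarrow> A) net" "(G \<longlongrightarrow> B) net"
  shows "((\<lambda>z. F z ** G z) \<longlongrightarrow> A ** B) net"
  unfolding matrix_matrix_mult_def by (intro tendsto_intros assms)

lemma tendsto_conj_transpose:
  fixes A :: "complex^'b^'a"
  assumes "(F \<longlongrightarrow> A) net"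
  shows "((\<lambda>z. conj_transpose (F z)) \<longlongrightarrow> conj_transpose A) net"
  unfolding conj_transpose_def by (intro tendsto_intros assms)

lemma tendsto_hdot:
  fixes v :: "complex^'b"
  assumes "(x \<longlongrightarrow> v) net"
  shows "((\<lambda>z. hdot u (x z)) \<longlongrightarrow> hdot u v) net"
  unfolding hdot_def by (intro tendsto_intros assms)

text \<open>
  The points of \<open>\<Omega>\<close> are dense in the disc and the Gram matrix depends continuously on the points, so
  \<open>neg_dim_ge_stable\<close> applies.
\<close>

lemma neg_dim_ge_perturb_points:
  fixes F :: "complex \<Rightarrow> complex^'c^'r"
  assumes neg: "neg_dim_ge k n (kentry (mvf_kernel J J' F) w u)"
    and w: "\<And>i. i < n \<Longrightarrow> w i \<in> H" and H: "H \<subseteq> \<bbbD>" "open H"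
    and F: "\<And>i j. (\<lambda>z. F z $ i $ j) holomorphic_on H"
    and \<Omega>: "(\<bbbD> - \<Omega>) sparse_in \<bbbD>"
  shows "\<exists>w'. (\<forall>i<n. w' i \<in> \<Omega>) \<and> neg_dim_ge k n (kentry (mvf_kernel J J' F) w' u)"
proof -
  obtain \<epsilon> where \<epsilon>: "\<epsilon> > 0" and stable:
    "\<And>G'. (\<forall>i<n. \<forall>j<n. norm (G' i j - kentry (mvf_kernel J J' F) w u i j) < \<epsilon>) \<Longrightarrow> neg_dim_ge k n G'"
    using neg_dim_ge_stable[OF neg] by blast
  have "\<exists>x. (\<forall>m. x m \<in> \<Omega>) \<and> x \<longlonglongrightarrow> z" if z: "z \<in> \<bbbD>" for z
  proof -
    have "\<exists>y. y \<in> \<Omega> \<and> dist y z < inverse (real (Suc m))" for m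
    proof -
      have "eventually (\<lambda>y. y \<notin> \<bbbD> - \<Omega>) (at z)" using \<Omega> z sparse_in_eventually_iff[of \<bbbD> "\<bbbD> - \<Omega>"] by blast
      moreover have "eventually (\<lambda>y. y \<in> \<bbbD> \<inter> ball z (inverse (real (Suc m)))) (at z)"
        using z by (intro eventually_at_in_open') auto
      ultimately have "eventually (\<lambda>y. y \<in> \<Omega> \<and> dist y z < inverse (real (Suc m))) (at z)"
        by eventually_elim (auto simp: dist_commute)
      then show ?thesis using eventually_happens'[OF at_neq_bot] by blast
    qed
    then obtain x where x: "\<And>m. x m \<in> \<Omega>" "\<And>m. dist (x m) z < inverse (real (Suc m))" by metis
    have "(\<lambda>m. dist (x m) z) \<longlonglongrightarrow> 0"
      by (rule tendsto_sandwich[OF _ _ tendsto_const LIMSEQ_inverse_real_of_nat])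
         (use x in \<open>auto intro!: always_eventually less_imp_le simp del: of_nat_Suc\<close>)
    then have "x \<longlonglongrightarrow> z" by (rule iffD2[OF tendsto_dist_iff])
    then show ?thesis using x by blast
  qed
  then have "\<forall>i. \<exists>x. i < n \<longrightarrow> (\<forall>m. x m \<in> \<Omega>) \<and> x \<longlonglongrightarrow> w i" using w H by blast
  then obtain x where x: "\<And>i m. i < n \<Longrightarrow> x i m \<in> \<Omega>" "\<And>i. i < n \<Longrightarrow> x i \<longlonglongrightarrow> w i" by metis
  have lF: "(\<lambda>m. F (x i m) $ a $ b) \<longlonglongrightarrow> F (w i) $ a $ b" if "i < n" for i a b
  proof -
    have "isCont (\<lambda>z. F z $ a $ b) (w i)"
      using F[of a b] w[OF that] H holomorphic_on_imp_continuous_on continuous_on_eq_continuous_at by blast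
    then show ?thesis using x(2)[OF that] by (rule isCont_tendsto_compose)
  qed
  have lFv: "(\<lambda>m. F (x i m)) \<longlonglongrightarrow> F (w i)" if "i < n" for i
    by (rule vec_tendstoI, rule vec_tendstoI, rule lF[OF that])
  have lk: "(\<lambda>m. kentry (mvf_kernel J J' F) (\<lambda>i. x i m) u i j) \<longlonglongrightarrow> kentry (mvf_kernel J J' F) w u i j" if ij: "i < n" "j < n" for i j
  proof -
    have "norm (w i * cnj (w j)) < 1"
    proof -
      have "norm (w i) < 1" "norm (w j) < 1" using w[OF ij(1)] w[OF ij(2)] H by auto
      then show ?thesis by (simp add: norm_mult) (metis mult_strict_mono' norm_ge_zero mult_1)
    qed
    then have "1 - w i * cnj (w j) \<noteq> 0" by auto
    then show ?thesis
      unfolding kentry_def mvf_kernel_def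
      by (intro tendsto_hdot tendsto_matrix_vector tendsto_vec_lambda tendsto_divide tendsto_vec_nth tendsto_diff
          tendsto_mult tendsto_cnj tendsto_const tendsto_matrix_mult tendsto_conj_transpose lFv x ij)
  qed
  have "eventually (\<lambda>m. \<forall>i\<in>{..<n}. \<forall>j\<in>{..<n}. norm (kentry (mvf_kernel J J' F) (\<lambda>i. x i m) u i j - kentry (mvf_kernel J J' F) w u i j) < \<epsilon>) sequentially"
    using tendstoD[OF lk \<epsilon>] by (intro eventually_ball_finite ballI) (auto simp: dist_norm)
  then obtain m where "\<forall>i\<in>{..<n}. \<forall>j\<in>{..<n}. norm (kentry (mvf_kernel J J' F) (\<lambda>i. x i m) u i j - kentry (mvf_kernel J J' F) w u i j) < \<epsilon>"
    using eventually_happens by force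
  then have "neg_dim_ge k n (kentry (mvf_kernel J J' F) (\<lambda>i. x i m) u)" by (intro stable) auto
  then show ?thesis using x(1) by (intro exI[of _ "\<lambda>i. x i m"]) auto
qed

section \<open>Operations on the Hardy space\<close>

lemma hardy_disc_add: "f \<in> hardy_disc \<Longrightarrow> g \<in> hardy_disc \<Longrightarrow> (\<lambda>z. f z + g z) \<in> hardy_disc"
  by (simp add: hardy_disc_iff hcoef_add l2_add)

lemma hardy_disc_cmult: "f \<in> hardy_disc \<Longrightarrow> (\<lambda>z. c *s f z) \<in> hardy_disc"
  by (simp add: hardy_disc_iff hcoef_cmult l2_cmult)

lemma hardy_disc_sum:
  assumes "\<And>i. i \<in> I \<Longrightarrow> f i \<in> hardy_disc"
  shows "(\<lambda>z. \<Sum>i\<in>I. c i *s f i z) \<in> hardy_disc"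
proof -
  have "hol (f i)" "l2 (hcoef (f i))" if "i \<in> I" for i using assms[OF that] by (auto simp: hardy_disc_iff)
  then show ?thesis using hcoef_sum[of I f c] by (auto simp: hardy_disc_iff intro!: l2_sum l2_cmult)
qed

lemma hardy_disc_diff: "f \<in> hardy_disc \<Longrightarrow> g \<in> hardy_disc \<Longrightarrow> (\<lambda>z. f z - g z) \<in> hardy_disc"
  using hardy_disc_add[of f "\<lambda>z. (-1) *s g z"] hardy_disc_cmult[of g "-1"] by simp

lemma hardy_disc_shift:
  assumes "f \<in> hardy_disc"
  shows "(\<lambda>z. z ^ k *s f z) \<in> hardy_disc"
proof -
  have f: "hol f" "l2 (hcoef f)" using assms by (auto simp: hardy_disc_iff)
  have "summable (\<lambda>n. (norm (if n + k < k then 0 else hcoef f (n + k - k)))\<^sup>2)" using f(2) by (simp add: l2_def)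
  then have "l2 (\<lambda>n. if n < k then 0 else hcoef f (n - k))"
    unfolding l2_def by (subst (asm) summable_iff_shift)
  then show ?thesis using hcoef_shift[OF f(1), of k] by (simp add: hardy_disc_iff)
qed

lemma hardy_disc_polynomial: "(\<lambda>z. \<Sum>n<N. z ^ n *s b n) \<in> hardy_disc"
proof -
  have "l2 (\<lambda>n. if n < N then b n else 0)"
    unfolding l2_def by (rule summable_finite[of "{..<N}"]) auto
  then show ?thesis using hcoef_polynomial[where N = N and a = b] by (simp add: hardy_disc_iff)
qed

lemma hardy_disc_parts:
  fixes f :: "complex \<Rightarrow> complex^('p::finite + 'q::finite)"
  assumes "f \<in> hardy_disc"
  shows "(\<lambda>z. upper (f z)) \<in> hardy_disc" "(\<lambda>z. lower (f z)) \<in> hardy_disc"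
proof -
  have f: "hol f" "l2 (hcoef f)" using assms by (auto simp: hardy_disc_iff)
  have u: "(\<lambda>n. upper (hcoef f n) $ i * z ^ n) sums (upper (f z) $ i)" if "norm z < 1" for i z
    using hcoef_sums[OF f(1) that, of "Inl i"] by (simp add: upper_def)
  have l: "(\<lambda>n. lower (hcoef f n) $ i * z ^ n) sums (lower (f z) $ i)" if "norm z < 1" for i z
    using hcoef_sums[OF f(1) that, of "Inr i"] by (simp add: lower_def)
  have "l2 (\<lambda>n. upper (hcoef f n))" "l2 (\<lambda>n. lower (hcoef f n))"
    unfolding l2_def by (rule summable_comparison_test'[OF f(2)[unfolded l2_def], of 0], simp add: norm_parts)+
  then show "(\<lambda>z. upper (f z)) \<in> hardy_disc" "(\<lambda>z. lower (f z)) \<in> hardy_disc"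
    using hcoef_unique[where a = "\<lambda>n. upper (hcoef f n)" and f = "\<lambda>z. upper (f z)", OF u]
      hcoef_unique[where a = "\<lambda>n. lower (hcoef f n)" and f = "\<lambda>z. lower (f z)", OF l]
    by (auto simp: hardy_disc_iff)
qed

lemma hardy_disc_combine:
  fixes x :: "complex \<Rightarrow> complex^'p" and y :: "complex \<Rightarrow> complex^'q"
  assumes "x \<in> hardy_disc" "y \<in> hardy_disc"
  shows "(\<lambda>z. in_upper (x z) + in_lower (y z)) \<in> hardy_disc"
proof -
  have f: "hol x" "l2 (hcoef x)" "hol y" "l2 (hcoef y)" using assms by (auto simp: hardy_disc_iff)
  have u: "(\<lambda>n. (in_upper (hcoef x n) + in_lower (hcoef y n)) $ i * z ^ n) sums ((in_upper (x z) + in_lower (y z)) $ i)" if "norm z < 1" for i z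
    using hcoef_sums[OF f(1) that] hcoef_sums[OF f(3) that] by (cases i) (auto simp: in_upper_def in_lower_def)
  have "l2 (\<lambda>n. in_upper (hcoef x n) + in_lower (hcoef y n))"
    using f unfolding l2_def norm_parts by (simp add: summable_add)
  then show ?thesis
    using hcoef_unique[where a = "\<lambda>n. in_upper (hcoef x n) + in_lower (hcoef y n)" and f = "\<lambda>z. in_upper (x z) + in_lower (y z)", OF u]
    by (auto simp: hardy_disc_iff)
qed

lemma hardy_radial_limits:
  assumes "ae_circle (\<lambda>\<mu>. has_nt_limit f \<mu> (g \<mu>))"
  shows "AE t in lebesgue_on {0..2*pi}. ((\<lambda>r. f (of_real r * cis t)) \<longlongrightarrow> g (cis t)) (at_left 1)"
  using assms unfolding ae_circle_def by eventually_elim (rule has_nt_limit_radial, auto)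

lemma hardy_boundary_zero:
  assumes f: "f \<in> hardy_disc" and z: "ae_circle (\<lambda>\<mu>. has_nt_limit f \<mu> 0)" and w: "w \<in> \<bbbD>"
  shows "f w = 0"
proof -
  have h: "hol f" "l2 (hcoef f)" using f by (auto simp: hardy_disc_iff)
  have "ennreal (2 * pi * (l2norm (hcoef f))\<^sup>2) \<le> 0"
    using hardy_norm_le_boundary[OF f hardy_radial_limits[OF z]] by simp
  then have "2 * pi * (l2norm (hcoef f))\<^sup>2 \<le> 0" by (simp add: ennreal_eq_0_iff)
  then have "(\<Sum>n. (norm (hcoef f n))\<^sup>2) = 0"
    unfolding l2norm_square[OF h(2), symmetric] using pi_gt_zero by (auto simp: mult_le_0_iff)
  then have "\<forall>n. (norm (hcoef f n))\<^sup>2 = 0"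
    using h(2) by (subst (asm) suminf_eq_zero_iff) (auto simp: l2_def)
  then have 0: "hcoef f n = 0" for n by simp
  have "f w $ i = 0" for i
    using hcoef_sums[OF h(1), of w i] w by (simp add: 0 sums_iff)
  then show ?thesis by (simp add: vec_eq_iff)
qed

lemma hardy_norm_le_polynomial:
  fixes b :: "nat \<Rightarrow> complex^'k" and k :: "complex \<Rightarrow> complex^'m"
  assumes k: "k \<in> hardy_disc"
    and bd: "ae_circle (\<lambda>\<mu>. \<exists>v. has_nt_limit k \<mu> v \<and> norm v = norm (\<Sum>n<L. \<mu> ^ n *s b n))"
  shows "(l2norm (hcoef k))\<^sup>2 \<le> (\<Sum>n<L. (norm (b n))\<^sup>2)"
proof -
  define p where "p t = (\<Sum>n<L. cis t ^ n *s b n)" for t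
  define b' where "b' n = (if n < L then b n else 0)" for n
  have bd': "ae_circle (\<lambda>\<mu>. has_nt_limit k \<mu> (nt_boundary k \<mu>) \<and> norm (nt_boundary k \<mu>) = norm (\<Sum>n<L. \<mu> ^ n *s b n))"
    by (rule ae_circle_mono[OF bd]) (auto simp: nt_boundary_eq)
  have sm: "summable (\<lambda>n. norm (b' n))" by (rule summable_finite[of "{..<L}"]) (auto simp: b'_def)
  have comp: "p t $ i = (\<Sum>n. b' n $ i * cis (of_nat n * t))" for t i
  proof -
    have "(\<Sum>n. b' n $ i * cis (of_nat n * t)) = (\<Sum>n<L. b' n $ i * cis (of_nat n * t))"
      by (rule suminf_finite) (auto simp: b'_def)
    also have "\<dots> = p t $ i"
      unfolding p_def sum_component by (intro sum.cong refl) (simp add: b'_def Complex.DeMoivre)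
    finally show ?thesis by simp
  qed
  note P = parseval_vec[OF sm comp]
  have "ennreal (2 * pi * (l2norm (hcoef k))\<^sup>2) \<le> (\<integral>\<^sup>+ t. ennreal ((norm (nt_boundary k (cis t)))\<^sup>2) \<partial>lebesgue_on {0..2*pi})"
    by (rule hardy_norm_le_boundary[OF k hardy_radial_limits]) (rule ae_circle_mono[OF bd'], simp)
  also have "\<dots> = (\<integral>\<^sup>+ t. ennreal ((norm (p t))\<^sup>2) \<partial>lebesgue_on {0..2*pi})"
  proof (rule nn_integral_cong_AE)
    have "AE t in lebesgue_on {0..2*pi}. has_nt_limit k (cis t) (nt_boundary k (cis t)) \<and> norm (nt_boundary k (cis t)) = norm (\<Sum>n<L. cis t ^ n *s b n)"
      using bd' unfolding ae_circle_def .
    then show "AE t in lebesgue_on {0..2*pi}. ennreal ((norm (nt_boundary k (cis t)))\<^sup>2) = ennreal ((norm (p t))\<^sup>2)"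
      by eventually_elim (simp add: p_def)
  qed
  also have "\<dots> = ennreal (2 * pi * (l2norm b')\<^sup>2)"
    by (rule nn_integral_circle_continuous[OF _ _ P(1)]) (intro continuous_intros P(3), simp)
  finally have "(l2norm (hcoef k))\<^sup>2 \<le> (l2norm b')\<^sup>2" by (simp add: ennreal_le_iff)
  also have "\<dots> = (\<Sum>n<L. (norm (b n))\<^sup>2)"
    unfolding l2norm_square[OF P(2)] by (subst suminf_finite[of "{..<L}"]) (auto simp: b'_def)
  finally show ?thesis .
qed

section \<open>The transform of a function of class U\<close>

definition pg_domain :: "(complex \<Rightarrow> complex^('p::finite + 'q::finite)^('p + 'q)) \<Rightarrow> complex set" where
  "pg_domain W = {z \<in> holomorphy_domain W. Determinants.det (pgC (mvf_reg W z)) \<noteq> 0}"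

definition good_boundary_point :: "(complex \<Rightarrow> complex^('p::finite + 'q::finite)^('p + 'q)) \<Rightarrow> complex \<Rightarrow> bool" where
  "good_boundary_point W \<mu> \<longleftrightarrow> has_nt_limit (mvf_reg W) \<mu> (nt_boundary (mvf_reg W) \<mu>) \<and>
     nt_boundary (mvf_reg W) \<mu> ** j_pq ** conj_transpose (nt_boundary (mvf_reg W) \<mu>) = j_pq \<and>
     Determinants.det (pgC (nt_boundary (mvf_reg W) \<mu>)) \<noteq> 0 \<and>
     (\<forall>\<alpha>>1. eventually (\<lambda>z. z \<in> pg_domain W) (at \<mu> within stolz_region \<alpha> \<mu>))"

lemma U_class_boundary:
  assumes "W \<in> U_class \<kappa>"
  shows "ae_circle (good_boundary_point W)"
proof -
  have mero: "mvf_meromorphic W" and bd: "ae_circle (\<lambda>\<mu>. \<exists>L. has_nt_limit (mvf_reg W) \<mu> L \<and> L ** j_pq ** conj_transpose L = j_pq)"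
    using assms by (auto simp: U_class_def)
  show ?thesis
  proof (rule ae_circle_mono[OF bd])
    fix \<mu> :: complex assume \<mu>: "norm \<mu> = 1" and "\<exists>L. has_nt_limit (mvf_reg W) \<mu> L \<and> L ** j_pq ** conj_transpose L = j_pq"
    then obtain L where L: "has_nt_limit (mvf_reg W) \<mu> L" "L ** j_pq ** conj_transpose L = j_pq" by blast
    have eq: "nt_boundary (mvf_reg W) \<mu> = L" by (rule nt_boundary_eq[OF L(1) \<mu>])
    have d: "Determinants.det (pgC L) \<noteq> 0" by (rule pgC_invertible_if_j_unitary[OF L(2)])
    have "eventually (\<lambda>z. z \<in> pg_domain W) (at \<mu> within stolz_region \<alpha> \<mu>)" if "\<alpha> > 1" for \<alpha>
    proof -
      have lim: "(mvf_reg W \<longlongrightarrow> L) (at \<mu> within stolz_region \<alpha> \<mu>)" using L(1) that by (simp add: has_nt_limit_def)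
      have "eventually (\<lambda>z. Determinants.det (pgC (mvf_reg W z)) \<noteq> 0) (at \<mu> within stolz_region \<alpha> \<mu>)"
        by (rule tendsto_imp_eventually_ne[OF tendsto_det[OF tendsto_pgCD(1)[OF lim]] d])
      then show ?thesis using nt_limit_in_holomorphy_domain[OF mero \<mu> lim]
        by eventually_elim (simp add: pg_domain_def)
    qed
    then show "good_boundary_point W \<mu>" unfolding good_boundary_point_def eq using L d by blast
  qed
qed

lemma matrix_axis: "(M *v axis j 1) $ a = M $ a $ j" for M :: "complex^'n^'m"
proof -
  have "(\<Sum>k\<in>UNIV. M $ a $ k * axis j 1 $ k) = (\<Sum>k\<in>UNIV. if k = j then M $ a $ k else 0)"
    by (intro sum.cong) (auto simp: axis_def)
  then show ?thesis by (simp add: matrix_vector_mult_def)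
qed

text \<open>
  Cramer's rule.
\<close>

lemma pgS_entry:
  fixes A :: "complex^('p::finite + 'q::finite)^('p + 'q)"
  assumes "Determinants.det (pgC A) \<noteq> 0"
  shows "pgS A $ i $ j = Determinants.det (\<chi> a b. if b = i then pgD A $ a $ j else pgC A $ a $ b) / Determinants.det (pgC A)"
proof -
  have "pgC A *v (pgS A *v axis j 1) = pgD A *v axis j 1" by (rule iffD1[OF pgS_iff[OF assms] refl])
  then have "pgS A *v axis j 1 = (\<chi> k. Determinants.det (\<chi> a b. if b = k then (pgD A *v axis j 1) $ a else pgC A $ a $ b) / Determinants.det (pgC A))"
    by (simp only: cramer[OF assms])
  then have "(pgS A *v axis j 1) $ i = Determinants.det (\<chi> a b. if b = i then (pgD A *v axis j 1) $ a else pgC A $ a $ b) / Determinants.det (pgC A)"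
    by simp
  then show ?thesis unfolding matrix_axis .
qed

text \<open>
  The determinant of \<open>pgC\<close> does not vanish identically, since its limit at a good boundary point is not zero.
  It is the denominator in Cramer's rule for the entries of the transform, of which \<open>s\<^sub>2\<^sub>1\<close> is a block.
\<close>

lemma pg_domain_facts:
  fixes W :: "complex \<Rightarrow> complex^('p::finite + 'q::finite)^('p + 'q)"
  assumes W: "W \<in> U_class \<kappa>"
  shows "open (pg_domain W)" "pg_domain W \<subseteq> \<bbbD>" "(\<bbbD> - pg_domain W) sparse_in \<bbbD>"
    "\<And>i j. (\<lambda>z. pgS (mvf_reg W z) $ i $ j) holomorphic_on pg_domain W"
    "\<And>i j. (\<lambda>z. s21 (mvf_reg W) z $ i $ j) holomorphic_on pg_domain W"
    "mvf_meromorphic (s21 W)" "pg_domain W \<subseteq> holomorphy_domain (s21 W)"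
    "\<And>z. z \<in> pg_domain W \<Longrightarrow> mvf_reg (s21 W) z = s21 (mvf_reg W) z"
proof -
  let ?R = "mvf_reg W"
  have mero: "mvf_meromorphic W" using W by (auto simp: U_class_def)
  note hd = holomorphy_domain_facts[OF mero]
  define d where "d z = Determinants.det (pgC (?R z))" for z
  have mC: "(\<lambda>z. pgC (?R z) $ a $ b) meromorphic_on \<bbbD>" "(\<lambda>z. pgD (?R z) $ a $ b) meromorphic_on \<bbbD>" for a b
    unfolding pgC_def pgD_def matrix_matrix_mult_def by (simp; intro meromorphic_intros hd(5))+
  have mdet: "(\<lambda>z. Determinants.det (M z)) meromorphic_on \<bbbD>"
    if "\<And>a b. (\<lambda>z. M z $ a $ b) meromorphic_on \<bbbD>" for M :: "complex \<Rightarrow> complex^('p + 'q)^('p + 'q)"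
    unfolding Determinants.det_def by (intro meromorphic_intros that)
  have md: "d meromorphic_on \<bbbD>" unfolding d_def using mdet[of "\<lambda>z. pgC (?R z)"] mC(1) by blast
  have "eventually (\<lambda>z. d z = 0) (cosparse \<bbbD>) \<or> eventually (\<lambda>z. d z \<noteq> 0) (cosparse \<bbbD>)"
    by (rule meromorphic_imp_constant_or_avoid[OF md]) auto
  moreover have "\<not> eventually (\<lambda>z. d z = 0) (cosparse \<bbbD>)"
  proof
    assume 0: "eventually (\<lambda>z. d z = 0) (cosparse \<bbbD>)"
    obtain \<mu> where \<mu>: "norm \<mu> = 1" "good_boundary_point W \<mu>" using ae_circle_ex[OF U_class_boundary[OF W]] by blast
    then have "eventually (\<lambda>z. z \<in> pg_domain W) (at \<mu> within stolz_region 2 \<mu>)" by (simp add: good_boundary_point_def)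
    then obtain e where e: "e > 0" "\<And>z. z \<in> stolz_region 2 \<mu> \<Longrightarrow> z \<noteq> \<mu> \<Longrightarrow> dist z \<mu> < e \<Longrightarrow> z \<in> pg_domain W"
      unfolding eventually_at by blast
    have "eventually (\<lambda>r. of_real r * \<mu> \<in> stolz_region 2 \<mu> \<and> of_real r * \<mu> \<noteq> \<mu>) (at_left 1)"
      "((\<lambda>r. of_real r * \<mu>) \<longlongrightarrow> \<mu>) (at_left 1)"
      using radius_in_stolz_region[OF \<mu>(1), of 2] by (auto simp: filterlim_at)
    from this(1) tendstoD[OF this(2) e(1)]
    have "eventually (\<lambda>r. of_real r * \<mu> \<in> stolz_region 2 \<mu> \<inter> ball \<mu> e) (at_left 1)"
      by eventually_elim (auto simp: dist_commute)
    then obtain r where z: "of_real r * \<mu> \<in> stolz_region 2 \<mu> \<inter> ball \<mu> e"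
      using eventually_happens'[OF trivial_limit_at_left_real] by blast
    let ?z = "of_real r * \<mu>"
    have "eventually (\<lambda>w. w \<in> stolz_region 2 \<mu> \<inter> ball \<mu> e) (at ?z)"
      using z by (intro eventually_at_in_open' open_Int open_stolz_region open_ball)
    moreover have "eventually (\<lambda>w. d w = 0) (at ?z)"
      using 0 z by (intro eventually_cosparse_imp_eventually_at[of _ \<bbbD>]) (auto simp: stolz_region_def)
    ultimately have "eventually (\<lambda>w. False) (at ?z)"
    proof eventually_elim
      case (elim w)
      then have "w \<noteq> \<mu>" using \<mu>(1) by (auto simp: stolz_region_def)
      then have "w \<in> pg_domain W" using e(2)[of w] elim by (simp add: dist_commute)
      then show ?case using elim by (simp add: pg_domain_def d_def)
    qed
    then show False by simp
  qed
  ultimately have dz: "eventually (\<lambda>z. d z \<noteq> 0) (cosparse \<bbbD>)" by blast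
  have "eventually (\<lambda>z. z \<in> holomorphy_domain W) (cosparse \<bbbD>)"
  proof -
    have "eventually (\<lambda>z. z \<notin> \<bbbD> - holomorphy_domain W) (cosparse \<bbbD>)" using hd(2) by (simp only: eventually_cosparse not_not Collect_mem_eq)
    moreover have "eventually (\<lambda>z. z \<in> \<bbbD>) (cosparse \<bbbD>)" by (intro eventually_in_cosparse) auto
    ultimately show ?thesis by eventually_elim auto
  qed
  then have ev: "eventually (\<lambda>z. z \<in> pg_domain W) (cosparse \<bbbD>)"
    using dz by eventually_elim (simp add: pg_domain_def d_def)
  then have sp: "{z. z \<notin> pg_domain W} sparse_in \<bbbD>" by (simp add: eventually_cosparse)
  show sub: "pg_domain W \<subseteq> \<bbbD>" by (auto simp: pg_domain_def holomorphy_domain_def)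
  show "(\<bbbD> - pg_domain W) sparse_in \<bbbD>" by (rule sparse_in_subset2[OF sp]) auto
  have "pg_domain W = \<bbbD> - {z. z \<notin> pg_domain W}" using sub by auto
  then show op: "open (pg_domain W)" using open_diff_sparse_pts[OF _ sp] by simp
  define E where "E i j z = Determinants.det (\<chi> a b. if b = i then pgD (?R z) $ a $ j else pgC (?R z) $ a $ b) / d z" for i j z
  have Eq: "pgS (?R z) $ i $ j = E i j z" if "z \<in> pg_domain W" for i j z
    unfolding E_def d_def using that by (intro pgS_entry) (simp add: pg_domain_def)
  have hC: "(\<lambda>z. pgC (?R z) $ a $ b) holomorphic_on pg_domain W" "(\<lambda>z. pgD (?R z) $ a $ b) holomorphic_on pg_domain W" for a b
  proof -
    have "(\<lambda>z. ?R z $ a $ b) holomorphic_on pg_domain W" for a b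
      by (rule holomorphic_on_subset[OF hd(3)]) (auto simp: pg_domain_def)
    then show "(\<lambda>z. pgC (?R z) $ a $ b) holomorphic_on pg_domain W" "(\<lambda>z. pgD (?R z) $ a $ b) holomorphic_on pg_domain W"
      unfolding pgC_def pgD_def matrix_matrix_mult_def by (simp; intro holomorphic_intros; assumption?)+
  qed
  have hdet: "(\<lambda>z. Determinants.det (M z)) holomorphic_on pg_domain W"
    if "\<And>a b. (\<lambda>z. M z $ a $ b) holomorphic_on pg_domain W" for M :: "complex \<Rightarrow> complex^('p + 'q)^('p + 'q)"
    unfolding Determinants.det_def by (intro holomorphic_intros that)
  have hE: "E i j holomorphic_on pg_domain W" for i j
    unfolding E_def d_def
  proof (intro holomorphic_on_divide hdet hC)
    fix a b show "(\<lambda>z. (\<chi> a b. if b = i then pgD (?R z) $ a $ j else pgC (?R z) $ a $ b) $ a $ b) holomorphic_on pg_domain W"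
      using hC by (cases "b = i") auto
  qed (simp add: pg_domain_def)
  have mE: "E i j meromorphic_on \<bbbD>" for i j
    unfolding E_def
  proof (intro meromorphic_on_divide mdet md)
    fix a b show "(\<lambda>z. (\<chi> a b. if b = i then pgD (?R z) $ a $ j else pgC (?R z) $ a $ b) $ a $ b) meromorphic_on \<bbbD>"
      using mC by (cases "b = i") auto
  qed
  show "(\<lambda>z. pgS (?R z) $ i $ j) holomorphic_on pg_domain W" for i j
    using hE[of i j] Eq by (simp cong: holomorphic_cong)
  have s: "s21 ?R z $ i $ j = E (Inr i) (Inl j) z" if z: "z \<in> pg_domain W" for z i j
  proof -
    have dz: "Determinants.det (pgC (?R z)) \<noteq> 0" using z by (simp add: pg_domain_def)
    have "in_upper (axis j (1::complex)) = (axis (Inl j) 1 :: complex^('p + 'q))"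
      by (auto simp: vec_eq_iff in_upper_def axis_def split: sum.split)
    then have "lower (pgS (?R z) *v in_upper (axis j 1)) $ i = pgS (?R z) $ Inr i $ Inl j"
      by (simp add: matrix_axis lower_def)
    moreover have "(s21 ?R z *v axis j 1) $ i = s21 ?R z $ i $ j"
      by (simp add: matrix_axis)
    ultimately show ?thesis using lower_pgS[where W = ?R, OF dz] Eq[OF z] by metis
  qed
  show hs: "(\<lambda>z. s21 ?R z $ i $ j) holomorphic_on pg_domain W" for i j
    using hE[of "Inr i" "Inl j"] s by (simp cong: holomorphic_cong)
  have pt: "s21 W z = s21 ?R z" if "?R z = W z" for z using that by (simp add: s21_def)
  have at: "eventually (\<lambda>w. s21 W w $ i $ j = s21 ?R w $ i $ j) (at z)" if "z \<in> \<bbbD>" for z i j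
    using hd(4)[OF that] by eventually_elim (simp add: pt)
  have an: "(\<lambda>w. s21 ?R w $ i $ j) analytic_on {z}" if "z \<in> pg_domain W" for z i j
    using hs op that holomorphic_on_imp_analytic_at by blast
  show "mvf_meromorphic (s21 W)"
    unfolding mvf_meromorphic_def
  proof (intro allI)
    fix i j
    have "eventually (\<lambda>z. ?R z = W z) (cosparse \<bbbD>)" using hd(4) by (simp add: eventually_cosparse_open_eq)
    then have "eventually (\<lambda>z. E (Inr i) (Inl j) z = s21 W z $ i $ j) (cosparse \<bbbD>)"
      using ev by eventually_elim (simp add: s pt)
    from meromorphic_on_cong'[OF this refl] show "(\<lambda>z. s21 W z $ i $ j) meromorphic_on \<bbbD>" using mE by blast
  qed
  show "pg_domain W \<subseteq> holomorphy_domain (s21 W)"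
  proof
    fix z assume z: "z \<in> pg_domain W"
    have "\<not> is_pole (\<lambda>w. s21 W w $ i $ j) z" for i j
      using is_pole_cong[OF at[of z i j] refl] analytic_at_imp_no_pole[OF an[OF z]] z sub by blast
    then show "z \<in> holomorphy_domain (s21 W)" using z sub by (auto simp: holomorphy_domain_def)
  qed
  show "mvf_reg (s21 W) z = s21 ?R z" if z: "z \<in> pg_domain W" for z
  proof -
    have "remove_sings (\<lambda>w. s21 W w $ i $ j) z = s21 ?R z $ i $ j" for i j
      using remove_sings_cong[OF at[of z i j] refl] remove_sings_at_analytic[OF an[OF z]] z sub by auto
    then show ?thesis by (simp add: mvf_reg_def vec_eq_iff)
  qed
qed

lemma kentry_hermitian:
  assumes "\<forall>z\<in>\<Omega>. \<forall>w\<in>\<Omega>. K w z = conj_transpose (K z w)" "w i \<in> \<Omega>" "w j \<in> \<Omega>"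
  shows "kentry K w u i j = cnj (kentry K w u j i)"
proof -
  have "K (w i) (w j) = conj_transpose (K (w j) (w i))" using assms by blast
  then show ?thesis
    unfolding kentry_def by (simp add: conj_transpose_apply[symmetric]) (rule hdot_commute)
qed

lemma neg_dim_ge_gram:
  assumes "\<forall>z\<in>\<Omega>. \<forall>w\<in>\<Omega>. K w z = conj_transpose (K z w)" "\<And>i. i < n \<Longrightarrow> w i \<in> \<Omega>"
  shows "neg_dim_ge k n (kentry K w u) \<longleftrightarrow> k \<le> num_neg_eigenvalues (gram_matrix K n w u)"
  unfolding gram_matrix_kentry by (rule neg_dim_ge_iff) (rule kentry_hermitian[OF assms(1)], auto intro: assms(2))

lemma pgS_few_negative_squares:
  fixes W :: "complex \<Rightarrow> complex^('p::finite + 'q::finite)^('p + 'q)"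
  assumes W: "W \<in> U_class \<kappa>" and w: "\<And>i. i < n \<Longrightarrow> w i \<in> pg_domain W"
  shows "\<not> neg_dim_ge (Suc \<kappa>) n (kentry (schur_kernel (\<lambda>z. pgS (mvf_reg W z))) w u)"
proof
  let ?R = "mvf_reg W"
  assume neg: "neg_dim_ge (Suc \<kappa>) n (kentry (schur_kernel (\<lambda>z. pgS (?R z))) w u)"
  define v where "v i = matrix_inv (conj_transpose (pgC (?R (w i)))) *v u i" for i
  have d: "Determinants.det (pgC (?R (w i))) \<noteq> 0" if "i < n" for i using w[OF that] by (simp add: pg_domain_def)
  have u: "conj_transpose (pgC (?R (w i))) *v v i = u i" if "i < n" for i
  proof -
    have "invertible (conj_transpose (pgC (?R (w i))))" using d[OF that] by (simp add: invertible_det_nz det_conj_transpose)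
    then show ?thesis by (simp add: v_def matrix_vector_mul_assoc matrix_inv_cancel)
  qed
  have "kentry (mvf_kernel j_pq j_pq ?R) w v i j = kentry (schur_kernel (\<lambda>z. pgS (?R z))) w u i j" if "i < n" "j < n" for i j
  proof -
    have "kentry (mvf_kernel j_pq j_pq ?R) w v i j =
        kentry (schur_kernel (\<lambda>z. pgS (?R z))) w (\<lambda>i. conj_transpose (pgC (?R (w i))) *v v i) i j"
      by (rule pg_kernel_congruence) (use d that in auto)
    also have "\<dots> = kentry (schur_kernel (\<lambda>z. pgS (?R z))) w u i j" using u that by (simp add: kentry_def)
    finally show ?thesis .
  qed
  then have "neg_dim_ge (Suc \<kappa>) n (kentry (mvf_kernel j_pq j_pq ?R) w v)" using neg by (subst neg_dim_ge_cong)
  moreover have wH: "w i \<in> holomorphy_domain W" if "i < n" for i using w[OF that] by (simp add: pg_domain_def)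
  moreover have ns: "has_negative_squares \<kappa> (holomorphy_domain W) (mvf_kernel j_pq j_pq ?R)" using W by (simp add: U_class_def)
  ultimately have "Suc \<kappa> \<le> num_neg_eigenvalues (gram_matrix (mvf_kernel j_pq j_pq ?R) n w v)"
    using neg_dim_ge_gram[of "holomorphy_domain W" "mvf_kernel j_pq j_pq ?R" n w "Suc \<kappa>" v]
    unfolding has_negative_squares_def by blast
  moreover have "num_neg_eigenvalues (gram_matrix (mvf_kernel j_pq j_pq ?R) n w v) \<le> \<kappa>"
    using ns wH unfolding has_negative_squares_def by blast
  ultimately show False by simp
qed

text \<open>
  Equality on the circle carries over to the disc within the Hardy space (\<open>hardy_boundary_zero\<close>), but the
  transform times \<open>h\<close> is not known to lie there. As the transform has few negative squares, some nontrivial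
  combination of its products with \<open>h, z h, \<dots>, z\<^sup>\<kappa> h\<close> is in the Hardy space. That is, multiplication by a
  nonzero polynomial \<open>ch\<close> brings it there. The result has the same boundary values as \<open>ch * k\<close> and hence
  equals it in the disc. Away from its zeros \<open>ch\<close> cancels, and continuity settles the zeros.
\<close>

lemma pgS_boundary_relation:
  fixes W :: "complex \<Rightarrow> complex^('p::finite + 'q::finite)^('p + 'q)"
  assumes W: "W \<in> U_class \<kappa>" and h: "h \<in> hardy_disc" and k: "k \<in> hardy_disc"
    and bd: "ae_circle (\<lambda>\<mu>. \<exists>h0 k0. has_nt_limit h \<mu> h0 \<and> has_nt_limit k \<mu> k0 \<and>
       pgC (nt_boundary (mvf_reg W) \<mu>) *v k0 = pgD (nt_boundary (mvf_reg W) \<mu>) *v h0)"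
    and z: "z \<in> pg_domain W"
  shows "pgS (mvf_reg W z) *v h z = k z"
proof -
  let ?R = "mvf_reg W"
  note \<Omega> = pg_domain_facts[OF W]
  obtain c g where c: "\<exists>i<Suc \<kappa>. c i \<noteq> 0" and g: "g \<in> hardy_disc"
    "\<And>z. z \<in> pg_domain W \<Longrightarrow> pgS (?R z) *v (\<Sum>i<Suc \<kappa>. c i *s (z ^ i *s h z)) = g z"
    using few_negative_squares_imp_finite_codim[OF \<Omega>(1-4) pgS_few_negative_squares[OF W], where h = "\<lambda>i z. z ^ i *s h z"] hardy_disc_shift[OF h]
    by blast
  define ch where "ch z = (\<Sum>i<Suc \<kappa>. c i * z ^ i)" for z
  have chi: "(\<Sum>i<Suc \<kappa>. c i *s (z ^ i *s x)) = ch z *s x" for z and x :: "complex^('p + 'q)"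
    unfolding ch_def vec_eq_iff by (simp only: sum_component vector_smult_component sum_distrib_right mult.assoc) simp
  have S: "pgC (?R z) *v g z = pgD (?R z) *v (ch z *s h z)" if "z \<in> pg_domain W" for z
    using g(2)[OF that] that unfolding chi by (subst pgS_iff[symmetric]) (auto simp: pg_domain_def)
  define f where "f z = (\<Sum>i<Suc \<kappa>. c i *s (z ^ i *s k z))" for z
  have f: "f \<in> hardy_disc" unfolding f_def using hardy_disc_sum[of "{..<Suc \<kappa>}" "\<lambda>i z. z ^ i *s k z" c] hardy_disc_shift[OF k] by blast
  have fchi: "f z = ch z *s k z" for z unfolding f_def chi ..
  have "ae_circle (\<lambda>\<mu>. has_nt_limit (\<lambda>z. g z - f z) \<mu> 0)"
  proof (rule ae_circle_mono[OF ae_circle_conj[OF U_class_boundary[OF W] bd]])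
    fix \<mu> :: complex assume \<mu>: "norm \<mu> = 1"
    let ?L = "nt_boundary ?R \<mu>"
    assume "good_boundary_point W \<mu> \<and> (\<exists>h0 k0. has_nt_limit h \<mu> h0 \<and> has_nt_limit k \<mu> k0 \<and> pgC ?L *v k0 = pgD ?L *v h0)"
    then obtain h0 k0 where L: "has_nt_limit ?R \<mu> ?L" "Determinants.det (pgC ?L) \<noteq> 0"
      "\<And>\<alpha>. \<alpha> > 1 \<Longrightarrow> eventually (\<lambda>z. z \<in> pg_domain W) (at \<mu> within stolz_region \<alpha> \<mu>)"
      and hk: "has_nt_limit h \<mu> h0" "has_nt_limit k \<mu> k0" "pgC ?L *v k0 = pgD ?L *v h0"
      by (auto simp: good_boundary_point_def)
    show "has_nt_limit (\<lambda>z. g z - f z) \<mu> 0"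
      unfolding has_nt_limit_def
    proof (intro allI impI)
      fix \<alpha> :: real assume \<alpha>: "\<alpha> > 1"
      let ?F = "at \<mu> within stolz_region \<alpha> \<mu>"
      have R: "(?R \<longlongrightarrow> ?L) ?F" and h0: "(h \<longlongrightarrow> h0) ?F" and k0: "(k \<longlongrightarrow> k0) ?F"
        using L(1) hk \<alpha> by (simp_all add: has_nt_limit_def)
      have chi_lim: "(ch \<longlongrightarrow> ch \<mu>) ?F" unfolding ch_def by (intro tendsto_intros)
      have "eventually (\<lambda>z. pgC (?R z) *v g z = pgD (?R z) *v (ch z *s h z)) ?F"
        using L(3)[OF \<alpha>] by eventually_elim (rule S)
      from tendsto_linear_solution[OF tendsto_pgCD(1)[OF R] tendsto_matrix_vector[OF tendsto_pgCD(2)[OF R] tendsto_cmult_vec[OF chi_lim h0]] L(2) this]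
      obtain g0 where g0: "(g \<longlongrightarrow> g0) ?F" "pgC ?L *v g0 = pgD ?L *v (ch \<mu> *s h0)" by blast
      have "pgC ?L *v g0 = pgC ?L *v (ch \<mu> *s k0)"
        unfolding g0(2) matrix_vector_cmult hk(3) ..
      then have "g0 = ch \<mu> *s k0"
        using matrix_left_invertible_injective[of "pgC ?L"] L(2)
        by (metis invertible_det_nz invertible_left_inverse injD)
      then have "((\<lambda>z. g z - f z) \<longlongrightarrow> ch \<mu> *s k0 - ch \<mu> *s k0) ?F"
        unfolding fchi using g0(1) by (intro tendsto_diff tendsto_cmult_vec chi_lim k0) simp
      then show "((\<lambda>z. g z - f z) \<longlongrightarrow> 0) ?F" by simp
    qed
  qed
  then have gf: "g z = f z" if "z \<in> \<bbbD>" for z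
    using hardy_boundary_zero[OF hardy_disc_diff[OF g(1) f] _ that] by simp
  define Z where "Z = {z. (\<Sum>i\<le>\<kappa>. c i * z ^ i) = 0}"
  have "finite Z" unfolding Z_def using c by (subst polyfun_finite_roots) (auto simp: less_Suc_eq_le)
  have eq: "pgS (?R z) *v h z = k z" if z: "z \<in> pg_domain W" "z \<notin> Z" for z
  proof -
    have "ch z \<noteq> 0" using z(2) by (simp add: Z_def ch_def lessThan_Suc_atMost)
    moreover have "ch z *s (pgS (?R z) *v h z) = ch z *s k z"
      using g(2)[OF z(1)] gf[of z] z(1) \<Omega>(2) unfolding chi fchi by (auto simp: matrix_vector_cmult)
    ultimately show ?thesis by (simp add: vec_eq_iff)
  qed
  have "(\<lambda>z. (pgS (?R z) *v h z) $ i - k z $ i) holomorphic_on pg_domain W" for i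
  proof -
    have "(\<lambda>z. h z $ j) holomorphic_on pg_domain W" "(\<lambda>z. k z $ j) holomorphic_on pg_domain W" for j
      using h k \<Omega>(2) by (auto simp: hardy_disc_def intro: holomorphic_on_subset)
    then show ?thesis unfolding matrix_vector_mult_def by simp (intro holomorphic_intros \<Omega>(4); simp)
  qed
  then have cont: "isCont (\<lambda>z. (pgS (?R z) *v h z) $ i - k z $ i) z" for i
    using z \<Omega>(1) holomorphic_on_imp_continuous_on continuous_on_eq_continuous_at by blast
  have "(pgS (?R z) *v h z) $ i - k z $ i = 0" for i
  proof (rule tendsto_unique[OF at_neq_bot])
    show "((\<lambda>z. (pgS (?R z) *v h z) $ i - k z $ i) \<longlongrightarrow> (pgS (?R z) *v h z) $ i - k z $ i) (at z)"
      using cont by (simp add: isCont_def)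
    have "eventually (\<lambda>w. w \<notin> Z) (at z)"
      using \<open>finite Z\<close> islimpt_finite[of Z z] by (simp add: islimpt_iff_eventually)
    moreover have "eventually (\<lambda>w. w \<in> pg_domain W) (at z)" using z \<Omega>(1) by (intro eventually_at_in_open')
    ultimately have "eventually (\<lambda>w. (pgS (?R w) *v h w) $ i - k w $ i = 0) (at z)"
      by eventually_elim (simp add: eq)
    then show "((\<lambda>z. (pgS (?R z) *v h z) $ i - k z $ i) \<longlongrightarrow> 0) (at z)" by (rule tendsto_eventually)
  qed
  then show ?thesis by (simp add: vec_eq_iff)
qed

section \<open>Lifting data on the circle\<close>

lemma has_nt_limit_sum:
  fixes f :: "'i \<Rightarrow> complex \<Rightarrow> complex^'k"
  assumes "\<And>i. i \<in> I \<Longrightarrow> has_nt_limit (f i) \<mu> (v i)"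
  shows "has_nt_limit (\<lambda>z. \<Sum>i\<in>I. c i *s f i z) \<mu> (\<Sum>i\<in>I. c i *s v i)"
  using assms unfolding has_nt_limit_def by (auto intro!: tendsto_sum tendsto_cmult_vec)

lemma has_nt_limit_add:
  fixes f :: "complex \<Rightarrow> complex^'k"
  assumes "has_nt_limit f \<mu> v" "has_nt_limit g \<mu> u"
  shows "has_nt_limit (\<lambda>z. f z + g z) \<mu> (v + u)"
  using assms unfolding has_nt_limit_def by (auto intro!: tendsto_add)

lemma has_nt_limit_diff:
  fixes f :: "complex \<Rightarrow> complex^'k"
  assumes "has_nt_limit f \<mu> v" "has_nt_limit g \<mu> u"
  shows "has_nt_limit (\<lambda>z. f z - g z) \<mu> (v - u)"
  using assms unfolding has_nt_limit_def by (auto intro!: tendsto_diff)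

lemma has_nt_limit_parts:
  fixes v :: "complex^('p::finite + 'q::finite)"
  assumes "has_nt_limit f \<mu> v"
  shows "has_nt_limit (\<lambda>z. upper (f z)) \<mu> (upper v)" "has_nt_limit (\<lambda>z. lower (f z)) \<mu> (lower v)"
  using assms unfolding has_nt_limit_def by (auto intro!: tendsto_parts)

lemma has_nt_limit_combine:
  fixes u :: "complex^'p" and v :: "complex^'q"
  assumes "has_nt_limit x \<mu> u" "has_nt_limit y \<mu> v"
  shows "has_nt_limit (\<lambda>z. in_upper (x z) + in_lower (y z)) \<mu> (in_upper u + in_lower v)"
  using assms unfolding has_nt_limit_def by (auto intro!: tendsto_add tendsto_in_parts)

lemma has_nt_limit_polynomial: "has_nt_limit (\<lambda>z. \<Sum>n<L. z ^ n *s b n) \<mu> (\<Sum>n<L. \<mu> ^ n *s b n)"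
  unfolding has_nt_limit_def by (intro allI impI tendsto_sum tendsto_cmult_vec tendsto_intros)

lemma inner_mult_hardy:
  fixes b :: "complex \<Rightarrow> complex^'k^'k"
  assumes b: "inner_mvf b" and y: "y \<in> hardy_disc"
  shows "(\<lambda>z. b z *v y z) \<in> hardy_disc"
proof -
  have yh: "(\<lambda>z. y z $ i) holomorphic_on \<bbbD>" for i using y by (simp add: hardy_disc_def)
  have bh: "(\<lambda>z. b z $ i $ j) holomorphic_on \<bbbD>" for i j using b by (simp add: inner_mvf_def)
  have hl: "(\<lambda>z. (b z *v y z) $ i) holomorphic_on \<bbbD>" for i
    unfolding matrix_vector_mult_def by simp (intro holomorphic_intros yh bh)
  obtain C where C: "\<forall>r\<in>{0..<1}. integral {0..2*pi} (\<lambda>t. (norm (y (of_real r * cis t)))\<^sup>2) \<le> C"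
    using y unfolding hardy_disc_def by blast
  have "integral {0..2*pi} (\<lambda>t. (norm (b (of_real r * cis t) *v y (of_real r * cis t)))\<^sup>2) \<le> C" if r: "r \<in> {0..<1}" for r
  proof -
    have "hol (\<lambda>z. b z *v y z)" "hol y" using hl yh by (simp_all add: hol_def)
    note P = parseval_circle(1)[OF this(1), of r] parseval_circle(1)[OF this(2), of r]
    have "integral {0..2*pi} (\<lambda>t. (norm (b (of_real r * cis t) *v y (of_real r * cis t)))\<^sup>2)
       \<le> integral {0..2*pi} (\<lambda>t. (norm (y (of_real r * cis t)))\<^sup>2)"
    proof (rule integral_le)
      show "(\<lambda>t. (norm (b (of_real r * cis t) *v y (of_real r * cis t)))\<^sup>2) integrable_on {0..2*pi}"
        "(\<lambda>t. (norm (y (of_real r * cis t)))\<^sup>2) integrable_on {0..2*pi}" using P r by auto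
      fix t
      have "of_real r * cis t \<in> \<bbbD>" using r by (simp add: norm_mult)
      then show "(norm (b (of_real r * cis t) *v y (of_real r * cis t)))\<^sup>2 \<le> (norm (y (of_real r * cis t)))\<^sup>2"
        using b by (intro power_mono) (auto simp: inner_mvf_def)
    qed
    also have "\<dots> \<le> C" using C r by blast
    finally show ?thesis .
  qed
  then show ?thesis using hl unfolding hardy_disc_def by blast
qed

lemma inner_boundary:
  assumes "inner_mvf b"
  shows "ae_circle (\<lambda>\<mu>. has_nt_limit b \<mu> (nt_boundary b \<mu>) \<and> invertible (nt_boundary b \<mu>))"
proof (rule ae_circle_mono)
  show "ae_circle (\<lambda>\<mu>. \<exists>L. has_nt_limit b \<mu> L \<and> L ** conj_transpose L = mat 1 \<and> conj_transpose L ** L = mat 1)"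
    using assms by (simp add: inner_mvf_def)
  fix \<mu> :: complex assume \<mu>: "norm \<mu> = 1"
    and "\<exists>L. has_nt_limit b \<mu> L \<and> L ** conj_transpose L = mat 1 \<and> conj_transpose L ** L = mat 1"
  then obtain L where L: "has_nt_limit b \<mu> L" "L ** conj_transpose L = mat 1" "conj_transpose L ** L = mat 1" by blast
  then show "has_nt_limit b \<mu> (nt_boundary b \<mu>) \<and> invertible (nt_boundary b \<mu>)"
    using nt_boundary_eq[OF L(1) \<mu>] by (auto simp: invertible_def)
qed

text \<open>
  On the circle \<open>y\<close> is the inverse of \<open>b\<close> times \<open>b y\<close>, hence by (iv) the lower component of \<open>W f\<close> for some \<open>f\<close>. This
  component is in the Hardy space, so (iii) puts all of \<open>W f\<close> there.
\<close>

lemma lift_lower: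
  fixes W :: "complex \<Rightarrow> complex^('p::finite + 'q::finite)^('p + 'q)" and b :: "complex \<Rightarrow> complex^'q^'q"
  assumes b: "inner_mvf b"
    and iii: "\<And>f. f \<in> H2 \<Longrightarrow> (\<lambda>\<mu>. (zero_id :: complex^('p + 'q)^'q) *v bd_mult W f \<mu>) \<in> H2 \<Longrightarrow> bd_mult W f \<in> H2"
    and iv: "ae_set_eq ((\<lambda>f \<mu>. (zero_id :: complex^('p + 'q)^'q) *v bd_mult W f \<mu>) ` H2)
               ((\<lambda>g \<mu>. matrix_inv (nt_boundary b \<mu>) *v g \<mu>) ` H2)"
    and y: "y \<in> hardy_disc" "ae_circle (\<lambda>\<mu>. has_nt_limit y \<mu> (y\<^sub>0 \<mu>))"
  shows "\<exists>f g. f \<in> hardy_disc \<and> g \<in> hardy_disc \<and> ae_circle (\<lambda>\<mu>. \<exists>f\<^sub>0. has_nt_limit f \<mu> f\<^sub>0 \<and>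
     has_nt_limit g \<mu> (nt_boundary (mvf_reg W) \<mu> *v f\<^sub>0) \<and> lower (nt_boundary (mvf_reg W) \<mu> *v f\<^sub>0) = y\<^sub>0 \<mu>)"
proof -
  let ?b = "nt_boundary b"
  note bb = inner_boundary[OF b]
  have "ae_circle (\<lambda>\<mu>. has_nt_limit (\<lambda>z. b z *v y z) \<mu> (?b \<mu> *v y\<^sub>0 \<mu>))"
    by (rule ae_circle_mono[OF ae_circle_conj[OF bb y(2)]]) (auto simp: has_nt_limit_def intro!: tendsto_matrix_vector)
  then have "(\<lambda>\<mu>. ?b \<mu> *v y\<^sub>0 \<mu>) \<in> H2" using inner_mult_hardy[OF b y(1)] unfolding H2_def by blast
  then obtain f\<^sub>1 where f1: "f\<^sub>1 \<in> H2"
    "ae_circle (\<lambda>\<mu>. (zero_id :: complex^('p + 'q)^'q) *v bd_mult W f\<^sub>1 \<mu> = matrix_inv (?b \<mu>) *v (?b \<mu> *v y\<^sub>0 \<mu>))"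
    using iv unfolding ae_set_eq_def by force
  have eq: "ae_circle (\<lambda>\<mu>. lower (bd_mult W f\<^sub>1 \<mu>) = y\<^sub>0 \<mu>)"
    by (rule ae_circle_mono[OF ae_circle_conj[OF bb f1(2)]])
       (simp add: zero_id_apply matrix_vector_mul_assoc matrix_inv_cancel)
  have "(\<lambda>\<mu>. (zero_id :: complex^('p + 'q)^'q) *v bd_mult W f\<^sub>1 \<mu>) \<in> H2"
    unfolding zero_id_apply H2_def mem_Collect_eq
    by (rule bexI[OF _ y(1)], rule ae_circle_mono[OF ae_circle_conj[OF y(2) eq]]) simp
  then have "bd_mult W f\<^sub>1 \<in> H2" by (rule iii[OF f1(1)])
  then obtain g where g: "g \<in> hardy_disc" "ae_circle (\<lambda>\<mu>. has_nt_limit g \<mu> (bd_mult W f\<^sub>1 \<mu>))" by (auto simp: H2_def)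
  obtain f where f: "f \<in> hardy_disc" "ae_circle (\<lambda>\<mu>. has_nt_limit f \<mu> (f\<^sub>1 \<mu>))" using f1(1) by (auto simp: H2_def)
  have "ae_circle (\<lambda>\<mu>. \<exists>f\<^sub>0. has_nt_limit f \<mu> f\<^sub>0 \<and> has_nt_limit g \<mu> (nt_boundary (mvf_reg W) \<mu> *v f\<^sub>0) \<and>
     lower (nt_boundary (mvf_reg W) \<mu> *v f\<^sub>0) = y\<^sub>0 \<mu>)"
    by (rule ae_circle_mono[OF ae_circle_conj[OF eq ae_circle_conj[OF f(2) g(2)]]]) (auto simp: bd_mult_def)
  then show ?thesis using f(1) g(1) by blast
qed

lemma lift_lower_zero:
  fixes W :: "complex \<Rightarrow> complex^('p::finite + 'q::finite)^('p + 'q)"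
  assumes iii: "\<And>f. f \<in> H2 \<Longrightarrow> (\<lambda>\<mu>. (zero_id :: complex^('p + 'q)^'q) *v bd_mult W f \<mu>) \<in> H2 \<Longrightarrow> bd_mult W f \<in> H2"
    and f: "f \<in> hardy_disc"
    and bd: "ae_circle (\<lambda>\<mu>. \<exists>f\<^sub>0. has_nt_limit f \<mu> f\<^sub>0 \<and> lower (nt_boundary (mvf_reg W) \<mu> *v f\<^sub>0) = 0)"
  shows "\<exists>g. g \<in> hardy_disc \<and> ae_circle (\<lambda>\<mu>. has_nt_limit g \<mu> (nt_boundary (mvf_reg W) \<mu> *v nt_boundary f \<mu>))"
proof -
  have bd': "ae_circle (\<lambda>\<mu>. has_nt_limit f \<mu> (nt_boundary f \<mu>) \<and> lower (bd_mult W (nt_boundary f) \<mu>) = 0)"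
    by (rule ae_circle_mono[OF bd]) (auto simp: nt_boundary_eq bd_mult_def)
  have "ae_circle (\<lambda>\<mu>. has_nt_limit f \<mu> (nt_boundary f \<mu>))" by (rule ae_circle_mono[OF bd']) simp
  then have fH: "nt_boundary f \<in> H2" using f by (auto simp: H2_def)
  have "has_nt_limit (\<lambda>z. 0) \<mu> (0 :: complex^'q)" for \<mu> by (simp add: has_nt_limit_def)
  then have "ae_circle (\<lambda>\<mu>. has_nt_limit (\<lambda>z. 0) \<mu> (lower (bd_mult W (nt_boundary f) \<mu>)))"
    by (intro ae_circle_mono[OF bd']) simp
  moreover have "(\<lambda>z. 0) \<in> hardy_disc" by (auto simp: hardy_disc_def)
  ultimately have "(\<lambda>\<mu>. (zero_id :: complex^('p + 'q)^'q) *v bd_mult W (nt_boundary f) \<mu>) \<in> H2"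
    unfolding zero_id_apply H2_def by blast
  from iii[OF fH this] show ?thesis by (auto simp: H2_def bd_mult_def)
qed

text \<open>
  In the disc \<open>W\<close> maps \<open>(x, s\<^sub>2\<^sub>1 x)\<close> to a vector with zero lower component. The limit of \<open>s\<^sub>2\<^sub>1 x\<close> exists because \<open>s\<^sub>2\<^sub>1 x\<close>
  is part of the solution of a linear system whose matrix remains invertible in the limit.
\<close>

lemma s21_boundary:
  fixes W :: "complex \<Rightarrow> complex^('p::finite + 'q::finite)^('p + 'q)"
  assumes \<mu>: "good_boundary_point W \<mu>" and x: "has_nt_limit x \<mu> x\<^sub>0"
    and y: "\<And>z. z \<in> pg_domain W \<Longrightarrow> s21 (mvf_reg W) z *v x z = y z"
  shows "\<exists>y\<^sub>0. has_nt_limit y \<mu> y\<^sub>0 \<and> lower (nt_boundary (mvf_reg W) \<mu> *v (in_upper x\<^sub>0 + in_lower y\<^sub>0)) = 0"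
proof -
  let ?R = "mvf_reg W" let ?L = "nt_boundary ?R \<mu>"
  have L: "has_nt_limit ?R \<mu> ?L" "Determinants.det (pgC ?L) \<noteq> 0"
      "\<And>\<alpha>. \<alpha> > 1 \<Longrightarrow> eventually (\<lambda>z. z \<in> pg_domain W) (at \<mu> within stolz_region \<alpha> \<mu>)"
    using \<mu> by (auto simp: good_boundary_point_def)
  define k where "k z = pgS (?R z) *v in_upper (x z)" for z
  define k\<^sub>0 where "k\<^sub>0 = pgS ?L *v in_upper x\<^sub>0"
  have "pgC ?L *v k\<^sub>0 = pgD ?L *v in_upper x\<^sub>0" by (rule iffD1[OF pgS_iff[OF L(2)]]) (simp add: k\<^sub>0_def)
  then have rel: "?L *v (in_upper x\<^sub>0 + in_lower (lower k\<^sub>0)) = in_upper (upper k\<^sub>0)" by (simp add: pg_relation)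
  have "has_nt_limit y \<mu> (lower k\<^sub>0)"
    unfolding has_nt_limit_def
  proof (intro allI impI)
    fix \<alpha> :: real assume \<alpha>: "\<alpha> > 1"
    let ?F = "at \<mu> within stolz_region \<alpha> \<mu>"
    have R: "(?R \<longlongrightarrow> ?L) ?F" and x0: "(x \<longlongrightarrow> x\<^sub>0) ?F"
      using L(1) x \<alpha> by (simp_all add: has_nt_limit_def)
    have "eventually (\<lambda>z. pgC (?R z) *v k z = pgD (?R z) *v in_upper (x z)) ?F"
      using L(3)[OF \<alpha>]
    proof eventually_elim
      case (elim z)
      then have "Determinants.det (pgC (?R z)) \<noteq> 0" by (simp add: pg_domain_def)
      from iffD1[OF pgS_iff[OF this] refl] show ?case by (simp add: k_def)
    qed
    from tendsto_linear_solution[OF tendsto_pgCD(1)[OF R] tendsto_matrix_vector[OF tendsto_pgCD(2)[OF R] tendsto_in_parts(1)[OF x0]] L(2) this]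
    obtain k\<^sub>1 where k1: "(k \<longlongrightarrow> k\<^sub>1) ?F" "pgC ?L *v k\<^sub>1 = pgD ?L *v in_upper x\<^sub>0" by blast
    have "k\<^sub>0 = k\<^sub>1" unfolding k\<^sub>0_def by (rule iffD2[OF pgS_iff[OF L(2)] k1(2)])
    then have "((\<lambda>z. lower (k z)) \<longlongrightarrow> lower k\<^sub>0) ?F" using tendsto_parts(2)[OF k1(1)] by simp
    moreover have "eventually (\<lambda>z. lower (k z) = y z) ?F" using L(3)[OF \<alpha>]
    proof eventually_elim
      case (elim z)
      then have "Determinants.det (pgC (?R z)) \<noteq> 0" by (simp add: pg_domain_def)
      from lower_pgS[where W = ?R, OF this] show ?case using y[OF elim] by (simp add: k_def)
    qed
    ultimately show "(y \<longlongrightarrow> lower k\<^sub>0) ?F" by (rule Lim_transform_eventually)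
  qed
  then show ?thesis using rel by (intro exI[of _ "lower k\<^sub>0"]) simp
qed

lemma choice_less: "\<forall>l<k. \<exists>x. P l x \<Longrightarrow> \<exists>f. \<forall>l<k. P l (f l)" for k :: nat
  by metis

lemma j_pq_square: "j_pq ** j_pq = mat 1"
proof (rule mat_eqI)
  fix x :: "complex^('a + 'b)"
  show "(j_pq ** j_pq) *v x = mat 1 *v x"
    unfolding matrix_vector_mul_assoc[symmetric] proj_apply(3) proj_apply(1,2)
    by (auto simp: vec_eq_iff in_upper_def in_lower_def upper_def lower_def split: sum.split)
qed

text \<open>
  The assumption says that \<open>j A\<^sup>* j\<close> is a right inverse of \<open>A\<close>, hence also a left inverse.
\<close>

lemma j_unitary_adjoint:
  fixes A :: "complex^('p::finite + 'q::finite)^('p + 'q)"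
  assumes "A ** j_pq ** conj_transpose A = j_pq"
  shows "conj_transpose A ** j_pq ** A = j_pq"
proof -
  have "A ** (j_pq ** conj_transpose A ** j_pq) = mat 1"
    using arg_cong[OF assms, of "\<lambda>M. M ** j_pq"] by (simp add: matrix_mul_assoc j_pq_square)
  then have "(j_pq ** conj_transpose A ** j_pq) ** A = mat 1"
    using matrix_left_right_inverse by blast
  then have "j_pq ** ((j_pq ** conj_transpose A ** j_pq) ** A) = j_pq ** mat 1" by (rule arg_cong)
  then show ?thesis by (simp add: matrix_mul_assoc j_pq_square matrix_mul_lid matrix_mul_rid)
qed

text \<open>
  Preservation of the form of \<open>j\<close>, with the two lower components moved to the other sides.
\<close>

lemma j_unitary_norm:
  fixes A :: "complex^('p::finite + 'q::finite)^('p + 'q)"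
  assumes "A ** j_pq ** conj_transpose A = j_pq"
  shows "norm (in_upper (upper (A *v f)) + in_lower (lower f) :: complex^('p + 'q)) =
    norm (in_upper (upper f) + in_lower (lower (A *v f)) :: complex^('p + 'q))"
proof -
  have "hdot (A *v f) (j_pq *v (A *v f)) = hdot f (j_pq *v f)"
    using j_unitary_adjoint[OF assms] by (simp add: conj_transpose_apply matrix_vector_mul_assoc matrix_mul_assoc)
  then have "complex_of_real ((norm (upper (A *v f)))\<^sup>2 - (norm (lower (A *v f)))\<^sup>2) = of_real ((norm (upper f))\<^sup>2 - (norm (lower f))\<^sup>2)"
    by (simp add: j_pq_hdot hdot_self)
  then have "(norm (upper (A *v f)))\<^sup>2 - (norm (lower (A *v f)))\<^sup>2 = (norm (upper f))\<^sup>2 - (norm (lower f))\<^sup>2"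
    by (simp only: of_real_eq_iff)
  then have "(norm (in_upper (upper (A *v f)) + in_lower (lower f) :: complex^('p + 'q)))\<^sup>2 =
    (norm (in_upper (upper f) + in_lower (lower (A *v f)) :: complex^('p + 'q)))\<^sup>2"
    unfolding norm_parts by simp
  then show ?thesis by (simp add: power2_eq_iff_nonneg)
qed

text \<open>
  For a combination \<open>H\<close> of the given polynomials, functions \<open>F\<close> and \<open>G\<close> in the Hardy space are constructed with \<open>G = W F\<close>
  on the circle such that \<open>F\<close> has the upper component of \<open>H\<close> and \<open>G\<close> its lower component. Then the transform maps
  \<open>H\<close> to the function \<open>K\<close> made of the upper component of \<open>G\<close> and the lower component of \<open>F\<close>, and the norms agree by
  \<open>j_unitary_norm\<close>.

  The lower components are matched for each polynomial separately by \<open>lift_lower\<close>. To match the upper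
  components as well, \<open>(x, s\<^sub>2\<^sub>1 x)\<close> is added, where \<open>x\<close> is what is missing; as \<open>s\<^sub>2\<^sub>1 x\<close> has to be in the Hardy space, only a
  combination can be treated. The addition does not affect the lower component of \<open>G\<close>.
\<close>

lemma pgS_contractive_finite_codim:
  fixes W :: "complex \<Rightarrow> complex^('p::finite + 'q::finite)^('p + 'q)" and b\<^sub>2 :: "complex \<Rightarrow> complex^'q^'q"
    and b :: "nat \<Rightarrow> nat \<Rightarrow> complex^('p + 'q)"
  assumes W: "W \<in> U_class \<kappa>" and b2: "inner_mvf b\<^sub>2"
    and iii: "\<And>f. f \<in> H2 \<Longrightarrow> (\<lambda>\<mu>. (zero_id :: complex^('p + 'q)^'q) *v bd_mult W f \<mu>) \<in> H2 \<Longrightarrow> bd_mult W f \<in> H2"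
    and iv: "ae_set_eq ((\<lambda>f \<mu>. (zero_id :: complex^('p + 'q)^'q) *v bd_mult W f \<mu>) ` H2)
               ((\<lambda>g \<mu>. matrix_inv (nt_boundary b\<^sub>2 \<mu>) *v g \<mu>) ` H2)"
    and neg: "\<And>(n::nat) w u. (\<And>i. i < n \<Longrightarrow> w i \<in> pg_domain W) \<Longrightarrow>
       \<not> neg_dim_ge (Suc k) n (kentry (schur_kernel (s21 (mvf_reg W))) w u)"
  shows "\<exists>c. (\<exists>l<Suc k. c l \<noteq> 0) \<and>
      (\<exists>g\<in>hardy_disc. (\<forall>z\<in>pg_domain W. pgS (mvf_reg W z) *v (\<Sum>l<Suc k. c l *s (\<Sum>n<L. z ^ n *s b l n)) = g z) \<and>
         (l2norm (hcoef g))\<^sup>2 \<le> (\<Sum>n<L. (norm (\<Sum>l<Suc k. c l *s b l n))\<^sup>2))"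
proof -
  let ?R = "mvf_reg W" let ?L = "nt_boundary ?R"
  note \<Omega> = pg_domain_facts[OF W]
  define h where "h l z = (\<Sum>n<L. z ^ n *s b l n)" for l z
  have h: "h l \<in> hardy_disc" "has_nt_limit (h l) \<mu> (h l \<mu>)" for l \<mu>
    unfolding h_def by (rule hardy_disc_polynomial, rule has_nt_limit_polynomial)
  define P where "P l \<mu> f g f\<^sub>0 \<longleftrightarrow> has_nt_limit f \<mu> f\<^sub>0 \<and>
     has_nt_limit g \<mu> (?L \<mu> *v f\<^sub>0) \<and> lower (?L \<mu> *v f\<^sub>0) = lower (h l \<mu>)" for l \<mu> f g f\<^sub>0
  have "\<forall>l. \<exists>fg. fst fg \<in> hardy_disc \<and> snd fg \<in> hardy_disc \<and> ae_circle (\<lambda>\<mu>. \<exists>f\<^sub>0. P l \<mu> (fst fg) (snd fg) f\<^sub>0)"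
  proof
    fix l
    have "ae_circle (\<lambda>\<mu>. has_nt_limit (\<lambda>z. lower (h l z)) \<mu> (lower (h l \<mu>)))"
      unfolding ae_circle_def by (rule AE_I2) (rule has_nt_limit_parts(2)[OF h(2)])
    from lift_lower[OF b2 iii iv hardy_disc_parts(2)[OF h(1)] this]
    show "\<exists>fg. fst fg \<in> hardy_disc \<and> snd fg \<in> hardy_disc \<and> ae_circle (\<lambda>\<mu>. \<exists>f\<^sub>0. P l \<mu> (fst fg) (snd fg) f\<^sub>0)"
      unfolding P_def by auto
  qed
  from choice[OF this] obtain fg where fg: "\<forall>l. fst (fg l) \<in> hardy_disc \<and> snd (fg l) \<in> hardy_disc \<and>
    ae_circle (\<lambda>\<mu>. \<exists>f\<^sub>0. P l \<mu> (fst (fg l)) (snd (fg l)) f\<^sub>0)" by blast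
  define f where "f l = fst (fg l)" for l
  define g where "g l = snd (fg l)" for l
  have f: "f l \<in> hardy_disc" and g: "g l \<in> hardy_disc" for l using fg by (simp_all add: f_def g_def)
  have "ae_circle (\<lambda>\<mu>. \<forall>l<Suc k. \<exists>f\<^sub>0. P l \<mu> (f l) (g l) f\<^sub>0)"
    by (rule ae_circle_all_less) (use fg in \<open>simp add: f_def g_def\<close>)
  then have fg_all: "ae_circle (\<lambda>\<mu>. \<exists>f\<^sub>0. \<forall>l<Suc k. P l \<mu> (f l) (g l) (f\<^sub>0 l))"
    by (rule ae_circle_mono) (rule choice_less)
  define x where "x l z = upper (h l z - f l z)" for l z
  have x: "x l \<in> hardy_disc" for l
    unfolding x_def by (intro hardy_disc_parts hardy_disc_diff h f)
  obtain c y where c: "\<exists>l<Suc k. c l \<noteq> 0" and y: "y \<in> hardy_disc"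
    "\<And>z. z \<in> pg_domain W \<Longrightarrow> s21 ?R z *v (\<Sum>l<Suc k. c l *s x l z) = y z"
    using few_negative_squares_imp_finite_codim[OF \<Omega>(1-3,5) neg, where h = x] x by blast
  define X where "X z = (\<Sum>l<Suc k. c l *s x l z)" for z
  have X: "X \<in> hardy_disc" unfolding X_def by (intro hardy_disc_sum x)
  define f' where "f' z = in_upper (X z) + in_lower (y z)" for z
  have f': "f' \<in> hardy_disc" unfolding f'_def by (intro hardy_disc_combine X y(1))
  have point: "\<exists>y\<^sub>0. has_nt_limit f' \<mu> (in_upper (\<Sum>l<Suc k. c l *s upper (h l \<mu> - f\<^sub>0 l)) + in_lower y\<^sub>0) \<and>
      lower (?L \<mu> *v (in_upper (\<Sum>l<Suc k. c l *s upper (h l \<mu> - f\<^sub>0 l)) + in_lower y\<^sub>0)) = 0"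
    if \<mu>: "good_boundary_point W \<mu>" and f0: "\<And>l. l < Suc k \<Longrightarrow> has_nt_limit (f l) \<mu> (f\<^sub>0 l)" for \<mu> f\<^sub>0
  proof -
    have "has_nt_limit X \<mu> (\<Sum>l<Suc k. c l *s upper (h l \<mu> - f\<^sub>0 l))"
      unfolding X_def x_def by (intro has_nt_limit_sum has_nt_limit_parts has_nt_limit_diff h f0) simp
    then show ?thesis
      using s21_boundary[OF \<mu> _ y(2)[folded X_def]] unfolding f'_def by (blast intro: has_nt_limit_combine)
  qed
  have "ae_circle (\<lambda>\<mu>. \<exists>f\<^sub>0. has_nt_limit f' \<mu> f\<^sub>0 \<and> lower (?L \<mu> *v f\<^sub>0) = 0)"
  proof (rule ae_circle_mono[OF ae_circle_conj[OF U_class_boundary[OF W] fg_all]])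
    fix \<mu> :: complex
    assume A: "good_boundary_point W \<mu> \<and> (\<exists>f\<^sub>0. \<forall>l<Suc k. P l \<mu> (f l) (g l) (f\<^sub>0 l))"
    then obtain f\<^sub>0 where "\<And>l. l < Suc k \<Longrightarrow> has_nt_limit (f l) \<mu> (f\<^sub>0 l)" unfolding P_def by blast
    from point[OF conjunct1[OF A] this] show "\<exists>f\<^sub>0. has_nt_limit f' \<mu> f\<^sub>0 \<and> lower (?L \<mu> *v f\<^sub>0) = 0" by blast
  qed
  from lift_lower_zero[OF iii f' this]
  obtain g' where g': "g' \<in> hardy_disc" "ae_circle (\<lambda>\<mu>. has_nt_limit g' \<mu> (?L \<mu> *v nt_boundary f' \<mu>))" by blast
  define F where "F z = (\<Sum>l<Suc k. c l *s f l z) + f' z" for z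
  define G where "G z = (\<Sum>l<Suc k. c l *s g l z) + g' z" for z
  define H where "H z = (\<Sum>l<Suc k. c l *s h l z)" for z
  define K where "K z = in_upper (upper (G z)) + in_lower (lower (F z))" for z
  have FG: "F \<in> hardy_disc" "G \<in> hardy_disc" and H: "H \<in> hardy_disc"
    unfolding F_def G_def H_def by (intro hardy_disc_add hardy_disc_sum f f' g g' h)+
  have K: "K \<in> hardy_disc" unfolding K_def by (intro hardy_disc_combine hardy_disc_parts FG)
  have bd: "ae_circle (\<lambda>\<mu>. \<exists>k\<^sub>0. has_nt_limit K \<mu> k\<^sub>0 \<and> norm k\<^sub>0 = norm (H \<mu>) \<and> pgC (?L \<mu>) *v k\<^sub>0 = pgD (?L \<mu>) *v H \<mu>)"
  proof (rule ae_circle_mono[OF ae_circle_conj[OF U_class_boundary[OF W] ae_circle_conj[OF fg_all g'(2)]]])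
    fix \<mu> :: complex assume \<mu>: "norm \<mu> = 1"
    assume A: "good_boundary_point W \<mu> \<and> (\<exists>f\<^sub>0. \<forall>l<Suc k. P l \<mu> (f l) (g l) (f\<^sub>0 l)) \<and>
       has_nt_limit g' \<mu> (?L \<mu> *v nt_boundary f' \<mu>)"
    then obtain f\<^sub>0 where f0: "\<And>l. l < Suc k \<Longrightarrow> has_nt_limit (f l) \<mu> (f\<^sub>0 l)"
      "\<And>l. l < Suc k \<Longrightarrow> has_nt_limit (g l) \<mu> (?L \<mu> *v f\<^sub>0 l)"
      "\<And>l. l < Suc k \<Longrightarrow> lower (?L \<mu> *v f\<^sub>0 l) = lower (h l \<mu>)" unfolding P_def by blast
    obtain p where p: "has_nt_limit f' \<mu> p" "lower (?L \<mu> *v p) = 0"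
      "upper p = (\<Sum>l<Suc k. c l *s upper (h l \<mu> - f\<^sub>0 l))"
      using point[OF conjunct1[OF A] f0(1)] by fastforce
    have g'p: "has_nt_limit g' \<mu> (?L \<mu> *v p)" using A nt_boundary_eq[OF p(1) \<mu>] by simp
    define q where "q = (\<Sum>l<Suc k. c l *s f\<^sub>0 l) + p"
    have Lq: "?L \<mu> *v q = (\<Sum>l<Suc k. c l *s (?L \<mu> *v f\<^sub>0 l)) + ?L \<mu> *v p"
      unfolding q_def by (simp add: matrix_vector_right_distrib matrix_vector_cmult vec.linear_sum del: sum.lessThan_Suc)
    have Fq: "has_nt_limit F \<mu> q" unfolding F_def q_def by (intro has_nt_limit_add has_nt_limit_sum f0 p) simp
    have Gq: "has_nt_limit G \<mu> (?L \<mu> *v q)" unfolding G_def Lq by (intro has_nt_limit_add has_nt_limit_sum f0 g'p) simp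
    have up: "upper q = upper (H \<mu>)"
      by (simp add: q_def p(3) H_def parts_sum vec_eq_iff sum.distrib[symmetric] ring_distribs del: sum.lessThan_Suc)
    have lo: "lower (?L \<mu> *v q) = lower (H \<mu>)"
      unfolding Lq using f0(3) by (simp add: p(2) H_def parts_sum del: sum.lessThan_Suc)
    define k\<^sub>0 where "k\<^sub>0 = in_upper (upper (?L \<mu> *v q)) + in_lower (lower q)"
    have "has_nt_limit K \<mu> k\<^sub>0"
      unfolding K_def k\<^sub>0_def by (intro has_nt_limit_combine has_nt_limit_parts Fq Gq)
    moreover have "norm k\<^sub>0 = norm (H \<mu>)"
      unfolding k\<^sub>0_def using A by (subst j_unitary_norm) (auto simp: good_boundary_point_def up lo)
    moreover have "pgC (?L \<mu>) *v k\<^sub>0 = pgD (?L \<mu>) *v H \<mu>"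
      unfolding pg_relation by (simp add: k\<^sub>0_def up[symmetric] lo[symmetric])
    ultimately show "\<exists>k\<^sub>0. has_nt_limit K \<mu> k\<^sub>0 \<and> norm k\<^sub>0 = norm (H \<mu>) \<and> pgC (?L \<mu>) *v k\<^sub>0 = pgD (?L \<mu>) *v H \<mu>" by blast
  qed
  have Hn: "has_nt_limit H \<mu> (H \<mu>)" for \<mu> unfolding H_def by (intro has_nt_limit_sum h)
  have "pgS (?R z) *v H z = K z" if "z \<in> pg_domain W" for z
    by (rule pgS_boundary_relation[OF W H K _ that], rule ae_circle_mono[OF bd]) (use Hn in blast)
  moreover have "H z = (\<Sum>n<L. z ^ n *s (\<Sum>l<Suc k. c l *s b l n))" for z
    unfolding H_def h_def vec_eq_iff
    by (simp add: sum_component sum_distrib_left mult_ac sum.swap[of _ "{..<Suc k}"] del: sum.lessThan_Suc)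
  then have "(l2norm (hcoef K))\<^sup>2 \<le> (\<Sum>n<L. (norm (\<Sum>l<Suc k. c l *s b l n))\<^sup>2)"
    by (intro hardy_norm_le_polynomial[OF K] ae_circle_mono[OF bd]) auto
  ultimately show ?thesis using c K unfolding H_def h_def by blast
qed

section \<open>The number of negative squares of the lower left block\<close>

lemma schur_kernel_hermitian: "schur_kernel F w z = conj_transpose (schur_kernel F z w)"
proof (rule mat_eqI, rule hdot_eqI)
  fix y x
  have "hdot x (conj_transpose (schur_kernel F z w) *v y) = hdot (schur_kernel F z w *v x) y"
    by (rule conj_transpose_apply[symmetric])
  also have "\<dots> = hdot x (schur_kernel F w z *v y)"
    by (simp add: schur_kernel_apply conj_transpose_apply[where A = "F z"] hdot_mat[of x "F w"] mult.commute)
  finally show "hdot x (schur_kernel F w z *v y) = hdot x (conj_transpose (schur_kernel F z w) *v y)" by simp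
qed

theorem lemma4p8:
  fixes W :: "complex \<Rightarrow> complex^('p::finite + 'q::finite)^('p + 'q)"
    and b\<^sub>2 :: "complex \<Rightarrow> complex^'q^'q"
    and \<kappa> :: nat
  assumes "W \<in> U_class \<kappa>"
    and "inner_mvf b\<^sub>2"
    and iii: "\<And>f. f \<in> H2 \<Longrightarrow> (\<lambda>\<mu>. (zero_id :: complex^('p + 'q)^'q) *v bd_mult W f \<mu>) \<in> H2
                \<Longrightarrow> bd_mult W f \<in> H2"
    and iv: "ae_set_eq
               ((\<lambda>f \<mu>. (zero_id :: complex^('p + 'q)^'q) *v bd_mult W f \<mu>) ` H2)
               ((\<lambda>g \<mu>. matrix_inv (nt_boundary b\<^sub>2 \<mu>) *v g \<mu>) ` H2)"
  shows "s21 W \<in> schur_class \<kappa> \<and> W \<in> U_circ_class \<kappa>"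
proof -
  note W = assms(1)
  let ?R = "mvf_reg W" let ?S = "\<lambda>z. pgS (?R z)" let ?s = "mvf_reg (s21 W)" let ?H = "holomorphy_domain (s21 W)"
  note \<Omega> = pg_domain_facts[OF W]
  note hs = holomorphy_domain_facts[OF \<Omega>(6)]
  have HD: "?H \<subseteq> \<bbbD>" "holomorphy_domain W \<subseteq> \<bbbD>" by (auto simp: holomorphy_domain_def)
  have herm: "\<forall>z\<in>?H. \<forall>w\<in>?H. schur_kernel ?s w z = conj_transpose (schur_kernel ?s z w)"
    using schur_kernel_hermitian by blast
  have s_eq: "neg_dim_ge k n (kentry (schur_kernel ?s) w u) \<longleftrightarrow> neg_dim_ge k n (kentry (schur_kernel (s21 ?R)) w u)"
    if "\<And>i. i < n \<Longrightarrow> w i \<in> pg_domain W" for k n :: nat and w u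
    by (rule neg_dim_ge_cong) (simp add: kentry_def mvf_kernel_def \<Omega>(8) that)
  (* More than \<kappa> negative squares of the lower left block would give as many of the transform. *)
  have le: "num_neg_eigenvalues (gram_matrix (schur_kernel ?s) n w u) \<le> \<kappa>" if w: "\<forall>i<n. w i \<in> ?H" for n :: nat and w u
  proof (rule ccontr)
    assume "\<not> ?thesis"
    then have "neg_dim_ge (Suc \<kappa>) n (kentry (schur_kernel ?s) w u)"
      using neg_dim_ge_gram[OF herm, of n w "Suc \<kappa>" u] w by auto
    from neg_dim_ge_perturb_points[OF this _ HD(1) hs(1,3) \<Omega>(3)] w
    obtain w' where w': "\<forall>i<n. w' i \<in> pg_domain W" "neg_dim_ge (Suc \<kappa>) n (kentry (schur_kernel ?s) w' u)" by blast
    have "neg_dim_ge (Suc \<kappa>) n (kentry (schur_kernel (s21 ?R)) w' u)" using s_eq[of n w'] w' by blast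
    then have "neg_dim_ge (Suc \<kappa>) n (kentry (schur_kernel ?S) w' (\<lambda>i. in_lower (u i)))"
    proof (rule neg_dim_ge_lower_left[rotated 2])
      fix i assume i: "i < n"
      then have "Determinants.det (pgC (?R (w' i))) \<noteq> 0" using w'(1) by (simp add: pg_domain_def)
      then show "lower (?S (w' i) *v in_upper x) = s21 ?R (w' i) *v x" for x by (rule lower_pgS)
      show "norm (w' i) < 1" using w'(1) i \<Omega>(2) by auto
    qed
    then show False using pgS_few_negative_squares[OF W, of n w'] w'(1) by blast
  qed
  have ex: "\<exists>n w u. (\<forall>i<n. w i \<in> ?H) \<and> \<kappa> \<le> num_neg_eigenvalues (gram_matrix (schur_kernel ?s) n w u)"
  proof (cases \<kappa>)
    case (Suc k)
    have "\<exists>(n::nat) w u. (\<forall>i<n. w i \<in> pg_domain W) \<and> neg_dim_ge \<kappa> n (kentry (schur_kernel (s21 ?R)) w u)"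
    proof (rule ccontr)
      assume "\<not> ?thesis"
      then have neg: "\<not> neg_dim_ge (Suc k) n (kentry (schur_kernel (s21 ?R)) w u)"
        if "\<And>i. i < n \<Longrightarrow> w i \<in> pg_domain W" for n :: nat and w u
        using that Suc by blast
      (* Otherwise the transform would have fewer than \<kappa> negative squares too, while W has \<kappa>. *)
      have few: "\<not> neg_dim_ge (Suc k) n (kentry (schur_kernel ?S) w u)" if "\<And>i. i < n \<Longrightarrow> w i \<in> pg_domain W" for n :: nat and w u
        by (rule contractive_finite_codim_imp_few_negative_squares[OF pgS_contractive_finite_codim[OF W assms(2) iii iv neg] \<Omega>(2) that])
      have ns: "has_negative_squares \<kappa> (holomorphy_domain W) (mvf_kernel j_pq j_pq ?R)" and mW: "mvf_meromorphic W"
        using W by (auto simp: U_class_def)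
      note hW = holomorphy_domain_facts[OF mW]
      from ns obtain n w u where w: "\<forall>i<n. w i \<in> holomorphy_domain W"
        "num_neg_eigenvalues (gram_matrix (mvf_kernel j_pq j_pq ?R) n w u) = \<kappa>"
        unfolding has_negative_squares_def by blast
      have "neg_dim_ge \<kappa> n (kentry (mvf_kernel j_pq j_pq ?R) w u)"
      proof (rule iffD2[OF neg_dim_ge_gram[where \<Omega> = "holomorphy_domain W"]])
        show "\<forall>z\<in>holomorphy_domain W. \<forall>w\<in>holomorphy_domain W. mvf_kernel j_pq j_pq ?R w z = conj_transpose (mvf_kernel j_pq j_pq ?R z w)"
          using ns unfolding has_negative_squares_def by (rule conjunct1)
      qed (use w in simp_all)
      from neg_dim_ge_perturb_points[OF this _ HD(2) hW(1,3) \<Omega>(3)] w(1)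
      obtain w' where w': "\<forall>i<n. w' i \<in> pg_domain W" "neg_dim_ge \<kappa> n (kentry (mvf_kernel j_pq j_pq ?R) w' u)" by blast
      have "neg_dim_ge \<kappa> n (kentry (schur_kernel ?S) w' (\<lambda>i. conj_transpose (pgC (?R (w' i))) *v u i))"
        using w'(2)
      proof (rule iffD1[OF neg_dim_ge_cong, rotated])
        show "kentry (mvf_kernel j_pq j_pq ?R) w' u i j =
            kentry (schur_kernel ?S) w' (\<lambda>i. conj_transpose (pgC (?R (w' i))) *v u i) i j" if "i < n" "j < n" for i j
          by (rule pg_kernel_congruence[where n = n]) (use w'(1) that in \<open>auto simp: pg_domain_def\<close>)
      qed
      then show False using few[of n w'] w'(1) Suc by blast
    qed
    then obtain n w u where w: "\<forall>i<n. w i \<in> pg_domain W" "neg_dim_ge \<kappa> n (kentry (schur_kernel (s21 ?R)) w u)" by blast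
    then have wH: "\<forall>i<n. w i \<in> ?H" using \<Omega>(7) by blast
    then have "\<kappa> \<le> num_neg_eigenvalues (gram_matrix (schur_kernel ?s) n w u)"
      using neg_dim_ge_gram[OF herm, of n w \<kappa> u] s_eq[of n w] w by blast
    then show ?thesis using wH by blast
  qed (auto intro: exI[of _ 0])
  have "has_negative_squares \<kappa> ?H (schur_kernel ?s)"
    unfolding has_negative_squares_def using herm le ex by (meson le_antisym)
  then have "s21 W \<in> schur_class \<kappa>" using \<Omega>(6) by (simp add: schur_class_def)
  then show ?thesis using W by (simp add: U_circ_class_def)
qed

end
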